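(* For every $\Sigma^1_1$ set $P \subseteq \mathbb{N}$ there exist a finite alphabet $S$ and a cellular automaton $f$ on the full shift $S^{\mathbb{Z}}$ such that $P$ is many-one reducible to the language of the nonwandering set $\mathcal{N}(f)$. In particular, there exists a cellular automaton on a full shift whose nonwandering set has a $\Sigma^1_1$-complete language.
   Context: A cellular automaton on $X = S^{\mathbb{Z}}$ (product topology) is a continuous shift-commuting map $f: X \to X$. The nonwandering set of $f$ is $\mathcal{N}(f) = \{x \in X \mid x \in \bigcap_{n \in \mathbb{N}} \overline{\bigcup_{k \geq n} \{f^k(x)\}}\}$. The language of $Y \subseteq S^{\mathbb{Z}}$ is the set of words $w \in S^*$ with $w = y_{[0,k-1]}$ for some $y\in Y$, $k \in \mathbb{N}$, viewed as a subset of $\mathbb{N}$ via a computable bijection. A set $P \subseteq \mathbb{N}$ is $\Sigma^1_1$ if $w \in P \iff (\exists C \subseteq \mathbb{N})(\forall m \in \mathbb{N})(\exists \ell \in \mathbb{N}) R(C,m,\ell,w)$ for some recursive predicate $R$; it is $\Sigma^1_1$-complete if it is $\Sigma^1_1$ and every $\Sigma^1_1$ set many-one (computably) reduces to it. *)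

theory Defs
  imports "HOL-Analysis.Analysis"
begin

text \<open>Total functions of type nat set => nat list => nat computable by an oracle
machine with oracle C, total for every oracle (Kleene's mu-recursive schema
relativised to an oracle; arguments are given as a list, missing arguments read as 0).\<close>

definition arg :: "nat list \<Rightarrow> nat \<Rightarrow> nat" where
  "arg xs i = (if i < length xs then xs ! i else 0)"

definition prim_rec_op ::
  "(nat set \<Rightarrow> nat list \<Rightarrow> nat) \<Rightarrow> (nat set \<Rightarrow> nat list \<Rightarrow> nat) \<Rightarrow> nat set \<Rightarrow> nat list \<Rightarrow> nat" where
  "prim_rec_op G H C xs =
     rec_nat (G C (drop 1 xs)) (\<lambda>n r. H C (r # n # drop 1 xs)) (arg xs 0)"

inductive orec :: "(nat set \<Rightarrow> nat list \<Rightarrow> nat) \<Rightarrow> bool" where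
  zero: "orec (\<lambda>C xs. 0)"
| succ: "orec (\<lambda>C xs. Suc (arg xs 0))"
| proj: "orec (\<lambda>C xs. arg xs i)"
| orc: "orec (\<lambda>C xs. if arg xs 0 \<in> C then 1 else 0)"
| comp: "orec G \<Longrightarrow> (\<forall>H\<in>set Hs. orec H) \<Longrightarrow> orec (\<lambda>C xs. G C (map (\<lambda>H. H C xs) Hs))"
| prec: "orec G \<Longrightarrow> orec H \<Longrightarrow> orec (prim_rec_op G H)"
| mu: "orec G \<Longrightarrow> (\<forall>C xs. \<exists>n. G C (n # xs) = 0) \<Longrightarrow> orec (\<lambda>C xs. LEAST n. G C (n # xs) = 0)"

definition computable1 :: "(nat \<Rightarrow> nat) \<Rightarrow> bool" where
  "computable1 g \<longleftrightarrow> (\<exists>F. orec F \<and> (\<forall>C n. F C [n] = g n))"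

definition many_one_reducible :: "nat set \<Rightarrow> nat set \<Rightarrow> bool" where
  "many_one_reducible A B \<longleftrightarrow> (\<exists>g. computable1 g \<and> (\<forall>w. w \<in> A \<longleftrightarrow> g w \<in> B))"

definition Sigma11 :: "nat set \<Rightarrow> bool" where
  "Sigma11 P \<longleftrightarrow> (\<exists>F. orec F \<and>
     (\<forall>w. w \<in> P \<longleftrightarrow> (\<exists>C::nat set. \<forall>m. \<exists>l. F C [m, l, w] = 0)))"

definition Sigma11_complete :: "nat set \<Rightarrow> bool" where
  "Sigma11_complete P \<longleftrightarrow> Sigma11 P \<and> (\<forall>Q. Sigma11 Q \<longrightarrow> many_one_reducible Q P)"

text \<open>The alphabet is S = {0..<k}; the full shift is the set of configurations
int => nat with values below k, carrying the (subspace of the) product topology.\<close>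
definition full_shift :: "nat \<Rightarrow> (int \<Rightarrow> nat) set" where
  "full_shift k = {x. \<forall>i. x i < k}"

definition shift_map :: "(int \<Rightarrow> nat) \<Rightarrow> (int \<Rightarrow> nat)" where
  "shift_map x = (\<lambda>i. x (i + 1))"

definition cellular_automaton :: "nat \<Rightarrow> ((int \<Rightarrow> nat) \<Rightarrow> (int \<Rightarrow> nat)) \<Rightarrow> bool" where
  "cellular_automaton k f \<longleftrightarrow>
     f ` full_shift k \<subseteq> full_shift k \<and>
     continuous_on (full_shift k) f \<and>
     (\<forall>x\<in>full_shift k. f (shift_map x) = shift_map (f x))"

definition nonwandering :: "((int \<Rightarrow> nat) \<Rightarrow> (int \<Rightarrow> nat)) \<Rightarrow> (int \<Rightarrow> nat) set \<Rightarrow> (int \<Rightarrow> nat) set" where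
  "nonwandering f X = {x\<in>X. \<forall>n. x \<in> closure {(f ^^ j) x | j. j \<ge> n}}"

text \<open>Computable bijection between words over {0..<k} (k >= 1) and nat:
bijective base-k numeration.\<close>
fun word_code :: "nat \<Rightarrow> nat list \<Rightarrow> nat" where
  "word_code k [] = 0"
| "word_code k (a # w) = Suc a + k * word_code k w"

definition language :: "nat \<Rightarrow> (int \<Rightarrow> nat) set \<Rightarrow> nat set" where
  "language k Y = word_code k ` {map (\<lambda>i. y (int i)) [0..<n] | y n. y \<in> Y}"

end

theory Submission
  imports Defs "HOL-Library.Nat_Bijection"
begin

text \<open>
  A \<open>\<Sigma>\<^sup>1\<^sub>1\<close> set consists of all \<open>w\<close> for which there are functions \<open>f\<^sub>0, f\<^sub>1, \<dots>\<close> on the natural numbers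
  with \<open>f\<^sub>0 0 = w\<close> and \<open>f\<^sub>1 n = n + 1\<close> that satisfy finitely many conditional equations
  \<open>f\<^sub>i (f\<^sub>j n) = f\<^sub>k n\<close>: the functions code the oracle, the witnesses and the values of all
  subcomputations. Such functions are written on a half-line as an infinite sequence of blocks, the
  \<open>n\<close>-th of which contains \<open>f\<^sub>0 n, f\<^sub>1 n, \<dots>\<close> in unary. A single head runs a binary counter with
  one digit per block and, whenever a carry stops at block \<open>n\<close>, checks the equations at \<open>n\<close>; it
  never returns to its starting point if a check fails or no further block exists. If it returns
  infinitely often, then the carry reaches every block, so all equations hold. Conversely, if all
  equations hold, then the carry stopping at block \<open>n\<close> for the first time leaves everything to the
  left of this block in its initial state, so the configuration recurs. As the lengths of the blocks
  are unbounded, no compactness argument makes the condition arithmetical.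

  Recurrence of a point of a cellular automaton is itself a \<open>\<Sigma>\<^sup>1\<^sub>1\<close> condition, and there is a
  universal system of equations; its automaton has a complete language.
\<close>

text \<open>A word of the language fixes only finitely many cells; the rest of the configuration is
  arbitrary and may contain stray marks, walls, unsorted blocks and further heads. So one direction
  must extract everything from the returns of a single cell, the one where the head starts, while
  the other may use a clean tape of its choice. This asymmetry explains why each operation is
  analysed twice, why unexpected marks halt the head, and why cells carry side markers that keep
  other heads out. Equations of depth two are chosen because pointer marks can evaluate them: a
  value v is represented by the v-th block, so applying a function means moving a pointer by as many
  blocks as another block has letters of one kind, and equality of values means that two pointers
  meet. The counter reconciles infinitely many checks with recurrence: after 2^n increments from
  zero only digit n is set, and block n starts to the right of cell n.\<close>

lemma arg_simps [simp]:
  "arg [] i = 0" "arg (x # xs) 0 = x" "arg (x # xs) (Suc i) = arg xs i"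
  "arg (x # xs) (numeral n) = arg xs (pred_numeral n)"
  by (simp_all add: arg_def numeral_eq_Suc)

lemma arg_drop1: "arg (drop 1 xs) i = arg xs (Suc i)"
  by (cases xs) (auto simp: arg_def)

section \<open>Closure properties of the oracle recursive functions\<close>

lemma orec_arg: "orec (\<lambda>C xs. arg xs i)"
  by (rule orec.proj)

lemma orec_comp1: "orec G \<Longrightarrow> orec A \<Longrightarrow> orec (\<lambda>C xs. G C [A C xs])"
  using orec.comp[of G "[A]"] by simp

lemma orec_comp2: "orec G \<Longrightarrow> orec A \<Longrightarrow> orec B \<Longrightarrow> orec (\<lambda>C xs. G C [A C xs, B C xs])"
  using orec.comp[of G "[A, B]"] by simp

lemma orec_Suc: "orec A \<Longrightarrow> orec (\<lambda>C xs. Suc (A C xs))"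
  using orec_comp1[OF orec.succ] by simp

lemma orec_const: "orec (\<lambda>C xs. n)"
  by (induction n) (auto intro: orec.zero orec_Suc)

lemma orec_rec:
  assumes "orec (\<lambda>C xs. g C (arg xs 0))" "orec (\<lambda>C xs. h C (arg xs 0) (arg xs 1) (arg xs 2))"
    and "orec A" "orec B"
  shows "orec (\<lambda>C xs. rec_nat (g C (B C xs)) (\<lambda>n r. h C r n (B C xs)) (A C xs))"
  using orec_comp2[OF orec.prec[OF assms(1,2)] assms(3,4)]
  by (simp add: prim_rec_op_def numeral_2_eq_2)

lemma orec_add: "orec A \<Longrightarrow> orec B \<Longrightarrow> orec (\<lambda>C xs. A C xs + B C xs)"
proof -
  assume ab: "orec A" "orec B"
  have "rec_nat b (\<lambda>n r. Suc r) a = a + b" for a b :: nat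
    by (induction a) auto
  then show ?thesis
    using orec_rec[of "\<lambda>C x. x" "\<lambda>C r n x. Suc r", OF orec_arg orec_Suc[OF orec_arg] ab] by simp
qed

lemma orec_mult: "orec A \<Longrightarrow> orec B \<Longrightarrow> orec (\<lambda>C xs. A C xs * B C xs)"
proof -
  assume ab: "orec A" "orec B"
  have "rec_nat 0 (\<lambda>n r. r + b) a = a * b" for a b :: nat
    by (induction a) auto
  then show ?thesis
    using orec_rec[of "\<lambda>C x. 0" "\<lambda>C r n x. r + x", OF orec_const orec_add[OF orec_arg orec_arg] ab]
    by simp
qed

lemma orec_pred: "orec A \<Longrightarrow> orec (\<lambda>C xs. A C xs - 1)"
proof -
  assume a: "orec A"
  have "rec_nat 0 (\<lambda>n r. n) a = a - 1" for a :: nat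
    by (cases a) auto
  then show ?thesis
    using orec_rec[of "\<lambda>C x. 0" "\<lambda>C r n x. n", OF orec_const orec_arg a a] by simp
qed

lemma orec_diff: "orec A \<Longrightarrow> orec B \<Longrightarrow> orec (\<lambda>C xs. A C xs - B C xs)"
proof -
  assume ab: "orec A" "orec B"
  have "rec_nat b (\<lambda>n r. r - 1) a = b - a" for a b :: nat
    by (induction a) auto
  then show ?thesis
    using orec_rec[of "\<lambda>C x. x" "\<lambda>C r n x. r - 1", OF orec_arg orec_pred[OF orec_arg] ab(2,1)] by simp
qed

text \<open>Truth is the value 0, as in the \<open>mu\<close> scheme and in the matrix of
  \<open>Sigma11\<close>.\<close>

definition orecP :: "(nat set \<Rightarrow> nat list \<Rightarrow> bool) \<Rightarrow> bool" where
  "orecP p \<longleftrightarrow> orec (\<lambda>C xs. if p C xs then 0 else 1)"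

lemma orecP_eq0: "orec A \<Longrightarrow> orecP (\<lambda>C xs. A C xs = 0)"
proof -
  assume a: "orec A"
  have "(\<lambda>C xs. 1 - (1 - A C xs)) = (\<lambda>C xs. if A C xs = 0 then 0 else 1)"
    by (auto simp: fun_eq_iff)
  then show ?thesis
    unfolding orecP_def using orec_diff[OF orec_const orec_diff[OF orec_const a], of 1 1] by simp
qed

lemma orecP_cong: "orec A \<Longrightarrow> (\<And>C xs. p C xs \<longleftrightarrow> A C xs = 0) \<Longrightarrow> orecP p"
proof -
  assume "orec A" and p: "\<And>C xs. p C xs \<longleftrightarrow> A C xs = 0"
  have "p = (\<lambda>C xs. A C xs = 0)" by (simp add: fun_eq_iff p)
  then show ?thesis using orecP_eq0[OF \<open>orec A\<close>] by simp
qed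

lemma orecP_not: "orecP p \<Longrightarrow> orecP (\<lambda>C xs. \<not> p C xs)"
  unfolding orecP_def[of p]
  by (rule orecP_cong[OF orec_diff[OF orec_const[of 1], of "\<lambda>C xs. if p C xs then 0 else 1"]])
    (auto split: if_splits)

lemma orecP_conj: "orecP p \<Longrightarrow> orecP q \<Longrightarrow> orecP (\<lambda>C xs. p C xs \<and> q C xs)"
  unfolding orecP_def[of p] orecP_def[of q]
  by (rule orecP_cong[OF orec_add[of "\<lambda>C xs. if p C xs then 0 else 1" "\<lambda>C xs. if q C xs then 0 else 1"]])
    (auto split: if_splits)

lemma orecP_disj: "orecP p \<Longrightarrow> orecP q \<Longrightarrow> orecP (\<lambda>C xs. p C xs \<or> q C xs)"
  unfolding orecP_def[of p] orecP_def[of q]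
  by (rule orecP_cong[OF orec_mult[of "\<lambda>C xs. if p C xs then 0 else 1" "\<lambda>C xs. if q C xs then 0 else 1"]])
    (auto split: if_splits)

lemma orecP_imp: "orecP p \<Longrightarrow> orecP q \<Longrightarrow> orecP (\<lambda>C xs. p C xs \<longrightarrow> q C xs)"
  unfolding imp_conv_disj by (intro orecP_disj orecP_not)

lemma orecP_le: "orec A \<Longrightarrow> orec B \<Longrightarrow> orecP (\<lambda>C xs. A C xs \<le> B C xs)"
  by (rule orecP_cong[OF orec_diff[of A B]]) auto

lemma orecP_less: "orec A \<Longrightarrow> orec B \<Longrightarrow> orecP (\<lambda>C xs. A C xs < B C xs)"
  unfolding Suc_le_eq[symmetric] by (intro orecP_le orec_Suc)

lemma orecP_eq: "orec A \<Longrightarrow> orec B \<Longrightarrow> orecP (\<lambda>C xs. A C xs = B C xs)"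
  unfolding order_eq_iff by (intro orecP_conj orecP_le)

lemma orecP_mem: "orec A \<Longrightarrow> orecP (\<lambda>C xs. A C xs \<in> C)"
proof -
  assume "orec A"
  then have "orec (\<lambda>C xs. 1 - (if A C xs \<in> C then 1 else 0))"
    using orec_diff[OF orec_const orec_comp1[OF orec.orc], of A 1] by simp
  then show ?thesis by (rule orecP_cong) auto
qed

lemma orecP_comp2:
  "orecP p \<Longrightarrow> orec A \<Longrightarrow> orec B \<Longrightarrow> orecP (\<lambda>C xs. p C [A C xs, B C xs])"
  unfolding orecP_def using orec_comp2[of "\<lambda>C xs. if p C xs then 0 else 1"] by simp

lemma orec_if:
  assumes "orecP p" "orec A" "orec B"
  shows "orec (\<lambda>C xs. if p C xs then A C xs else B C xs)"
proof -
  have "(\<lambda>C xs. (1 - (if p C xs then 0 else 1)) * A C xs + (if p C xs then 0 else 1) * B C xs)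
      = (\<lambda>C xs. if p C xs then A C xs else B C xs)"
    by (auto simp: fun_eq_iff)
  then show ?thesis
    using orec_add[OF orec_mult[OF orec_diff[OF orec_const[of 1] assms(1)[unfolded orecP_def]] assms(2)]
        orec_mult[OF assms(1)[unfolded orecP_def] assms(3)]] by simp
qed

text \<open>A nest of finitely many case distinctions computes \<open>g\<close>; the induction peels
  off the last argument where \<open>g\<close> may be nonzero. This makes an arbitrary local rule on
  a finite alphabet recursive.\<close>

lemma orec_finite_table:
  assumes "orec A" "\<And>n. n \<ge> N \<Longrightarrow> g n = 0"
  shows "orec (\<lambda>C xs. g (A C xs))"
  using assms(2)
proof (induction N arbitrary: g)
  case 0
  then show ?case by (simp add: orec_const)
next
  case (Suc N)
  have "orec (\<lambda>C xs. (g(N := 0)) (A C xs))"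
    by (rule Suc.IH) (use Suc.prems in \<open>auto simp: le_Suc_eq Suc_le_eq\<close>)
  then have "orec (\<lambda>C xs. if A C xs = N then g N else (g(N := 0)) (A C xs))"
    by (intro orec_if orecP_eq assms(1) orec_const)
  moreover have "(\<lambda>C xs. if A C xs = N then g N else (g(N := 0)) (A C xs)) = (\<lambda>C xs. g (A C xs))"
    by (auto simp: fun_eq_iff)
  ultimately show ?case by simp
qed

lemma orec_funpow:
  assumes "orec (\<lambda>C xs. g (arg xs 0))" "orec A" "orec B"
  shows "orec (\<lambda>C xs. (g ^^ A C xs) (B C xs))"
proof -
  have "rec_nat b (\<lambda>n r. g r) a = (g ^^ a) b" for a b
    by (induction a) auto
  then show ?thesis
    using orec_rec[of "\<lambda>C x. x" "\<lambda>C r n x. g r", OF orec_arg assms] by simp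
qed

section \<open>Computability of Cantor pairing and of binary digits\<close>

lemma orec_triangle: "orec A \<Longrightarrow> orec (\<lambda>C xs. triangle (A C xs))"
proof -
  assume a: "orec A"
  have "rec_nat 0 (\<lambda>n r. r + Suc n) a = triangle a" for a
    by (induction a) auto
  then show ?thesis
    using orec_rec[of "\<lambda>C x. 0" "\<lambda>C r n x. r + Suc n",
        OF orec_const orec_add[OF orec_arg orec_Suc[OF orec_arg]] a a] by simp
qed

lemma orec_prod_encode: "orec A \<Longrightarrow> orec B \<Longrightarrow> orec (\<lambda>C xs. prod_encode (A C xs, B C xs))"
  unfolding prod_encode_def by (simp add: orec_add orec_triangle)

text \<open>The index of the Cantor diagonal through \<open>n\<close>, that is the largest
  \<open>d\<close> with \<open>triangle d <= n\<close>. Walking along the diagonals gives it by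
  primitive recursion, and both projections follow from it by subtraction.\<close>

definition diagonal :: "nat \<Rightarrow> nat" where
  "diagonal = rec_nat 0 (\<lambda>n r. if triangle (Suc r) \<le> Suc n then Suc r else r)"

lemma diagonal_bounds: "triangle (diagonal n) \<le> n \<and> n < triangle (Suc (diagonal n))"
  by (induction n) (auto simp: diagonal_def)

lemma triangle_mono: "m \<le> n \<Longrightarrow> triangle m \<le> triangle n"
  by (rule lift_Suc_mono_le[of triangle]) auto

lemma diagonal_prod_encode: "diagonal (prod_encode (a, b)) = a + b"
proof -
  let ?d = "diagonal (prod_encode (a, b))"
  have 1: "triangle ?d \<le> triangle (a + b) + a" "triangle (a + b) + a < triangle (Suc ?d)"
    using diagonal_bounds[of "prod_encode (a, b)"] by (auto simp: prod_encode_def)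
  have "\<not> Suc ?d \<le> a + b" using triangle_mono[of "Suc ?d" "a + b"] 1(2) by linarith
  moreover have "\<not> Suc (a + b) \<le> ?d" using triangle_mono[of "Suc (a + b)" ?d] 1(1) by auto
  ultimately show ?thesis by linarith
qed

lemma orec_diagonal: "orec A \<Longrightarrow> orec (\<lambda>C xs. diagonal (A C xs))"
proof -
  assume a: "orec A"
  have "orec (\<lambda>C xs. if triangle (Suc (arg xs 0)) \<le> Suc (arg xs 1) then Suc (arg xs 0) else arg xs 0)"
    by (intro orec_if orecP_le orec_triangle orec_Suc orec_arg)
  from orec_rec[of "\<lambda>C x. 0" "\<lambda>C r n x. if triangle (Suc r) \<le> Suc n then Suc r else r",
      OF orec_const this a a]
  show ?thesis unfolding diagonal_def .
qed

definition pfst :: "nat \<Rightarrow> nat" where "pfst n = fst (prod_decode n)"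
definition psnd :: "nat \<Rightarrow> nat" where "psnd n = snd (prod_decode n)"

lemma pfst_prod_encode [simp]: "pfst (prod_encode (a, b)) = a"
  and psnd_prod_encode [simp]: "psnd (prod_encode (a, b)) = b"
  and prod_encode_pfst_psnd [simp]: "prod_encode (pfst n, psnd n) = n"
  by (simp_all add: pfst_def psnd_def)

lemma orec_pfst: "orec A \<Longrightarrow> orec (\<lambda>C xs. pfst (A C xs))"
proof -
  assume a: "orec A"
  have "pfst n = n - triangle (diagonal n)" for n
    using diagonal_prod_encode[of "pfst n" "psnd n"] fun_cong[OF prod_encode_def, of "(pfst n, psnd n)"] by simp
  then show ?thesis using orec_diff[OF a orec_triangle[OF orec_diagonal[OF a]]] by simp
qed

lemma orec_psnd: "orec A \<Longrightarrow> orec (\<lambda>C xs. psnd (A C xs))"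
proof -
  assume a: "orec A"
  have "psnd n = diagonal n - pfst n" for n
    using diagonal_prod_encode[of "pfst n" "psnd n"] by simp
  then show ?thesis using orec_diff[OF orec_diagonal[OF a] orec_pfst[OF a]] by simp
qed

lemma orec_parity: "orec A \<Longrightarrow> orec (\<lambda>C xs. A C xs mod 2)"
proof -
  assume a: "orec A"
  have "rec_nat 0 (\<lambda>n r. 1 - r) a = a mod 2" for a :: nat
    by (induction a) (auto simp: mod_Suc)
  then show ?thesis
    using orec_rec[of "\<lambda>C x. 0" "\<lambda>C r n x. 1 - r", OF orec_const orec_diff[OF orec_const orec_arg] a a]
    by simp
qed

lemma orec_half: "orec A \<Longrightarrow> orec (\<lambda>C xs. A C xs div 2)"
proof -
  assume a: "orec A"
  have "rec_nat 0 (\<lambda>n r. r + n mod 2) a = a div 2" for a :: nat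
    by (induction a) (auto, presburger)
  then show ?thesis
    using orec_rec[of "\<lambda>C x. 0" "\<lambda>C r n x. r + n mod 2",
        OF orec_const orec_add[OF orec_arg orec_parity[OF orec_arg]] a a]
    by simp
qed

lemma orecP_set_decode: "orec A \<Longrightarrow> orec B \<Longrightarrow> orecP (\<lambda>C xs. A C xs \<in> set_decode (B C xs))"
proof -
  assume ab: "orec A" "orec B"
  have "((\<lambda>x. x div 2) ^^ a) b = b div 2 ^ a" for a b :: nat
  proof (induction a)
    case (Suc a)
    then show ?case by (simp add: div_mult2_eq[symmetric] mult.commute)
  qed simp
  then have "orec (\<lambda>C xs. 1 - (B C xs div 2 ^ A C xs) mod 2)"
    using orec_diff[OF orec_const orec_parity[OF orec_funpow[OF orec_half[OF orec_arg] ab]]] by simp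
  then show ?thesis
    by (rule orecP_cong) (auto simp: set_decode_def odd_iff_mod_2_eq_one)
qed

lemmas orec_intros =
  orec_arg orec_const orec_Suc orec_add orec_mult orec_diff orec_prod_encode orec_pfst orec_psnd
  orecP_not orecP_conj orecP_disj orecP_imp orecP_le orecP_less orecP_eq orecP_mem orecP_set_decode
  orec_if

text \<open>Every scheme reads its arguments through \<open>arg\<close> only, so trailing zeros are
  invisible. Hence codes of argument lists need to be correct only up to such zeros.\<close>

lemma orec_arg_cong: "orec F \<Longrightarrow> arg xs = arg ys \<Longrightarrow> F C xs = F C ys"
proof (induction F arbitrary: xs ys rule: orec.induct)
  case (comp G Hs)
  then have "map (\<lambda>H. H C xs) Hs = map (\<lambda>H. H C ys) Hs" by auto
  then show ?case by (simp only:)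
next
  case (prec G H)
  have d: "arg (drop 1 xs) = arg (drop 1 ys)"
    by (rule ext) (simp only: arg_drop1 prec.prems)
  have "arg (a # b # drop 1 xs) = arg (a # b # drop 1 ys)" for a b
  proof
    fix i show "arg (a # b # drop 1 xs) i = arg (a # b # drop 1 ys) i"
      using fun_cong[OF d] by (cases i; cases "i - 1") auto
  qed
  then have "H C (a # b # drop 1 xs) = H C (a # b # drop 1 ys)" for a b by (rule prec.IH(2))
  then show ?case using prec.IH(1)[OF d] prec.prems by (simp add: prim_rec_op_def)
next
  case (mu G)
  have "arg (n # xs) = arg (n # ys)" for n
  proof
    fix i show "arg (n # xs) i = arg (n # ys) i" using mu.prems by (cases i) auto
  qed
  then have "G C (n # xs) = G C (n # ys)" for n by (rule mu.IH)
  then show ?case by simp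
qed simp_all

section \<open>Quantifying over functions instead of sets\<close>

definition graph :: "(nat \<Rightarrow> nat) \<Rightarrow> nat set" where
  "graph f = {prod_encode (a, f a) | a. True}"

lemma prod_encode_in_graph [simp]: "prod_encode (a, b) \<in> graph f \<longleftrightarrow> b = f a"
  by (auto simp: graph_def)

lemma graphI:
  assumes "\<And>a. \<exists>b. prod_encode (a, b) \<in> C"
    and "\<And>a b b'. prod_encode (a, b) \<in> C \<Longrightarrow> prod_encode (a, b') \<in> C \<Longrightarrow> b = b'"
  shows "\<exists>f. C = graph f"
proof -
  obtain f where f: "\<And>a. prod_encode (a, f a) \<in> C" using assms(1) by metis
  have "n \<in> C \<longleftrightarrow> n \<in> graph f" for n
  proof -
    have "prod_encode (pfst n, psnd n) \<in> C \<longleftrightarrow> prod_encode (pfst n, psnd n) \<in> graph f"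
      using f assms(2) by (auto simp del: prod_encode_pfst_psnd)
    then show ?thesis by simp
  qed
  then show ?thesis by blast
qed

text \<open>The set quantified in \<open>Sigma11\<close> is forced to be a graph: the inner
  existential quantifier is spent on totality at \<open>?m2\<close>, and uniqueness, the agreement
  of \<open>?m3\<close> and \<open>?m4\<close>, is universal. No existential quantifier is left for
  \<open>R\<close>; witnesses can be values of the function instead.\<close>

lemma Sigma11I:
  assumes R: "orecP R" and P: "\<And>w. w \<in> P \<longleftrightarrow> (\<exists>f. \<forall>m. R (graph f) [m, w])"
  shows "Sigma11 P"
proof -
  let ?m1 = "\<lambda>xs. pfst (arg xs 0)" and ?m2 = "\<lambda>xs. pfst (psnd (arg xs 0))"
  let ?m3 = "\<lambda>xs. pfst (psnd (psnd (arg xs 0)))" and ?m4 = "\<lambda>xs. psnd (psnd (psnd (arg xs 0)))"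
  define Q where "Q = (\<lambda>C xs. R C [?m1 xs, arg xs 2] \<and> prod_encode (?m2 xs, arg xs 1) \<in> C \<and>
    (prod_encode (?m2 xs, ?m3 xs) \<in> C \<and> prod_encode (?m2 xs, ?m4 xs) \<in> C \<longrightarrow> ?m3 xs = ?m4 xs))"
  have "orecP Q" unfolding Q_def by (intro orec_intros orecP_comp2[OF R])
  then have "orec (\<lambda>C xs. if Q C xs then 0 else 1)" unfolding orecP_def .
  moreover have "w \<in> P \<longleftrightarrow> (\<exists>C. \<forall>m. \<exists>l. (if Q C [m, l, w] then 0 else 1::nat) = 0)" for w
  proof
    assume "w \<in> P"
    then obtain f where "\<forall>m. R (graph f) [m, w]" using P by blast
    then show "\<exists>C. \<forall>m. \<exists>l. (if Q C [m, l, w] then 0 else 1::nat) = 0"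
      by (intro exI[of _ "graph f"]) (auto simp: Q_def)
  next
    assume "\<exists>C. \<forall>m. \<exists>l. (if Q C [m, l, w] then 0 else 1::nat) = 0"
    then obtain C where "\<forall>m. \<exists>l. (if Q C [m, l, w] then 0 else 1::nat) = 0" by blast
    then have C: "\<exists>l. Q C [m, l, w]" for m
      by (metis zero_neq_one)
    have "\<exists>l. Q C [prod_encode (a, prod_encode (b, prod_encode (c, d))), l, w]" for a b c d
      by (rule C)
    then have *: "\<exists>l. R C [a, w] \<and> prod_encode (b, l) \<in> C \<and>
      (prod_encode (b, c) \<in> C \<and> prod_encode (b, d) \<in> C \<longrightarrow> c = d)" for a b c d
      unfolding Q_def by simp
    obtain f where "C = graph f" using graphI[of C] * by metis
    then show "w \<in> P" using P * by metis
  qed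
  ultimately show ?thesis unfolding Sigma11_def by blast
qed

section \<open>A normal form by systems of functional equations\<close>

type_synonym eqn = "bool \<times> nat \<times> nat \<times> nat \<times> nat"

definition holds :: "(nat \<Rightarrow> nat \<Rightarrow> nat) \<Rightarrow> eqn set \<Rightarrow> bool" where
  "holds f E \<longleftrightarrow> (\<forall>(b, c, i, j, k)\<in>E. \<forall>n. (f c n = 0) = b \<longrightarrow> f i (f j n) = f k n)"

definition solvable :: "eqn set \<Rightarrow> nat \<Rightarrow> bool" where
  "solvable E w \<longleftrightarrow> (\<exists>f. f 0 0 = w \<and> f 1 = Suc \<and> holds f E)"

definition below :: "nat \<Rightarrow> eqn set \<Rightarrow> bool" where
  "below s E \<longleftrightarrow> (\<forall>(b, c, i, j, k)\<in>E. c < s \<and> i < s \<and> j < s \<and> k < s)"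

text \<open>Both truth values of the condition are listed, so every \<open>n\<close> falls under one
  of the two conditional equations.\<close>

definition always :: "nat \<Rightarrow> nat \<Rightarrow> nat \<Rightarrow> eqn set" where
  "always i j k = {(True, 3, i, j, k), (False, 3, i, j, k)}"

lemma holds_Un [simp]: "holds f (A \<union> B) \<longleftrightarrow> holds f A \<and> holds f B"
  by (simp add: holds_def ball_Un)

lemma holds_always [simp]: "holds f (always i j k) \<longleftrightarrow> (\<forall>n. f i (f j n) = f k n)"
  by (auto simp: holds_def always_def)

lemma holds_insert [simp]:
  "holds f (insert (b, c, i, j, k) E) \<longleftrightarrow>
    (\<forall>n. (f c n = 0) = b \<longrightarrow> f i (f j n) = f k n) \<and> holds f E"
  by (simp add: holds_def)

lemma holds_empty [simp]: "holds f {}"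
  by (simp add: holds_def)

lemma holds_alwaysD: "holds f E \<Longrightarrow> always i j k \<subseteq> E \<Longrightarrow> f i (f j n) = f k n"
  by (metis holds_Un holds_always sup.absorb_iff1)

lemma holdsD:
  assumes "holds f E" "(b, c, i, j, k) \<in> E" "(f c n = 0) = b"
  shows "f i (f j n) = f k n"
  using bspec[OF assms(1)[unfolded holds_def] assms(2)] assms(3) by simp

lemma holds_TrueD: "holds f E \<Longrightarrow> (True, c, i, j, k) \<in> E \<Longrightarrow> f c n = 0 \<Longrightarrow> f i (f j n) = f k n"
  by (rule holdsD[of f E True]) simp_all

lemma holds_FalseD: "holds f E \<Longrightarrow> (False, c, i, j, k) \<in> E \<Longrightarrow> f c n \<noteq> 0 \<Longrightarrow> f i (f j n) = f k n"
  by (rule holdsD[of f E False]) simp_all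

lemma below_simps [simp]:
  "below s (A \<union> B) \<longleftrightarrow> below s A \<and> below s B"
  "below s {}"
  "below s (insert (b, c, i, j, k) E) \<longleftrightarrow> c < s \<and> i < s \<and> j < s \<and> k < s \<and> below s E"
  "below s (always i j k) \<longleftrightarrow> 3 < s \<and> i < s \<and> j < s \<and> k < s"
  by (simp_all add: below_def always_def ball_Un)

lemma finite_always [simp]: "finite (always i j k)"
  by (simp add: always_def)

lemma below_mono: "below r E \<Longrightarrow> r \<le> s \<Longrightarrow> below s E"
  unfolding below_def by fastforce

lemma holds_cong: "below s E \<Longrightarrow> (\<And>i. i < s \<Longrightarrow> f i = g i) \<Longrightarrow> holds f E \<Longrightarrow> holds g E"
  unfolding holds_def below_def by fastforce

text \<open>Indices: 1 successor, 2 identity, 3 zero, 4 head, 5 tail, 6 and 7 the oracle, where 7 is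
  its characteristic function.\<close>
definition base_eqns :: "eqn set" where
  "base_eqns = {(False, 3, 1, 2, 2)} \<union> always 1 2 1 \<union> always 4 3 3 \<union> always 5 3 3 \<union>
     {(True, 6, 3, 2, 7)} \<union> {(False, 6, 1, 3, 7)}"

definition base :: "(nat \<Rightarrow> nat \<Rightarrow> nat) \<Rightarrow> bool" where
  "base f \<longleftrightarrow> f 1 = Suc \<and> holds f base_eqns"

text \<open>Injectivity of the successor gives \<open>f 2\<close>. The first equation would read
  \<open>Suc n = n\<close> wherever \<open>f 3 n\<close> is nonzero, so \<open>f 3\<close> vanishes.
  Of head and tail only the values at 0 are prescribed; \<open>f 7\<close> is \<open>f 6\<close>
  with nonzero values replaced by 1.\<close>

lemma base_simps:
  assumes "base f"
  shows "f (Suc 0) n = Suc n" "f 2 n = n" "f 3 n = 0" "f 4 0 = 0" "f 5 0 = 0" "f 7 n = 0 \<or> f 7 n = 1"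
proof -
  have 1: "f 1 = Suc" and h: "holds f base_eqns" using assms by (simp_all add: base_def)
  have a: "f 1 (f 2 m) = f 1 m" "f 4 (f 3 m) = f 3 m" "f 5 (f 3 m) = f 3 m" for m
    by (rule holds_alwaysD[OF h], force simp: base_eqns_def)+
  have b: "f 3 m \<noteq> 0 \<Longrightarrow> f 1 (f 2 m) = f 2 m" "f 6 m \<noteq> 0 \<Longrightarrow> f 1 (f 3 m) = f 7 m" for m
    by (rule holds_FalseD[OF h], force simp: base_eqns_def, assumption)+
  have c: "f 6 m = 0 \<Longrightarrow> f 3 (f 2 m) = f 7 m" for m
    by (rule holds_TrueD[OF h], force simp: base_eqns_def)
  have 2: "f 2 m = m" for m using a(1)[of m] unfolding 1 by simp
  have 3: "f 3 m = 0" for m using b(1)[of m] unfolding 1 2 by (metis n_not_Suc_n)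
  show "f (Suc 0) n = Suc n" "f 2 n = n" "f 3 n = 0" using 1 by (simp_all add: 2 3)
  show "f 4 0 = 0" "f 5 0 = 0" using a(2,3)[of 0] by (simp_all add: 3)
  show "f 7 n = 0 \<or> f 7 n = 1" using b(2)[of n] c[of n] unfolding 1 2 3 by (cases "f 6 n = 0") auto
qed

definition orc_of :: "(nat \<Rightarrow> nat \<Rightarrow> nat) \<Rightarrow> nat set" where
  "orc_of f = {n. f 7 n = 1}"

text \<open>The intended interpretation, in which head and tail are the true projections. Solutions
  are constructed from it, while computed values are shown to be correct in every
  \<open>base\<close> interpretation.\<close>

definition std :: "(nat \<Rightarrow> nat \<Rightarrow> nat) \<Rightarrow> nat set \<Rightarrow> bool" where
  "std f C \<longleftrightarrow> f 1 = Suc \<and> f 2 = (\<lambda>n. n) \<and> f 3 = (\<lambda>n. 0) \<and> f 4 = pfst \<and> f 5 = psnd \<and>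
     f 6 = (\<lambda>n. of_bool (n \<in> C)) \<and> f 7 = (\<lambda>n. of_bool (n \<in> C))"

lemma pfst_0 [simp]: "pfst 0 = 0" and psnd_0 [simp]: "psnd 0 = 0"
proof -
  have "prod_encode (0, 0) = 0" by (simp add: prod_encode_def)
  then show "pfst 0 = 0" "psnd 0 = 0"
    using pfst_prod_encode[of 0 0] psnd_prod_encode[of 0 0] by simp_all
qed

lemma std_base: "std f C \<Longrightarrow> base f"
  by (auto simp: std_def base_def base_eqns_def)

lemma std_orc_of: "std f C \<Longrightarrow> orc_of f = C"
  by (auto simp: std_def orc_of_def)

lemma std_cong: "std f C \<Longrightarrow> (\<And>i. i < 8 \<Longrightarrow> g i = f i) \<Longrightarrow> std g C"
  by (simp add: std_def)

text \<open>A number is read as its stream of heads along iterated tails. This makes sense for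
  arbitrary \<open>f 4\<close> and \<open>f 5\<close> and does not presuppose that pairs have codes;
  the codes that a computation needs are supplied by further equations.\<close>

definition rep :: "(nat \<Rightarrow> nat \<Rightarrow> nat) \<Rightarrow> nat \<Rightarrow> nat list \<Rightarrow> bool" where
  "rep f x xs \<longleftrightarrow> (\<forall>i. arg xs i = f 4 ((f 5 ^^ i) x))"

lemma rep_head: "rep f x xs \<Longrightarrow> f 4 x = arg xs 0"
  unfolding rep_def by (metis funpow_0)

lemma rep_tail: "rep f x xs \<Longrightarrow> rep f (f 5 x) (drop 1 xs)"
  unfolding rep_def arg_drop1 by (simp add: funpow_swap1)

lemma rep_Cons: "rep f x (v # vs) \<longleftrightarrow> f 4 x = v \<and> rep f (f 5 x) vs"
proof
  assume "rep f x (v # vs)"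
  then show "f 4 x = v \<and> rep f (f 5 x) vs" using rep_head rep_tail by fastforce
next
  assume a: "f 4 x = v \<and> rep f (f 5 x) vs"
  show "rep f x (v # vs)" unfolding rep_def
  proof
    fix i show "arg (v # vs) i = f 4 ((f 5 ^^ i) x)"
      using a by (cases i) (auto simp: rep_def funpow_swap1)
  qed
qed

lemma rep_Nil: "base f \<Longrightarrow> rep f 0 []"
proof -
  assume b: "base f"
  have "(f 5 ^^ i) 0 = 0" for i by (induction i) (auto simp: base_simps[OF b])
  then show ?thesis by (simp add: rep_def base_simps[OF b])
qed

lemma rep_unique: "rep f x xs \<Longrightarrow> rep f x ys \<Longrightarrow> arg xs = arg ys"
  by (simp add: rep_def fun_eq_iff)

lemma rep_exists: "std f C \<Longrightarrow> \<exists>xs. rep f x xs"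
proof (induction x rule: less_induct)
  case (less x)
  have *: "x = triangle (pfst x + psnd x) + pfst x"
    using fun_cong[OF prod_encode_def, of "(pfst x, psnd x)"] by simp
  have "n \<le> triangle n" for n by (induction n) auto
  then have le: "pfst x + psnd x + pfst x \<le> x" using * by (metis add_le_mono1)
  show ?case
  proof (cases "psnd x < x")
    case True
    then obtain xs where "rep f (psnd x) xs" using less by blast
    then have "rep f x (pfst x # xs)" using less.prems by (simp add: rep_Cons std_def)
    then show ?thesis by blast
  next
    case False
    \<comment> \<open>The tail of 1 is 1, since \<open>triangle 1 = 1\<close>, so the descent along
      tails may stall; the head is then 0 and the empty list serves.\<close>
    then have x: "psnd x = x" "pfst x = 0" using le by auto
    have "(psnd ^^ i) x = x" for i by (induction i) (auto simp: x)
    then have "rep f x []" using less.prems by (simp add: rep_def std_def x)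
    then show ?thesis by blast
  qed
qed

definition lst :: "(nat \<Rightarrow> nat \<Rightarrow> nat) \<Rightarrow> nat \<Rightarrow> nat list" where
  "lst f x = (SOME xs. rep f x xs)"

lemma rep_lst: "std f C \<Longrightarrow> rep f x (lst f x)"
  unfolding lst_def by (rule someI_ex) (rule rep_exists)

section \<open>Systems of equations that define the oracle recursive functions\<close>

definition computes :: "eqn set \<Rightarrow> nat \<Rightarrow> (nat set \<Rightarrow> nat list \<Rightarrow> nat) \<Rightarrow> bool" where
  "computes E t F \<longleftrightarrow>
     (\<forall>f. base f \<and> holds f E \<longrightarrow> (\<forall>x xs. rep f x xs \<longrightarrow> f t x = F (orc_of f) xs))"

text \<open>\<open>computes\<close> speaks about every solution of \<open>E\<close> and would be
  vacuous for a contradictory system. This is the complementary half: over every oracle there are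
  auxiliary functions satisfying \<open>E\<close>, without any change to the indices below
  \<open>r\<close>.\<close>

definition extendable :: "nat \<Rightarrow> eqn set \<Rightarrow> bool" where
  "extendable r E \<longleftrightarrow> (\<forall>f C. std f C \<longrightarrow> (\<exists>g. (\<forall>i<r. g i = f i) \<and> holds g E))"

definition realizes :: "nat \<Rightarrow> eqn set \<Rightarrow> nat \<Rightarrow> nat \<Rightarrow> (nat set \<Rightarrow> nat list \<Rightarrow> nat) \<Rightarrow> bool" where
  "realizes r E s t F \<longleftrightarrow>
     finite E \<and> r \<le> s \<and> t < s \<and> below s E \<and> computes E t F \<and> extendable r E"

text \<open>The quantifier over \<open>r\<close> leaves the choice of the first fresh index to the
  caller, so that the systems of several subcomputations can be joined with disjoint auxiliary
  functions.\<close>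

definition definable :: "(nat set \<Rightarrow> nat list \<Rightarrow> nat) \<Rightarrow> bool" where
  "definable F \<longleftrightarrow> (\<forall>r\<ge>8. \<exists>E s t. realizes r E s t F)"

lemma computesD:
  "computes E t F \<Longrightarrow> base f \<Longrightarrow> holds f E \<Longrightarrow> rep f x xs \<Longrightarrow> f t x = F (orc_of f) xs"
  unfolding computes_def by blast

lemma definableE:
  assumes "definable F" "8 \<le> r"
  obtains E s t where "finite E" "r \<le> s" "t < s" "below s E" "computes E t F" "extendable r E"
  using assms(1)[unfolded definable_def realizes_def, rule_format, OF assms(2)] by (elim exE conjE) (rule that)

text \<open>The second extension leaves the indices below \<open>s\<close> alone and
  \<open>E\<close> mentions no others, so \<open>E\<close> survives it; \<open>8 <= r\<close> keeps
  the interpretation standard after the first one.\<close>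

lemma extendable_Un:
  assumes "extendable r E" "below s E" "8 \<le> r" "r \<le> s"
    and "\<And>f C. std f C \<Longrightarrow> holds f E \<Longrightarrow> \<exists>g. (\<forall>i<s. g i = f i) \<and> holds g E'"
  shows "extendable r (E \<union> E')"
  unfolding extendable_def
proof (intro allI impI)
  fix f C assume "std f C"
  then obtain g where g: "\<forall>i<r. g i = f i" "holds g E" using assms(1) unfolding extendable_def by blast
  have "std g C" using g(1) \<open>std f C\<close> \<open>8 \<le> r\<close> by - (rule std_cong[of f], auto)
  then obtain h where h: "\<forall>i<s. h i = g i" "holds h E'"
    using assms(5)[OF \<open>std g C\<close> g(2)] by (elim exE conjE) (rule that)
  then have "holds h E" using holds_cong[OF assms(2) _ g(2), of h] by simp
  then show "\<exists>g. (\<forall>i<r. g i = f i) \<and> holds g (E \<union> E')"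
    using g h \<open>r \<le> s\<close> by (intro exI[of _ h]) auto
qed

lemma extendable_empty: "extendable r {}"
  by (auto simp: extendable_def)

lemma extendable_trans:
  assumes "extendable r E" "below s E" "8 \<le> r" "r \<le> s" "extendable s E'"
  shows "extendable r (E \<union> E')"
  by (rule extendable_Un[OF assms(1-4)]) (use assms(5) in \<open>auto simp: extendable_def\<close>)

lemma extendable_always:
  assumes "extendable r E" "below s E" "8 \<le> r" "r \<le> s" "i < s" "j < s"
  shows "extendable r (E \<union> always i j s)"
proof (rule extendable_Un[OF assms(1-4)])
  fix f :: "nat \<Rightarrow> nat \<Rightarrow> nat"
  show "\<exists>g. (\<forall>i<s. g i = f i) \<and> holds g (always i j s)"
    using assms(5,6) by (intro exI[of _ "f(s := \<lambda>n. f i (f j n))"]) auto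
qed

lemma definable_zero: "definable (\<lambda>C xs. 0)"
  unfolding definable_def
proof (intro allI impI)
  fix r :: nat assume "8 \<le> r"
  then show "\<exists>E s t. realizes r E s t (\<lambda>C xs. 0)"
    unfolding realizes_def
    by (intro exI[of _ "{}"] exI[of _ r] exI[of _ 3]) (auto simp: computes_def base_simps extendable_empty)
qed

lemma definable_arg_old:
  assumes "i < 8" "j < 8"
    and "\<And>f x xs. base f \<Longrightarrow> rep f x xs \<Longrightarrow> f i (f j x) = F (orc_of f) xs"
  shows "definable F"
  unfolding definable_def
proof (intro allI impI)
  fix r :: nat assume r: "8 \<le> r"
  have "extendable r ({} \<union> always i j r)"
    by (rule extendable_always[OF extendable_empty]) (use r assms in auto)
  moreover have "computes (always i j r) r F"
    using assms(3) by (auto simp: computes_def)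
  ultimately show "\<exists>E s t. realizes r E s t F"
    unfolding realizes_def
    using r assms(1,2) by (intro exI[of _ "always i j r"] exI[of _ "Suc r"] exI[of _ r]) auto
qed

lemma definable_succ: "definable (\<lambda>C xs. Suc (arg xs 0))"
  by (rule definable_arg_old[of 1 4]) (auto simp: base_simps rep_head)

lemma definable_orc: "definable (\<lambda>C xs. if arg xs 0 \<in> C then 1 else 0)"
proof (rule definable_arg_old[of 7 4])
  fix f x xs assume "base f" "rep f x xs"
  then show "f 7 (f 4 x) = (if arg xs 0 \<in> orc_of f then 1 else 0)"
    using base_simps(6)[of f "arg xs 0"] by (auto simp: rep_head orc_of_def)
qed auto

lemma definable_arg: "definable (\<lambda>C xs. arg xs i)"
proof (induction i)
  case 0
  show ?case by (rule definable_arg_old[of 4 2]) (auto simp: base_simps rep_head)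
next
  case (Suc i)
  show ?case unfolding definable_def
  proof (intro allI impI)
    fix r :: nat assume r: "8 \<le> r"
    obtain E s t where E: "finite E" "r \<le> s" "t < s" "below s E"
      "computes E t (\<lambda>C xs. arg xs i)" "extendable r E"
      by (rule definableE[OF Suc.IH r])
    have "extendable r (E \<union> always t 5 s)"
      by (rule extendable_always[OF E(6,4) r E(2,3)]) (use r E in auto)
    moreover have "computes (E \<union> always t 5 s) s (\<lambda>C xs. arg xs (Suc i))"
      unfolding computes_def
    proof (intro allI impI)
      fix f x xs assume f: "base f \<and> holds f (E \<union> always t 5 s)" and x: "rep f x xs"
      then have "f s x = f t (f 5 x)" by simp
      also have "\<dots> = arg (drop 1 xs) i"
        using computesD[OF E(5) _ _ rep_tail[OF x]] f by simp
      finally show "f s x = arg xs (Suc i)" by (simp only: arg_drop1)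
    qed
    ultimately show "\<exists>E s t. realizes r E s t (\<lambda>C xs. arg xs (Suc i))"
    unfolding realizes_def
      using E r by (intro exI[of _ "E \<union> always t 5 s"] exI[of _ "Suc s"] exI[of _ s])
        (auto intro: below_mono)
  qed
qed

text \<open>Composition applies \<open>G\<close> to a list of results, so a function is needed whose
  value represents that list. It is pinned down by its head and its tail, the latter representing
  the remaining results.\<close>

lemma definable_list:
  assumes "\<forall>H\<in>set Hs. definable H" "8 \<le> r"
  shows "\<exists>E s t. finite E \<and> r \<le> s \<and> t < s \<and> below s E \<and> extendable r E \<and>
    (\<forall>f. base f \<and> holds f E \<longrightarrow>
       (\<forall>x xs. rep f x xs \<longrightarrow> rep f (f t x) (map (\<lambda>H. H (orc_of f) xs) Hs)))"
  using assms(1)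
proof (induction Hs)
  case Nil
  then show ?case using assms(2)
    by (intro exI[of _ "{}"] exI[of _ r] exI[of _ 3]) (auto simp: base_simps rep_Nil extendable_empty)
next
  case (Cons H Hs)
  have "\<forall>H\<in>set Hs. definable H" using Cons.prems by simp
  from Cons.IH[OF this] obtain E s t where E: "finite E" "r \<le> s" "t < s" "below s E" "extendable r E"
    and t': "\<forall>f. base f \<and> holds f E \<longrightarrow>
       (\<forall>x xs. rep f x xs \<longrightarrow> rep f (f t x) (map (\<lambda>H. H (orc_of f) xs) Hs))"
    by (elim exE conjE) (rule that)
  have t: "rep f (f t x) (map (\<lambda>H. H (orc_of f) xs) Hs)" if "base f" "holds f E" "rep f x xs" for f x xs
    using t' that by simp
  have s: "8 \<le> s" using assms(2) E(2) by simp
  obtain E' s' t' where E': "finite E'" "s \<le> s'" "t' < s'" "below s' E'" "computes E' t' H"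
    "extendable s E'"
    by (rule definableE[OF Cons.prems[THEN bspec, OF list.set_intros(1)] s])
  let ?E = "E \<union> E'" let ?N = "always 4 s' t' \<union> always 5 s' t"
  have b: "below s' ?E" using E E' by (auto intro: below_mono)
  have "extendable r ?E" by (rule extendable_trans[OF E(5,4) assms(2) E(2) E'(6)])
  then have "extendable r (?E \<union> ?N)"
  proof (rule extendable_Un[OF _ b assms(2)])
    fix f C assume "std f C"
    then show "\<exists>g. (\<forall>i<s'. g i = f i) \<and> holds g ?N"
      using E E' \<open>8 \<le> s\<close>
      by (intro exI[of _ "f(s' := \<lambda>x. prod_encode (f t' x, f t x))"]) (auto simp: std_def)
  qed (use E E' in auto)
  moreover have "rep f (f s' x) (map (\<lambda>H. H (orc_of f) xs) (H # Hs))"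
    if "base f" "holds f (?E \<union> ?N)" "rep f x xs" for f x xs
    using that t[of f x xs] computesD[OF E'(5), of f x xs] by (simp add: rep_Cons)
  ultimately show ?case using E E' b \<open>8 \<le> s\<close>
    by (intro exI[of _ "?E \<union> ?N"] exI[of _ "Suc s'"] exI[of _ s']) (auto intro: below_mono)
qed

lemma definable_comp:
  assumes G: "definable G" and Hs: "\<forall>H\<in>set Hs. definable H"
  shows "definable (\<lambda>C xs. G C (map (\<lambda>H. H C xs) Hs))"
  unfolding definable_def
proof (intro allI impI)
  fix r :: nat assume r: "8 \<le> r"
  obtain E s t where E: "finite E" "r \<le> s" "t < s" "below s E" "extendable r E"
    and t': "\<forall>f. base f \<and> holds f E \<longrightarrow>
       (\<forall>x xs. rep f x xs \<longrightarrow> rep f (f t x) (map (\<lambda>H. H (orc_of f) xs) Hs))"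
    using definable_list[OF Hs r] by (elim exE conjE) (rule that)
  have t: "rep f (f t x) (map (\<lambda>H. H (orc_of f) xs) Hs)" if "base f" "holds f E" "rep f x xs" for f x xs
    using t' that by simp
  have s: "8 \<le> s" using r E(2) by simp
  obtain E' s' t' where E': "finite E'" "s \<le> s'" "t' < s'" "below s' E'" "computes E' t' G"
    "extendable s E'"
    by (rule definableE[OF G s])
  let ?E = "E \<union> E'" let ?N = "always t' t s'"
  have b: "below s' ?E" using E E' by (auto intro: below_mono)
  have "extendable r ?E" by (rule extendable_trans[OF E(5,4) r E(2) E'(6)])
  then have "extendable r (?E \<union> ?N)"
    by (rule extendable_always[OF _ b r]) (use E E' in auto)
  moreover have "computes (?E \<union> ?N) s' (\<lambda>C xs. G C (map (\<lambda>H. H C xs) Hs))"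
    unfolding computes_def
  proof (intro allI impI)
    fix f x xs assume f: "base f \<and> holds f (?E \<union> ?N)" and x: "rep f x xs"
    then have "f s' x = f t' (f t x)" by simp
    then show "f s' x = G (orc_of f) (map (\<lambda>H. H (orc_of f) xs) Hs)"
      using computesD[OF E'(5) _ _ t[OF _ _ x]] f by simp
  qed
  ultimately show "\<exists>E s t. realizes r E s t (\<lambda>C xs. G C (map (\<lambda>H. H C xs) Hs))"
    unfolding realizes_def
    using E E' b \<open>8 \<le> s\<close>
    by (intro exI[of _ "?E \<union> ?N"] exI[of _ "Suc s'"] exI[of _ s']) (auto intro: below_mono)
qed

text \<open>An equation composes only two functions, so every intermediate object of the recursion
  gets a name. Uniqueness is an induction on the first argument. For existence the result is defined
  through a chosen list \<open>lst f x\<close>; the choice does not matter because recursive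
  functions depend on \<open>arg\<close> alone.\<close>

lemma definable_prec:
  assumes G: "definable G" "orec G" and H: "definable H" "orec H"
  shows "definable (prim_rec_op G H)"
  unfolding definable_def
proof (intro allI impI)
  fix r :: nat assume r: "8 \<le> r"
  obtain E1 s1 g where E1: "finite E1" "r \<le> s1" "g < s1" "below s1 E1" "computes E1 g G"
    "extendable r E1"
    by (rule definableE[OF G(1) r])
  have s1: "8 \<le> s1" using r E1(2) by simp
  obtain E2 s h where E2: "finite E2" "s1 \<le> s" "h < s" "below s E2" "computes E2 h H"
    "extendable s1 E2"
    by (rule definableE[OF H(1) s1])
  let ?E = "E1 \<union> E2"
  have b: "below s ?E" using E1 E2 by (auto intro: below_mono)
  have ext: "extendable r ?E" by (rule extendable_trans[OF E1(6,4) r E1(2) E2(6)])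
  \<comment> \<open>With \<open>x = (n + 1, xs)\<close>: \<open>s\<close> is the result, \<open>s + 1\<close> is \<open>n\<close>, \<open>s + 2\<close> is \<open>(n, xs)\<close>,
    \<open>s + 3\<close> the previous result \<open>r\<close>, \<open>s + 4\<close> is \<open>(r, n, xs)\<close> and \<open>s + 5\<close> is \<open>(n, xs)\<close>.\<close>
  define N where "N = {(True, 4, g, 5, s)} \<union> {(False, 4, 1, s + 1, 4)} \<union> always 4 (s + 2) (s + 1) \<union>
    always 5 (s + 2) 5 \<union> always s (s + 2) (s + 3) \<union> always 4 (s + 4) (s + 3) \<union>
    always 5 (s + 4) (s + 5) \<union> always 4 (s + 5) (s + 1) \<union> always 5 (s + 5) 5 \<union>
    {(False, 4, h, s + 4, s)}"
  have s: "8 \<le> s" "g < s" using r E1 E2 by auto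
  have "extendable r (?E \<union> N)"
  proof (rule extendable_Un[OF ext b r])
    fix f C assume f: "std f C" "holds f ?E"
    note bf = std_base[OF f(1)] and C = std_orc_of[OF f(1)]
    have f45: "f 4 = pfst" "f 5 = psnd" "f (Suc 0) = Suc" using f(1) by (auto simp: std_def)
    define R where "R x = prim_rec_op G H C (lst f x)" for x
    \<comment> \<open>The truncated subtraction at \<open>pfst x = 0\<close> is harmless: the
      predecessor equation is imposed only where the head is nonzero.\<close>
    define v where "v x = prod_encode (pfst x - 1, psnd x)" for x
    define k where "k = f(s := R, s + 1 := (\<lambda>x. pfst x - 1), s + 2 := v, s + 3 := (\<lambda>x. R (v x)),
      s + 4 := (\<lambda>x. prod_encode (R (v x), v x)), s + 5 := v)"
    have old: "k i = f i" if "i < s" for i using that by (auto simp: k_def)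
    have new: "k s = R" "k (s + 1) = (\<lambda>x. pfst x - 1)" "k (s + 2) = v" "k (s + 3) = (\<lambda>x. R (v x))"
      "k (s + 4) = (\<lambda>x. prod_encode (R (v x), v x))" "k (s + 5) = v"
      by (auto simp: k_def)
    have Rv: "R x = prim_rec_op G H C xs" if "rep f x xs" for x xs
      unfolding R_def
      by (rule orec_arg_cong[OF orec.prec[OF G(2) H(2)] rep_unique[OF rep_lst[OF f(1)] that]])
    have g0: "f g (psnd x) = R x" if "pfst x = 0" for x
    proof -
      have "f g (f 5 x) = G C (drop 1 (lst f x))"
        using computesD[OF E1(5) bf _ rep_tail[OF rep_lst[OF f(1)]]] f(2) C by simp
      then show ?thesis
        using that rep_head[OF rep_lst[OF f(1)], of x] by (simp add: R_def prim_rec_op_def f45)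
    qed
    have h0: "f h (prod_encode (R (v x), v x)) = R x" if nz: "pfst x \<noteq> 0" for x
    proof -
      let ?xs = "drop 1 (lst f x)"
      obtain n where n: "pfst x = Suc n" using nz by (cases "pfst x") auto
      then have an: "arg (lst f x) 0 = Suc n" using rep_head[OF rep_lst[OF f(1)], of x] f45 by simp
      have "rep f (psnd x) ?xs" using rep_tail[OF rep_lst[OF f(1)], of x] f45 by simp
      then have v: "rep f (v x) (n # ?xs)" by (simp add: rep_Cons f45 v_def n)
      then have "rep f (prod_encode (R (v x), v x)) (R (v x) # n # ?xs)" by (simp add: rep_Cons f45)
      then have "f h (prod_encode (R (v x), v x)) = H C (R (v x) # n # ?xs)"
        using computesD[OF E2(5) bf] f(2) C by simp
      then show ?thesis unfolding Rv[OF v] by (simp add: R_def prim_rec_op_def an)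
    qed
    have "holds k N"
      unfolding N_def using s E2(3)
      by (auto simp: old new new[simplified] f45 g0 h0 v_def[symmetric]) (auto simp: v_def)
    then show "\<exists>k. (\<forall>i<s. k i = f i) \<and> holds k N" using old by blast
  qed (use E1 E2 in auto)
  moreover have "computes (?E \<union> N) s (prim_rec_op G H)"
    unfolding computes_def
  proof (intro allI impI)
    fix f x xs assume "base f \<and> holds f (?E \<union> N)" and x: "rep f x xs"
    then have f: "base f" "holds f E1" "holds f E2" "holds f N" by auto
    have N: "f 4 (f (s + 2) x) = f (s + 1) x"
      "f 5 (f (s + 2) x) = f 5 x" "f s (f (s + 2) x) = f (s + 3) x"
      "f 4 (f (s + 4) x) = f (s + 3) x" "f 5 (f (s + 4) x) = f (s + 5) x"
      "f 4 (f (s + 5) x) = f (s + 1) x" "f 5 (f (s + 5) x) = f 5 x" for x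
      by (rule holds_alwaysD[OF f(4)], force simp: N_def)+
    have N0: "f 4 x = 0 \<Longrightarrow> f g (f 5 x) = f s x" for x
      by (rule holds_TrueD[OF f(4)], force simp: N_def)
    have N1: "f 4 x \<noteq> 0 \<Longrightarrow> f 1 (f (s + 1) x) = f 4 x" "f 4 x \<noteq> 0 \<Longrightarrow> f h (f (s + 4) x) = f s x" for x
      by (rule holds_FalseD[OF f(4)], force simp: N_def, assumption)+
    from x show "f s x = prim_rec_op G H (orc_of f) xs"
    proof (induction "f 4 x" arbitrary: x xs)
      case 0
      then show ?case
        using N0[of x] computesD[OF E1(5) f(1,2) rep_tail[OF 0(2)]] rep_head[OF 0(2)]
        by (simp add: prim_rec_op_def)
    next
      case (Suc n)
      have nz: "f 4 x \<noteq> 0" using Suc.hyps(2) by simp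
      have n: "f (s + 1) x = n" using N1(1)[OF nz] Suc.hyps(2) base_simps(1)[OF f(1)] by simp
      have an: "arg xs 0 = Suc n" using rep_head[OF Suc.prems] Suc.hyps(2) by simp
      have t: "rep f (f 5 x) (drop 1 xs)" by (rule rep_tail[OF Suc.prems])
      have v: "rep f (f (s + 2) x) (n # drop 1 xs)" using t by (simp only: rep_Cons N(1,2) n simp_thms)
      have "f s (f (s + 2) x) = prim_rec_op G H (orc_of f) (n # drop 1 xs)"
        by (rule Suc.hyps(1)[OF _ v]) (simp only: N(1) n simp_thms)
      then have o: "f (s + 3) x = prim_rec_op G H (orc_of f) (n # drop 1 xs)" by (simp only: N(3))
      have "rep f (f (s + 4) x) (f (s + 3) x # n # drop 1 xs)"
        using t by (simp only: rep_Cons N(4-7) n simp_thms)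
      then have "f h (f (s + 4) x) = H (orc_of f) (f (s + 3) x # n # drop 1 xs)"
        by (rule computesD[OF E2(5) f(1,3)])
      then show ?case using N1(2)[OF nz] o an by (simp add: prim_rec_op_def)
    qed
  qed
  ultimately show "\<exists>E s t. realizes r E s t (prim_rec_op G H)"
    unfolding realizes_def
    using E1 E2 s b
    by (intro exI[of _ "?E \<union> N"] exI[of _ "s + 6"] exI[of _ s]) (auto simp: N_def intro: below_mono)
qed

text \<open>The search function has the same value at \<open>(n, xs)\<close> and
  \<open>(n + 1, xs)\<close> unless \<open>n\<close> is a zero. This alone would leave it
  undetermined on an endless search; totality in the \<open>mu\<close> scheme provides the zero
  \<open>L\<close>, from which the values are determined backwards.\<close>

lemma definable_mu:
  assumes G: "definable G" "orec G" and ex: "\<forall>C xs. \<exists>n. G C (n # xs) = 0"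
  shows "definable (\<lambda>C xs. LEAST n. G C (n # xs) = 0)"
  unfolding definable_def
proof (intro allI impI)
  fix r :: nat assume r: "8 \<le> r"
  obtain E s g where E: "finite E" "r \<le> s" "g < s" "below s E" "computes E g G" "extendable r E"
    by (rule definableE[OF G(1) r])
  have s: "8 \<le> s" using r E(2) by simp
  \<comment> \<open>\<open>s\<close> maps \<open>(n, xs)\<close> to the least zero that is at least \<open>n\<close>, \<open>s + 2\<close> maps it to \<open>(n + 1, xs)\<close>,
    \<open>s + 3\<close> maps \<open>xs\<close> to \<open>(0, xs)\<close>, and \<open>s + 4\<close> is the result.\<close>
  define N where "N = {(True, g, 4, 2, s)} \<union> {(False, g, s, s + 2, s)} \<union> always 1 4 (s + 1) \<union>
    always 4 (s + 2) (s + 1) \<union> always 5 (s + 2) 5 \<union> always 4 (s + 3) 3 \<union> always 5 (s + 3) 2 \<union>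
    always s (s + 3) (s + 4)"
  have "extendable r (E \<union> N)"
  proof (rule extendable_Un[OF E(6,4) r E(2)])
    fix f C assume f: "std f C" "holds f E"
    note bf = std_base[OF f(1)] and C = std_orc_of[OF f(1)]
    have f45: "f 4 = pfst" "f 5 = psnd" "f 2 = (\<lambda>n. n)" "f 3 = (\<lambda>n. 0)" "f (Suc 0) = Suc"
      using f(1) by (auto simp: std_def)
    define Z where "Z y n \<longleftrightarrow> pfst y \<le> n \<and> f g (prod_encode (n, psnd y)) = 0" for y n
    \<comment> \<open>A search may begin beyond the last zero. The value 0 chosen then is
      consistent, since \<open>Z (v y) = Z y\<close> whenever \<open>f g y\<close> is
      nonzero.\<close>
    define M where "M y = (if \<exists>n. Z y n then LEAST n. Z y n else 0)" for y
    define v where "v y = prod_encode (Suc (pfst y), psnd y)" for y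
    define z where "z x = prod_encode (0, x)" for x
    define k where "k = f(s := M, s + 1 := (\<lambda>y. Suc (pfst y)), s + 2 := v, s + 3 := z, s + 4 := (\<lambda>x. M (z x)))"
    have old: "k i = f i" if "i < s" for i using that by (auto simp: k_def)
    have new: "k s = M" "k (s + 1) = (\<lambda>y. Suc (pfst y))" "k (s + 2) = v" "k (s + 3) = z"
      "k (s + 4) = (\<lambda>x. M (z x))"
      by (auto simp: k_def)
    have M0: "pfst y = M y" if "f g y = 0" for y
    proof -
      have "Z y (pfst y)" using that by (simp add: Z_def)
      moreover have "(LEAST n. Z y n) = pfst y"
        by (rule Least_equality) (use \<open>Z y (pfst y)\<close> in \<open>auto simp: Z_def\<close>)
      ultimately show ?thesis by (auto simp: M_def)
    qed
    have M1: "M (v y) = M y" if "f g y \<noteq> 0" for y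
    proof -
      have "Z (v y) = Z y"
      proof
        fix n
        have "n \<noteq> pfst y" if "f g (prod_encode (n, psnd y)) = 0"
          using that \<open>f g y \<noteq> 0\<close> by auto
        then show "Z (v y) n = Z y n" by (auto simp: Z_def v_def)
      qed
      then show ?thesis by (simp add: M_def)
    qed
    have "holds k N"
      unfolding N_def using s E(3)
      by (auto simp: old new new[simplified] f45 M0 M1) (auto simp: v_def z_def)
    then show "\<exists>k. (\<forall>i<s. k i = f i) \<and> holds k N" using old by blast
  qed
  moreover have "computes (E \<union> N) (s + 4) (\<lambda>C xs. LEAST n. G C (n # xs) = 0)"
    unfolding computes_def
  proof (intro allI impI)
    fix f x xs assume "base f \<and> holds f (E \<union> N)" and x: "rep f x xs"
    then have f: "base f" "holds f E" "holds f N" by auto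
    have N: "f 1 (f 4 y) = f (s + 1) y"
      "f 4 (f (s + 2) y) = f (s + 1) y" "f 5 (f (s + 2) y) = f 5 y" "f 4 (f (s + 3) y) = f 3 y"
      "f 5 (f (s + 3) y) = f 2 y" "f s (f (s + 3) y) = f (s + 4) y" for y
      by (rule holds_alwaysD[OF f(3)], force simp: N_def)+
    have N0: "f g y = 0 \<Longrightarrow> f 4 (f 2 y) = f s y" for y
      by (rule holds_TrueD[OF f(3)], force simp: N_def)
    have N1: "f g y \<noteq> 0 \<Longrightarrow> f s (f (s + 2) y) = f s y" for y
      by (rule holds_FalseD[OF f(3)], force simp: N_def)
    let ?G = "\<lambda>n. G (orc_of f) (n # xs)"
    define L where "L = (LEAST n. ?G n = 0)"
    have "\<exists>n. ?G n = 0" using ex by simp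
    then have L: "?G L = 0" unfolding L_def by (rule LeastI_ex)
    have L': "?G n \<noteq> 0" if "n < L" for n using that unfolding L_def by (rule not_less_Least)
    have least: "n + d = L \<Longrightarrow> rep f y (n # xs) \<Longrightarrow> f s y = L" for d n y
    proof (induction d arbitrary: n y)
      case 0
      have "f g y = 0" using computesD[OF E(5) f(1,2) 0(2)] 0(1) L by simp
      then show ?case using N0[of y] 0 base_simps[OF f(1)] by (simp add: rep_Cons)
    next
      case (Suc d)
      have "f g y \<noteq> 0" using computesD[OF E(5) f(1,2) Suc.prems(2)] Suc.prems(1) L'[of n] by simp
      moreover have "rep f (f (s + 2) y) (Suc n # xs)"
        using Suc.prems(2) N(1)[of y] N(2,3) base_simps(1)[OF f(1)] by (simp add: rep_Cons)
      ultimately show ?case using N1[of y] Suc.IH[of "Suc n" "f (s + 2) y"] Suc.prems(1) by simp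
    qed
    have "rep f (f (s + 3) x) (0 # xs)"
      using x by (simp add: rep_Cons N(4,5) base_simps[OF f(1)])
    then have "f s (f (s + 3) x) = L" by (intro least[of 0 L]) auto
    then have "f (s + 4) x = L" using N(6)[of x] by simp
    then show "f (s + 4) x = (LEAST n. ?G n = 0)" by (simp add: L_def)
  qed
  ultimately show "\<exists>E' s t. realizes r E' s t (\<lambda>C xs. LEAST n. G C (n # xs) = 0)"
    unfolding realizes_def
    using E s
    by (intro exI[of _ "E \<union> N"] exI[of _ "s + 5"] exI[of _ "s + 4"])
      (auto simp: N_def intro: below_mono)
qed

lemma orec_definable: "orec F \<Longrightarrow> definable F"
proof (induction rule: orec.induct)
  case (comp G Hs)
  then show ?case by (intro definable_comp) auto
qed (auto intro: definable_zero definable_succ definable_arg definable_orc definable_prec definable_mu)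

text \<open>The variable of the equations plays the universal \<open>m\<close>, the set where
  \<open>f 7\<close> is 1 plays the oracle, and \<open>l\<close> becomes a Skolem function. The
  input enters only as \<open>f 0 0\<close>; the equation \<open>always 0 3 s\<close> spreads it to
  a constant function.\<close>

theorem Sigma11_solvable:
  assumes "Sigma11 P"
  shows "\<exists>E. finite E \<and> (\<forall>w. w \<in> P \<longleftrightarrow> solvable E w)"
proof -
  obtain F where F: "orec F" "\<And>w. w \<in> P \<longleftrightarrow> (\<exists>C. \<forall>m. \<exists>l. F C [m, l, w] = 0)"
    using assms unfolding Sigma11_def by blast
  obtain E s t where E: "finite E" "8 \<le> s" "t < s" "below s E" "computes E t F" "extendable 8 E"
    by (rule definableE[OF orec_definable[OF F(1)] order_refl])
  \<comment> \<open>\<open>s\<close> is constantly \<open>w\<close>, \<open>s + 1\<close> maps \<open>m\<close> to a witness \<open>l\<close>, and \<open>s + 4\<close> to \<open>(m, l, w)\<close>.\<close>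
  define N where "N = always 0 3 s \<union> always 4 (s + 2) s \<union> always 5 (s + 2) 3 \<union> always 4 (s + 3) (s + 1) \<union>
    always 5 (s + 3) (s + 2) \<union> always 4 (s + 4) 2 \<union> always 5 (s + 4) (s + 3) \<union> always t (s + 4) 3"
  have "w \<in> P \<longleftrightarrow> solvable (base_eqns \<union> E \<union> N) w" for w
  proof
    assume "w \<in> P"
    then obtain C l where l: "\<And>m. F C [m, l m, w] = 0" unfolding F(2) by metis
    define f0 where "f0 = (\<lambda>i::nat. \<lambda>n. 0::nat)(0 := \<lambda>n. w, 1 := Suc, 2 := \<lambda>n. n, 4 := pfst, 5 := psnd,
      6 := \<lambda>n. of_bool (n \<in> C), 7 := \<lambda>n. of_bool (n \<in> C))"
    have "std f0 C" by (simp add: std_def f0_def)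
    then obtain f where f: "\<And>i. i < 8 \<Longrightarrow> f i = f0 i" "holds f E" using E(6) unfolding extendable_def by blast
    have st: "std f C" using \<open>std f0 C\<close> f(1) by (rule std_cong)
    have f45: "f 4 = pfst" "f 5 = psnd" "f 2 = (\<lambda>n. n)" "f 3 = (\<lambda>n. 0)" "f (Suc 0) = Suc" "f 0 = (\<lambda>n. w)"
      using f(1) by (auto simp: f0_def)
    define u where "u m = prod_encode (m, prod_encode (l m, prod_encode (w, 0)))" for m
    define k where "k = f(s := \<lambda>n. w, s + 1 := l, s + 2 := (\<lambda>n. prod_encode (w, 0)),
      s + 3 := (\<lambda>n. prod_encode (l n, prod_encode (w, 0))), s + 4 := u)"
    have old: "k i = f i" if "i < s" for i using that by (auto simp: k_def)
    have new: "k s = (\<lambda>n. w)" "k (s + 1) = l" "k (s + 2) = (\<lambda>n. prod_encode (w, 0))"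
      "k (s + 3) = (\<lambda>n. prod_encode (l n, prod_encode (w, 0)))" "k (s + 4) = u"
      by (auto simp: k_def)
    have "f t (u m) = 0" for m
    proof -
      have "rep f (u m) [m, l m, w]"
        using rep_Nil[OF std_base[OF st]] by (simp add: rep_Cons f45 u_def)
      then show ?thesis
        using computesD[OF E(5) std_base[OF st] f(2)] std_orc_of[OF st] l by simp
    qed
    then have "holds k N"
      unfolding N_def using E(2,3) by (auto simp: old new new[simplified] f45) (auto simp: u_def)
    moreover have "holds k E" by (rule holds_cong[OF E(4) _ f(2)]) (simp add: old)
    moreover have "std k C" by (rule std_cong[OF st]) (use E(2) old in auto)
    ultimately show "solvable (base_eqns \<union> E \<union> N) w"
      unfolding solvable_def using std_base[of k C] old[of 0] E(2) f45
      by (intro exI[of _ k]) (auto simp: base_def)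
  next
    assume "solvable (base_eqns \<union> E \<union> N) w"
    then obtain f where w: "f 0 0 = w" and f: "base f" "holds f E" "holds f N"
      unfolding solvable_def base_def by auto
    have N: "f 0 (f 3 n) = f s n" "f 4 (f (s + 2) n) = f s n" "f 5 (f (s + 2) n) = f 3 n"
      "f 4 (f (s + 3) n) = f (s + 1) n" "f 5 (f (s + 3) n) = f (s + 2) n" "f 4 (f (s + 4) n) = f 2 n"
      "f 5 (f (s + 4) n) = f (s + 3) n" "f t (f (s + 4) n) = f 3 n" for n
      by (rule holds_alwaysD[OF f(3)], force simp: N_def)+
    have "F (orc_of f) [m, f (s + 1) m, w] = 0" for m
    proof -
      have "f s m = w" using N(1)[of m] w base_simps(3)[OF f(1)] by simp
      then have "rep f (f (s + 4) m) [m, f (s + 1) m, w]"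
        using rep_Nil[OF f(1)] by (simp only: rep_Cons N(2-7) base_simps(2,3)[OF f(1)] simp_thms)
      then show ?thesis using computesD[OF E(5) f(1,2)] N(8)[of m] base_simps(3)[OF f(1)] by simp
    qed
    then show "w \<in> P" unfolding F(2) by (intro exI[of _ "orc_of f"] allI exI)
  qed
  moreover have "finite (base_eqns \<union> E \<union> N)" using E(1) by (simp add: base_eqns_def N_def)
  ultimately show ?thesis by (intro exI[of _ "base_eqns \<union> E \<union> N"]) simp
qed

section \<open>A universal system\<close>

fun eqn_code :: "eqn \<Rightarrow> nat" where
  "eqn_code (b, c, i, j, k) =
     prod_encode (of_bool b, prod_encode (c, prod_encode (i, prod_encode (j, k))))"

lemma inj_eqn_code: "inj eqn_code"
  by (rule injI) (auto elim!: eqn_code.elims simp: of_bool_def split: if_splits)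

definition eqns_of :: "nat \<Rightarrow> eqn set" where
  "eqns_of e = {q. eqn_code q \<in> set_decode e}"

definition universal :: "nat set" where
  "universal = {z. solvable (eqns_of (pfst z)) (psnd z)}"

lemma eqns_of_surj: "finite E \<Longrightarrow> \<exists>e. eqns_of e = E"
  by (rule exI[of _ "set_encode (eqn_code ` E)"])
    (auto simp: eqns_of_def set_encode_inverse inj_image_mem_iff[OF inj_eqn_code])

text \<open>With \<open>g\<close> coding \<open>f i n\<close> at the pair of \<open>i\<close> and
  \<open>n\<close>, the relation can only ask whether a pair lies in the graph. Nested values are
  therefore guessed: \<open>q\<close>, \<open>a\<close>, \<open>v\<close> are universally quantified
  candidates for \<open>f c n\<close>, \<open>f j n\<close>, \<open>f i (f j n)\<close>, and the
  premises select the right ones.\<close>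

lemma Sigma11_universal: "Sigma11 universal"
proof -
  define n where "n m = pfst m" for m
  define t where "t m = pfst (psnd m)" for m
  define q where "q m = pfst (psnd (psnd m))" for m
  define a where "a m = pfst (psnd (psnd (psnd m)))" for m
  define v where "v m = psnd (psnd (psnd (psnd m)))" for m
  define b where "b m = pfst (t m)" for m
  define c where "c m = pfst (psnd (t m))" for m
  define i where "i m = pfst (psnd (psnd (t m)))" for m
  define j where "j m = pfst (psnd (psnd (psnd (t m))))" for m
  define k where "k m = psnd (psnd (psnd (psnd (t m))))" for m
  note defs = n_def t_def q_def a_def v_def b_def c_def i_def j_def k_def
  define R where "R C xs \<longleftrightarrow>
    (let m = arg xs 0; z = arg xs 1 in
      prod_encode (prod_encode (0, 0), psnd z) \<in> C \<and>
      prod_encode (prod_encode (1, n m), Suc (n m)) \<in> C \<and>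
      (t m \<in> set_decode (pfst z) \<and> prod_encode (prod_encode (c m, n m), q m) \<in> C \<and>
       prod_encode (prod_encode (j m, n m), a m) \<in> C \<and> prod_encode (prod_encode (i m, a m), v m) \<in> C \<and>
       (q m = 0 \<and> b m = 1 \<or> \<not> q m = 0 \<and> b m = 0) \<longrightarrow>
       prod_encode (prod_encode (k m, n m), v m) \<in> C))" for C xs
  have "orecP R" unfolding R_def[abs_def] Let_def defs by (intro orec_intros)
  then show ?thesis
  proof (rule Sigma11I)
    fix z
    show "z \<in> universal \<longleftrightarrow> (\<exists>g. \<forall>m. R (graph g) [m, z])"
    proof
      assume "z \<in> universal"
      then obtain f where f: "f 0 0 = psnd z" "f 1 = Suc" "holds f (eqns_of (pfst z))"
        unfolding universal_def solvable_def by blast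
      define g where "g x = f (pfst x) (psnd x)" for x
      have "R (graph g) [m, z]" for m
      proof -
        have "f (k m) (n m) = v m" if "t m \<in> set_decode (pfst z)" "f (c m) (n m) = q m"
          "f (j m) (n m) = a m" "f (i m) (a m) = v m" "q m = 0 \<and> b m = 1 \<or> \<not> q m = 0 \<and> b m = 0"
        proof -
          have "of_bool (b m = 1) = pfst (t m)" using that(5) by (auto simp: b_def)
          then have "eqn_code (b m = 1, c m, i m, j m, k m) = t m" by (simp add: c_def i_def j_def k_def)
          then have "(b m = 1, c m, i m, j m, k m) \<in> eqns_of (pfst z)" using that(1) by (simp add: eqns_of_def)
          from holdsD[OF f(3) this, of "n m"] show ?thesis using that by auto
        qed
        then show ?thesis using f by (auto simp: R_def Let_def g_def)
      qed
      then show "\<exists>g. \<forall>m. R (graph g) [m, z]" by blast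
    next
      assume "\<exists>g. \<forall>m. R (graph g) [m, z]"
      then obtain g where g: "\<And>m. R (graph g) [m, z]" by blast
      define f where "f x y = g (prod_encode (x, y))" for x y
      have "f 1 x = Suc x" for x
        using g[of "prod_encode (x, 0)"] by (simp add: R_def Let_def n_def f_def)
      moreover have "f 0 0 = psnd z"
        using g[of 0] by (simp add: R_def Let_def f_def)
      moreover have "f i' (f j' x) = f k' x"
        if e: "(b', c', i', j', k') \<in> eqns_of (pfst z)" "(f c' x = 0) = b'" for b' c' i' j' k' x
      proof -
        define m where "m = prod_encode (x, prod_encode (eqn_code (b', c', i', j', k'),
          prod_encode (f c' x, prod_encode (f j' x, f i' (f j' x)))))"
        have "n m = x" "c m = c'" "i m = i'" "j m = j'" "k m = k'" "b m = of_bool b'"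
          "q m = f c' x" "a m = f j' x" "v m = f i' (f j' x)" "t m = eqn_code (b', c', i', j', k')"
          by (simp_all add: defs m_def)
        then show ?thesis using g[of m] e by (auto simp: R_def Let_def eqns_of_def f_def)
      qed
      then have "holds f (eqns_of (pfst z))" unfolding holds_def by blast
      ultimately show "z \<in> universal" unfolding universal_def solvable_def by fastforce
    qed
  qed
qed

lemma many_one_reducibleI: "orec F \<Longrightarrow> (\<And>C n. F C [n] = g n) \<Longrightarrow> (\<And>w. w \<in> A \<longleftrightarrow> g w \<in> B) \<Longrightarrow> many_one_reducible A B"
  unfolding many_one_reducible_def computable1_def by blast

lemma many_one_reducible_trans:
  assumes "many_one_reducible A B" "many_one_reducible B D"
  shows "many_one_reducible A D"
proof -
  obtain g F h H where "orec F" "\<And>C n. F C [n] = g n" "\<And>w. w \<in> A \<longleftrightarrow> g w \<in> B"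
    "orec H" "\<And>C n. H C [n] = h n" "\<And>w. w \<in> B \<longleftrightarrow> h w \<in> D"
    using assms unfolding many_one_reducible_def computable1_def by blast
  then show ?thesis
    by (intro many_one_reducibleI[OF orec_comp1[of H F], of "\<lambda>n. h (g n)"]) auto
qed

lemma reducible_universal:
  assumes "Sigma11 Q" shows "many_one_reducible Q universal"
proof -
  obtain E where E: "finite E" "\<And>w. w \<in> Q \<longleftrightarrow> solvable E w" using Sigma11_solvable[OF assms] by blast
  obtain e where "eqns_of e = E" using eqns_of_surj[OF E(1)] by blast
  then show ?thesis
    by (intro many_one_reducibleI[OF orec_prod_encode[OF orec_const[of e] orec_arg[of 0]]])
      (auto simp: E(2) universal_def)
qed

lemma universal_solvable: "\<exists>E. finite E \<and> (\<forall>w. w \<in> universal \<longleftrightarrow> solvable E w)"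
  by (rule Sigma11_solvable[OF Sigma11_universal])

section \<open>A sweeping machine that verifies a system of equations\<close>

datatype kd = Wall | Hdr | One nat
datatype ptr = PX | PG | PP | PQ | PR

text \<open>A tape is \<open>Wall\<close> followed by blocks, the \<open>n\<close>-th being \<open>Hdr\<close> and then \<open>f\<^sub>i n\<close> copies of
  \<open>One i\<close> for \<open>i = 0, 1, 2, \<dots>\<close>. Only digits (one per header) and pointer marks ever change.
  \<open>Odo\<close> increments the binary counter formed by the digits and puts \<open>PX\<close> on the block where
  the carry stops; \<open>Move a i b\<close> advances \<open>b\<close> by as many blocks as there are \<open>One i\<close> in the block
  at \<open>a\<close>; \<open>Cond b c n\<close> skips \<open>n\<close> operations unless \<open>(f\<^sub>c n = 0) = b\<close> at the block of \<open>PX\<close>.\<close>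
datatype operation = Odo | Place ptr | Move ptr nat ptr | Clear ptr | TestEq ptr ptr | TestSucc
  | Cond bool nat nat

type_synonym lbl = "operation list \<times> nat"

text \<open>The end of a search for \<open>One i\<close>: on the intended tape the indices within a
  block do not decrease, so a header or a larger index means that no \<open>One i\<close> follows in
  the block. On a badly ordered tape the search still has a definite outcome, which is enough to
  read off functions.\<close>

definition reach :: "nat \<Rightarrow> kd \<Rightarrow> bool" where
  "reach i k \<longleftrightarrow> k = Hdr \<or> (\<exists>j\<ge>i. k = One j)"

lemma reach_simps [simp]: "reach i Hdr" "\<not> reach i Wall" "reach i (One j) \<longleftrightarrow> i \<le> j"
  by (auto simp: reach_def)

text \<open>A result \<open>Some (d, S, h, q)\<close> means: write digit \<open>d\<close> and marks \<open>S\<close>, and continue in state \<open>q\<close>,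
  at the cell to the right of the wall if \<open>h\<close>, one cell further right otherwise.
  Unexpected marks make the machine stop, so that marks left on the initial tape do no harm.\<close>
fun act :: "operation list \<Rightarrow> lbl \<Rightarrow> kd \<Rightarrow> bool \<Rightarrow> ptr set \<Rightarrow> (bool \<times> ptr set \<times> bool \<times> lbl) option" where
  "act full ([], ph) k d S = Some (d, S, True, (full, 0))"
| "act full (Odo # r, ph) k d S =
    (if PX \<in> S then None
     else if k = Hdr then
       (if d then Some (False, S, False, (Odo # r, ph)) else Some (True, insert PX S, True, (r, 0)))
     else Some (d, S, False, (Odo # r, ph)))"
| "act full (Place a # r, ph) k d S = (if a \<in> S then None else Some (d, insert a S, True, (r, 0)))"
| "act full (Clear a # r, ph) k d S =
    (if a \<in> S then Some (d, S - {a}, True, (r, 0)) else Some (d, S, False, (Clear a # r, ph)))"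
| "act full (TestEq a b # r, ph) k d S =
    (if a \<in> S \<and> b \<in> S then Some (d, S, True, (r, 0))
     else if a \<notin> S \<and> b \<notin> S then Some (d, S, False, (TestEq a b # r, ph)) else None)"
| "act full (TestSucc # r, ph) k d S =
    (if ph = 0 then
       (if PQ \<in> S then None else Some (d, S, False, (TestSucc # r, if PX \<in> S then 1 else 0)))
     else if k = Hdr then (if PQ \<in> S then Some (d, S, True, (r, 0)) else None)
     else if PQ \<in> S then None else Some (d, S, False, (TestSucc # r, ph)))"
| "act full (Cond b c n # r, ph) k d S =
    (if ph = 0 then Some (d, S, False, (Cond b c n # r, if PX \<in> S then 1 else 0))
     else if reach c k then Some (d, S, True, (if (k \<noteq> One c) = b then r else drop n r, 0))
     else Some (d, S, False, (Cond b c n # r, ph)))"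
| "act full (Move a i b # r, ph) k d S =
    (if ph = 0 then
       (if PG \<in> S then None
        else if a \<in> S then Some (d, insert PG S, True, (Move a i b # r, 1))
        else Some (d, S, False, (Move a i b # r, 0)))
     else if ph = 1 then
       (if PG \<in> S then Some (d, S - {PG}, False, (Move a i b # r, 2))
        else Some (d, S, False, (Move a i b # r, 1)))
     else if ph = 2 then
       (if PG \<in> S then None
        else if reach i k then
          (if k = One i then Some (d, insert PG S, True, (Move a i b # r, 3)) else Some (d, S, True, (r, 0)))
        else Some (d, S, False, (Move a i b # r, 2)))
     else if ph = 3 then
       (if b \<in> S then Some (d, S - {b}, False, (Move a i b # r, 4))
        else Some (d, S, False, (Move a i b # r, 3)))
     else
       (if b \<in> S then None
        else if k = Hdr then Some (d, insert b S, True, (Move a i b # r, 1))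
        else Some (d, S, False, (Move a i b # r, ph))))"

type_synonym config = "lbl \<times> nat \<times> (nat \<Rightarrow> bool) \<times> (nat \<Rightarrow> ptr set)"

definition put :: "ptr \<Rightarrow> nat \<Rightarrow> (nat \<Rightarrow> ptr set) \<Rightarrow> nat \<Rightarrow> ptr set" where
  "put a p S = S(p := insert a (S p))"

text \<open>On an arbitrary tape nothing is known about marks beyond the cells visited. So absence
  is stated only up to a position, and a mark is identified as the first of its kind from cell 1
  on.\<close>

definition clr :: "ptr \<Rightarrow> nat \<Rightarrow> (nat \<Rightarrow> ptr set) \<Rightarrow> bool" where
  "clr a p S \<longleftrightarrow> (\<forall>u. 1 \<le> u \<and> u \<le> p \<longrightarrow> a \<notin> S u)"

definition first :: "ptr \<Rightarrow> nat \<Rightarrow> (nat \<Rightarrow> ptr set) \<Rightarrow> bool" where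
  "first a p S \<longleftrightarrow> 1 \<le> p \<and> a \<in> S p \<and> (\<forall>u. 1 \<le> u \<and> u < p \<longrightarrow> a \<notin> S u)"

lemma in_put [simp]: "b \<in> put a p S u \<longleftrightarrow> b = a \<and> u = p \<or> b \<in> S u"
  by (auto simp: put_def)

lemma put_commute: "put a p (put b q S) = put b q (put a p S)"
  by (auto simp: put_def fun_eq_iff)

lemma put_remove: "a \<notin> S p \<Longrightarrow> (put a p S)(p := put a p S p - {a}) = S"
  by (auto simp: put_def fun_eq_iff)

lemma clr_put [simp]: "b \<noteq> a \<Longrightarrow> clr b p (put a q S) \<longleftrightarrow> clr b p S"
  by (simp add: clr_def)

lemma first_put [simp]: "b \<noteq> a \<Longrightarrow> first b p (put a q S) \<longleftrightarrow> first b p S"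
  by (simp add: first_def)

lemma first_put_same: "clr a p S \<Longrightarrow> 1 \<le> p \<Longrightarrow> first a p (put a p S)"
  by (simp add: first_def clr_def)

lemma first_unique: "first a p S \<Longrightarrow> 1 \<le> q \<Longrightarrow> a \<in> S q \<Longrightarrow> (\<And>u. 1 \<le> u \<Longrightarrow> u < q \<Longrightarrow> a \<notin> S u) \<Longrightarrow> q = p"
  unfolding first_def by (metis linorder_neqE_nat)

section \<open>Numbers and equations read off a tape\<close>

definition nxt :: "(nat \<Rightarrow> kd) \<Rightarrow> nat \<Rightarrow> nat \<Rightarrow> bool" where
  "nxt K h h' \<longleftrightarrow> h < h' \<and> K h' = Hdr \<and> (\<forall>u. h < u \<and> u < h' \<longrightarrow> K u \<noteq> Wall \<and> K u \<noteq> Hdr)"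

definition stop :: "(nat \<Rightarrow> kd) \<Rightarrow> nat \<Rightarrow> nat \<Rightarrow> nat \<Rightarrow> bool" where
  "stop K i g u \<longleftrightarrow> g < u \<and> reach i (K u) \<and> (\<forall>v. g < v \<and> v < u \<longrightarrow> K v \<noteq> Wall \<and> \<not> reach i (K v))"

inductive cnt :: "(nat \<Rightarrow> kd) \<Rightarrow> nat \<Rightarrow> nat \<Rightarrow> nat \<Rightarrow> bool" for K i where
  cnt_0: "stop K i g u \<Longrightarrow> K u \<noteq> One i \<Longrightarrow> cnt K i g 0"
| cnt_Suc: "stop K i g u \<Longrightarrow> K u = One i \<Longrightarrow> cnt K i u v \<Longrightarrow> cnt K i g (Suc v)"

definition carry :: "(nat \<Rightarrow> kd) \<Rightarrow> (nat \<Rightarrow> bool) \<Rightarrow> nat \<Rightarrow> nat \<Rightarrow> bool" where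
  "carry K D c u = (if u = c then True else if 1 \<le> u \<and> u < c \<and> K u = Hdr then False else D u)"

text \<open>The leftmost header holds the least significant digit. That no \<open>Wall\<close> lies
  below \<open>c\<close> is known because the head has walked there; it later yields the next
  header.\<close>

definition carry_at :: "(nat \<Rightarrow> kd) \<Rightarrow> (nat \<Rightarrow> bool) \<Rightarrow> nat \<Rightarrow> bool" where
  "carry_at K D c \<longleftrightarrow> 1 \<le> c \<and> K c = Hdr \<and> \<not> D c \<and>
     (\<forall>u. 1 \<le> u \<and> u < c \<longrightarrow> K u \<noteq> Wall \<and> (K u = Hdr \<longrightarrow> D u))"

definition succ_ok :: "(nat \<Rightarrow> kd) \<Rightarrow> nat \<Rightarrow> bool" where
  "succ_ok K c \<longleftrightarrow> (\<exists>v Q. cnt K 1 c v \<and> (nxt K ^^ v) 1 Q \<and> nxt K c Q)"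

text \<open>A value \<open>v\<close> appears as the header \<open>v\<close> steps after cell 1, so
  both sides are compared as positions. Existence of these headers is part of the condition: a value
  that exceeds the supply of blocks counts as a failure.\<close>

fun eqn_ok :: "(nat \<Rightarrow> kd) \<Rightarrow> nat \<Rightarrow> eqn \<Rightarrow> bool" where
  "eqn_ok K c (b, z, i, j, k) \<longleftrightarrow> (\<exists>u. stop K z c u \<and> ((K u \<noteq> One z) = b \<longrightarrow>
     (\<exists>a A v Q v'. cnt K j c a \<and> (nxt K ^^ a) 1 A \<and> cnt K i A v \<and> (nxt K ^^ v) 1 Q \<and>
        cnt K k c v' \<and> (nxt K ^^ v') 1 Q)))"

definition succ_check :: "operation list" where
  "succ_check = [Place PQ, Move PX 1 PQ, TestSucc, Clear PQ]"

text \<open>The argument 10 of \<open>Cond\<close> is the number of operations that follow, so a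
  check whose condition fails is skipped as a whole.\<close>

fun eqn_check :: "eqn \<Rightarrow> operation list" where
  "eqn_check (b, z, i, j, k) = [Cond b z 10, Place PP, Move PX j PP, Place PQ, Move PP i PQ,
     Place PR, Move PX k PR, TestEq PQ PR, Clear PP, Clear PQ, Clear PR]"

locale machine =
  fixes Es :: "eqn list" and K :: "nat \<Rightarrow> kd"
  assumes K1: "K 1 = Hdr"
begin

definition body :: "operation list" where
  "body = succ_check @ concat (map eqn_check Es) @ [Clear PX]"

abbreviation full :: "operation list" where "full \<equiv> Odo # body"

definition init :: lbl where "init = (full, 0)"

text \<open>A step of an idealised machine that is back at cell 1 at once when \<open>h\<close> is
  set; the walk home is added in the cellular automaton. There is no step on a
  \<open>Wall\<close>.\<close>

definition mid :: "config \<Rightarrow> config \<Rightarrow> bool" where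
  "mid c c' \<longleftrightarrow> (case c of (q, p, D, S) \<Rightarrow> K p \<noteq> Wall \<and>
     (\<exists>d s h q'. act full q (K p) (D p) (S p) = Some (d, s, h, q') \<and>
        c' = (q', if h then 1 else Suc p, D(p := d), S(p := s))))"

lemma midI:
  "K p \<noteq> Wall \<Longrightarrow> act full q (K p) (D p) (S p) = Some (d, s, h, q') \<Longrightarrow>
    mid (q, p, D, S) (q', if h then 1 else Suc p, D(p := d), S(p := s))"
  unfolding mid_def by auto

lemma mid_det: "mid c c1 \<Longrightarrow> mid c c2 \<Longrightarrow> c1 = c2"
  unfolding mid_def by (auto split: prod.splits)

definition skips :: "lbl \<Rightarrow> (nat \<Rightarrow> bool) \<Rightarrow> (nat \<Rightarrow> ptr set) \<Rightarrow> nat \<Rightarrow> bool" where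
  "skips q D S u \<longleftrightarrow> K u \<noteq> Wall \<and> act full q (K u) (D u) (S u) = Some (D u, S u, False, q)"

subsection \<open>Soundness\<close>

text \<open>This is what the recurrence of cell 1 reveals about the whole tape: the initial state
  comes back infinitely often, with unknown digits and marks elsewhere.\<close>

definition live :: "config \<Rightarrow> bool" where
  "live c \<longleftrightarrow> (\<forall>N. \<exists>n\<ge>N. \<exists>D S. (mid ^^ n) c (init, 1, D, S))"

lemma live_mid: "live c \<Longrightarrow> mid c c' \<Longrightarrow> live c'"
  unfolding live_def
proof
  fix N assume l: "\<forall>N. \<exists>n\<ge>N. \<exists>D S. (mid ^^ n) c (init, 1, D, S)" and m: "mid c c'"
  obtain n D S where n: "n \<ge> Suc N" "(mid ^^ n) c (init, 1, D, S)" using l by blast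
  then obtain n' where n': "n = Suc n'" by (cases n) auto
  obtain c1 where "mid c c1" "(mid ^^ n') c1 (init, 1, D, S)"
    using n(2) unfolding n' by (meson relpowp_Suc_D2)
  moreover have "c1 = c'" using mid_det[OF \<open>mid c c1\<close> m] .
  ultimately show "\<exists>n\<ge>N. \<exists>D S. (mid ^^ n) c' (init, 1, D, S)" using n(1) n' by blast
qed

text \<open>The number of steps to some return is the measure for the inductions: on an arbitrary
  tape neither a scan nor a loop need end by itself.\<close>

definition lives :: "nat \<Rightarrow> config \<Rightarrow> bool" where
  "lives n c \<longleftrightarrow> live c \<and> (\<exists>D S. (mid ^^ n) c (init, 1, D, S))"

lemma live_lives: "live c \<Longrightarrow> \<exists>n>0. lives n c"
  unfolding live_def lives_def by (meson Suc_le_eq)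

lemma lives_live: "lives n c \<Longrightarrow> live c"
  by (simp add: lives_def)

lemma lives_step:
  assumes "lives n (q, p, D, S)" "q \<noteq> init \<or> p \<noteq> 1 \<or> n > 0"
  shows "\<exists>d s h q' m. K p \<noteq> Wall \<and> act full q (K p) (D p) (S p) = Some (d, s, h, q') \<and>
    n = Suc m \<and> lives m (q', if h then 1 else Suc p, D(p := d), S(p := s))"
proof -
  obtain D' S' where e: "(mid ^^ n) (q, p, D, S) (init, 1, D', S')" using assms(1) by (auto simp: lives_def)
  have "n > 0" using assms(2) e by (cases n) auto
  then obtain m where m: "n = Suc m" by (cases n) auto
  obtain c1 where c1: "mid (q, p, D, S) c1" "(mid ^^ m) c1 (init, 1, D', S')"
    using e unfolding m by (meson relpowp_Suc_D2)
  have "live c1" using live_mid[OF _ c1(1)] assms(1) by (simp add: lives_def)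
  then have "lives m c1" using c1(2) by (auto simp: lives_def)
  moreover obtain d s h q' where "K p \<noteq> Wall" "act full q (K p) (D p) (S p) = Some (d, s, h, q')"
    "c1 = (q', if h then 1 else Suc p, D(p := d), S(p := s))"
    using c1(1) unfolding mid_def by auto
  ultimately show ?thesis using m by blast
qed

definition stops_at :: "lbl \<Rightarrow> (nat \<Rightarrow> bool) \<Rightarrow> (nat \<Rightarrow> ptr set) \<Rightarrow> nat \<Rightarrow> nat \<Rightarrow> ptr set \<Rightarrow> bool \<Rightarrow> lbl \<Rightarrow> bool"
  where "stops_at q D S p p' s h q' \<longleftrightarrow> p \<le> p' \<and> (\<forall>u. p \<le> u \<and> u < p' \<longrightarrow> skips q D S u) \<and> \<not> skips q D S p' \<and>
    K p' \<noteq> Wall \<and> act full q (K p') (D p') (S p') = Some (D p', s, h, q')"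

lemma stops_atD:
  assumes "stops_at q D S p p' s h q'"
  shows "p \<le> p'" "\<And>u. p \<le> u \<Longrightarrow> u < p' \<Longrightarrow> skips q D S u" "\<not> skips q D S p'" "K p' \<noteq> Wall"
    "act full q (K p') (D p') (S p') = Some (D p', s, h, q')"
  using assms by (auto simp: stops_at_def)

text \<open>\<open>Odo\<close> is the only operation that writes digits, and \<open>init\<close> is
  one of its states; in all other states the digits are constant and the next return is still to
  come.\<close>

definition no_odo :: "lbl \<Rightarrow> bool" where
  "no_odo q \<longleftrightarrow> (\<forall>r. fst q \<noteq> Odo # r)"

lemma act_digit: "act full q k d S = Some (d', s, h, q') \<Longrightarrow> no_odo q \<Longrightarrow> d' = d"
  by (cases "(full, q, k, d, S)" rule: act.cases) (auto simp: no_odo_def split: if_splits)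

lemma lives_walk:
  assumes "lives n (q, p, D, S)" "no_odo q"
  obtains p' s h q' m where "stops_at q D S p p' s h q'" "m < n"
    "lives m (q', if h then 1 else Suc p', D, S(p' := s))"
  using assms
proof (induction n arbitrary: p thesis)
  case 0
  then show ?case by (auto simp: lives_def no_odo_def init_def)
next
  case (Suc n)
  obtain d s h q' where d: "K p \<noteq> Wall" "act full q (K p) (D p) (S p) = Some (d, s, h, q')"
    "lives n (q', if h then 1 else Suc p, D(p := d), S(p := s))"
    using lives_step[OF Suc.prems(2)] by auto
  note dd = act_digit[OF d(2) Suc.prems(3)]
  have *: "act full q (K p) (D p) (S p) = Some (D p, s, h, q')"
    "lives n (q', if h then 1 else Suc p, D, S(p := s))"
    using d by (simp_all add: dd)
  show ?case
  proof (cases "skips q D S p")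
    case False
    show ?thesis by (rule Suc.prems(1)[OF _ _ *(2)]) (use False * d(1) in \<open>auto simp: stops_at_def\<close>)
  next
    case True
    then have "lives n (q, Suc p, D, S)" using * by (auto simp: skips_def)
    then obtain p' s h q' m where IH: "stops_at q D S (Suc p) p' s h q'" "m < n"
      "lives m (q', if h then 1 else Suc p', D, S(p' := s))"
      using Suc.IH Suc.prems(3) by blast
    have "\<forall>u. p \<le> u \<and> u < p' \<longrightarrow> skips q D S u"
      using True IH(1) unfolding stops_at_def by (metis Suc_le_eq order_le_less)
    then have "stops_at q D S p p' s h q'" using IH(1) by (simp add: stops_at_def)
    from Suc.prems(1)[OF this _ IH(3)] show ?thesis using IH(2) by simp
  qed
qed

lemma live_walk:
  assumes "live (q, p, D, S)" "no_odo q"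
  obtains p' s h q' where "stops_at q D S p p' s h q'" "live (q', if h then 1 else Suc p', D, S(p' := s))"
  using live_lives[OF assms(1)] lives_walk[OF _ assms(2)] lives_live by metis

lemma live_Place:
  assumes "live ((Place a # r, 0), 1, D, S)"
  shows "clr a 1 S" "live ((r, 0), 1, D, put a 1 S)"
proof -
  obtain p' s g q' where st: "stops_at (Place a # r, 0) D S 1 p' s g q'"
    and l: "live (q', if g then 1 else Suc p', D, S(p' := s))"
    by (rule live_walk[OF assms(1)]) (auto simp: no_odo_def)
  note * = stops_atD[OF st]
  have "\<not> skips (Place a # r, 0) D S 1" by (auto simp: skips_def)
  then have "p' = 1" using *(1) *(2)[of 1] by (metis le_neq_implies_less le_refl)
  with * l have "a \<notin> S 1" "live ((r, 0), 1, D, put a 1 S)" by (auto simp: put_def split: if_splits)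
  then show "clr a 1 S" "live ((r, 0), 1, D, put a 1 S)" by (auto simp: clr_def le_Suc_eq)
qed

lemma live_Clear:
  assumes "live ((Clear a # r, 0), 1, D, put a h S)" "clr a h S" "1 \<le> h"
  shows "live ((r, 0), 1, D, S)"
proof -
  let ?S = "put a h S"
  obtain p' s g q' where st: "stops_at (Clear a # r, 0) D ?S 1 p' s g q'"
    and l: "live (q', if g then 1 else Suc p', D, ?S(p' := s))"
    by (rule live_walk[OF assms(1)]) (auto simp: no_odo_def)
  note * = stops_atD[OF st]
  have "a \<in> ?S p'" using *(3,4) by (auto simp: skips_def split: if_splits)
  moreover have "a \<notin> ?S u" if "1 \<le> u" "u < p'" for u
    using *(2)[OF that] by (auto simp: skips_def split: if_splits)
  ultimately have p': "p' = h" by (metis first_unique[OF first_put_same[OF assms(2,3)]] *(1))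
  have "a \<notin> S h" using assms(2,3) by (auto simp: clr_def)
  then have "?S(h := ?S h - {a}) = S" by (rule put_remove)
  then show ?thesis using *(5) l \<open>a \<in> ?S p'\<close> unfolding p' by auto
qed

lemma live_TestEq:
  assumes "live ((TestEq a b # r, 0), 1, D, S)" "first a p S" "first b q S"
  shows "p = q" "live ((r, 0), 1, D, S)"
proof -
  obtain p' s g q' where st: "stops_at (TestEq a b # r, 0) D S 1 p' s g q'"
    and l: "live (q', if g then 1 else Suc p', D, S(p' := s))"
    by (rule live_walk[OF assms(1)]) (auto simp: no_odo_def)
  note * = stops_atD[OF st]
  have ab: "a \<in> S p'" "b \<in> S p'" using *(3,4,5) by (auto simp: skips_def split: if_splits)
  have "a \<notin> S u \<and> b \<notin> S u" if "1 \<le> u" "u < p'" for u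
    using *(2)[OF that] by (auto simp: skips_def split: if_splits)
  then have "p' = p" "p' = q"
    using first_unique[OF assms(2) *(1) ab(1)] first_unique[OF assms(3) *(1) ab(2)] by blast+
  then show "p = q" by simp
  show "live ((r, 0), 1, D, S)" using *(5) l ab by auto
qed

lemma live_Cond:
  assumes "live ((Cond b c n # r, 0), 1, D, S)" "first PX A S"
  shows "\<exists>u. stop K c A u \<and> live ((if (K u \<noteq> One c) = b then r else drop n r, 0), 1, D, S)"
proof -
  obtain p' s g q' where st: "stops_at (Cond b c n # r, 0) D S 1 p' s g q'"
    and l: "live (q', if g then 1 else Suc p', D, S(p' := s))"
    by (rule live_walk[OF assms(1)]) (auto simp: no_odo_def)
  note * = stops_atD[OF st]
  have x: "PX \<in> S p'" using *(3,4) by (auto simp: skips_def split: if_splits)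
  moreover have "PX \<notin> S u" if "1 \<le> u" "u < p'" for u
    using *(2)[OF that] by (auto simp: skips_def split: if_splits)
  ultimately have "p' = A" using first_unique[OF assms(2) *(1)] by blast
  then have "live ((Cond b c n # r, 1), Suc A, D, S)" using *(5) l x by auto
  then obtain u s g q' where st: "stops_at (Cond b c n # r, 1) D S (Suc A) u s g q'"
    and l: "live (q', if g then 1 else Suc u, D, S(u := s))"
    by (rule live_walk) (auto simp: no_odo_def)
  note ** = stops_atD[OF st]
  have ru: "reach c (K u)" using **(3,4) by (auto simp: skips_def split: if_splits)
  moreover have "K v \<noteq> Wall \<and> \<not> reach c (K v)" if "A < v" "v < u" for v
    using **(2)[of v] that by (auto simp: skips_def split: if_splits)
  ultimately have "stop K c A u" using **(1) by (auto simp: stop_def)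
  moreover have "live ((if (K u \<noteq> One c) = b then r else drop n r, 0), 1, D, S)"
    using **(5) l ru by (auto split: if_splits)
  ultimately show ?thesis by blast
qed

lemma live_TestSucc:
  assumes "live ((TestSucc # r, 0), 1, D, S)" "first PX A S" "first PQ Q S"
  shows "nxt K A Q" "live ((r, 0), 1, D, S)"
proof -
  obtain p' s g q' where st: "stops_at (TestSucc # r, 0) D S 1 p' s g q'"
    and l: "live (q', if g then 1 else Suc p', D, S(p' := s))"
    by (rule live_walk[OF assms(1)]) (auto simp: no_odo_def)
  note * = stops_atD[OF st]
  have x: "PX \<in> S p'" "PQ \<notin> S p'" using *(3,4,5) by (auto simp: skips_def split: if_splits)
  have y: "PX \<notin> S u \<and> PQ \<notin> S u" if "1 \<le> u" "u < p'" for u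
    using *(2)[OF that] by (auto simp: skips_def split: if_splits)
  have p': "p' = A" using first_unique[OF assms(2) *(1) x(1)] y by blast
  then have "live ((TestSucc # r, 1), Suc A, D, S)" using *(5) l x by auto
  then obtain u s g q' where st: "stops_at (TestSucc # r, 1) D S (Suc A) u s g q'"
    and l: "live (q', if g then 1 else Suc u, D, S(u := s))"
    by (rule live_walk) (auto simp: no_odo_def)
  note ** = stops_atD[OF st]
  have u: "K u = Hdr" "PQ \<in> S u" using **(3,4,5) by (auto simp: skips_def split: if_splits)
  have v: "K v \<noteq> Wall \<and> K v \<noteq> Hdr \<and> PQ \<notin> S v" if "A < v" "v < u" for v
    using **(2)[of v] that by (auto simp: skips_def split: if_splits)
  have "PQ \<notin> S v" if "1 \<le> v" "v < u" for v
    using that v[of v] y[of v] x p' by (metis linorder_neqE_nat)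
  then have "u = Q" using first_unique[OF assms(3) _ u(2)] **(1) by simp
  then show "nxt K A Q" using **(1) u v by (auto simp: nxt_def)
  show "live ((r, 0), 1, D, S)" using **(5) l u by auto
qed

text \<open>In one pass phase 1 takes \<open>PG\<close> up, phase 2 puts it on the next
  \<open>One i\<close> or ends the move, phase 3 takes \<open>b\<close> up, and phase 4 puts it on
  the next header. Phases 2 and 4 halt on a second copy of the mark that they carry, which keeps
  \<open>clr\<close> true at the new positions. The tape does not bound the number of passes, so the
  induction is over the steps to a return.\<close>

lemma lives_Move_loop:
  assumes "lives n ((Move a i b # r, 1), 1, D, put PG g (put b h S))"
    and "clr PG g S" "clr b h S" "b \<noteq> PG" "1 \<le> g" "1 \<le> h"
  shows "\<exists>v h'. cnt K i g v \<and> (nxt K ^^ v) h h' \<and> clr b h' S \<and> 1 \<le> h' \<and> live ((r, 0), 1, D, put b h' S)"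
  using assms
proof (induction n arbitrary: g h rule: less_induct)
  case (less n)
  let ?M = "Move a i b # r" let ?S = "put PG g (put b h S)" let ?T = "put b h S"
  obtain p' s x q' m where s1: "stops_at (?M, 1) D ?S 1 p' s x q'" and m1: "m < n"
    and l1: "lives m (q', if x then 1 else Suc p', D, ?S(p' := s))"
    by (rule lives_walk[OF less.prems(1)]) (auto simp: no_odo_def)
  note 1 = stops_atD[OF s1]
  have G: "PG \<in> ?S p'" using 1(3,4) by (auto simp: skips_def split: if_splits)
  have "PG \<notin> ?S u" if "1 \<le> u" "u < p'" for u
    using 1(2)[OF that] by (auto simp: skips_def split: if_splits)
  moreover have "first PG g ?S" using less.prems by (intro first_put_same) auto
  ultimately have p': "p' = g" using first_unique 1(1) G by blast
  have "PG \<notin> ?T g" using less.prems by (auto simp: clr_def)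
  then have "?S(g := ?S g - {PG}) = ?T" by (rule put_remove)
  then have "lives m ((?M, 2), Suc g, D, ?T)" using 1(5) l1 G unfolding p' by auto
  then obtain u s x q' m2 where s2: "stops_at (?M, 2) D ?T (Suc g) u s x q'" and m2: "m2 < m"
    and l2: "lives m2 (q', if x then 1 else Suc u, D, ?T(u := s))"
    by (rule lives_walk) (auto simp: no_odo_def)
  note 2 = stops_atD[OF s2]
  have u: "PG \<notin> S u" "reach i (K u)"
    using 2(3,4,5) by (auto simp: skips_def split: if_splits)
  have v: "PG \<notin> S v \<and> K v \<noteq> Wall \<and> \<not> reach i (K v)" if "g < v" "v < u" for v
    using 2(2)[of v] that by (auto simp: skips_def split: if_splits)
  have st: "stop K i g u" using 2(1) u v by (auto simp: stop_def)
  show ?case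
  proof (cases "K u = One i")
    case False
    have "live ((r, 0), 1, D, ?T)"
      using 2(5) l2 u False \<open>b \<noteq> PG\<close> lives_live[of m2] by (auto split: if_splits)
    then show ?thesis using cnt_0[OF st False] less.prems by (intro exI[of _ 0] exI[of _ h]) auto
  next
    case True
    let ?U = "put PG u ?T"
    have "lives m2 ((?M, 3), 1, D, ?U)"
      using 2(5) l2 u True \<open>b \<noteq> PG\<close> by (auto simp: put_def[of PG] split: if_splits)
    then obtain p' s x q' m3 where s3: "stops_at (?M, 3) D ?U 1 p' s x q'" and m3: "m3 < m2"
      and l3: "lives m3 (q', if x then 1 else Suc p', D, ?U(p' := s))"
      by (rule lives_walk) (auto simp: no_odo_def)
    note 3 = stops_atD[OF s3]
    have B: "b \<in> ?U p'" using 3(3,4) by (auto simp: skips_def split: if_splits)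
    have "b \<notin> ?U u" if "1 \<le> u" "u < p'" for u
      using 3(2)[OF that] by (auto simp: skips_def split: if_splits)
    moreover have "first b h ?U" using less.prems by (auto intro!: first_put_same)
    ultimately have p': "p' = h" using first_unique 3(1) B by blast
    let ?V = "put PG u S"
    have "b \<notin> ?V h" using less.prems by (auto simp: clr_def)
    then have "?U(h := ?U h - {b}) = ?V" unfolding put_commute[of PG u b] by (rule put_remove)
    then have "lives m3 ((?M, 4), Suc h, D, ?V)" using 3(5) l3 B unfolding p' by auto
    then obtain h' s x q' m4 where s4: "stops_at (?M, 4) D ?V (Suc h) h' s x q'" and m4: "m4 < m3"
      and l4: "lives m4 (q', if x then 1 else Suc h', D, ?V(h' := s))"
      by (rule lives_walk) (auto simp: no_odo_def)
    note 4 = stops_atD[OF s4]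
    have h': "b \<notin> ?V h'" "K h' = Hdr"
      using 4(3,4,5) by (auto simp: skips_def split: if_splits)
    have w: "b \<notin> ?V v \<and> K v \<noteq> Wall \<and> K v \<noteq> Hdr" if "h < v" "v < h'" for v
      using 4(2)[of v] that by (auto simp: skips_def split: if_splits)
    have nx: "nxt K h h'" using 4(1) h' w by (auto simp: nxt_def)
    have "b \<notin> S v" if v1: "1 \<le> v" "v \<le> h'" for v
    proof -
      consider "v \<le> h" | "h < v" "v < h'" | "v = h'" using v1 by linarith
      then show ?thesis using less.prems(3) v1 h'(1) w[of v] by cases (auto simp: clr_def)
    qed
    then have cb: "clr b h' S" by (simp add: clr_def)
    have "PG \<notin> S w" if w1: "1 \<le> w" "w \<le> u" for w
    proof -
      consider "w \<le> g" | "g < w" "w < u" | "w = u" using w1 by linarith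
      then show ?thesis using less.prems(2) w1 u(1) v[of w] by cases (auto simp: clr_def)
    qed
    then have cg: "clr PG u S" by (simp add: clr_def)
    have "lives m4 ((?M, 1), 1, D, put b h' ?V)"
      using 4(5) l4 h' by (auto simp: put_def[of b] split: if_splits)
    then have "lives m4 ((?M, 1), 1, D, put PG u (put b h' S))" by (simp add: put_commute[of b])
    moreover have "m4 < n" using m1 m2 m3 m4 by linarith
    ultimately obtain v h2 where e: "cnt K i u v" "(nxt K ^^ v) h' h2" "clr b h2 S" "1 \<le> h2"
      "live ((r, 0), 1, D, put b h2 S)"
      using less.IH[of m4 u h'] cg cb less.prems(4) 2(1) 4(1) by auto
    have "(nxt K ^^ Suc v) h h2" by (rule relpowp_Suc_I2[of "nxt K", OF nx e(2)])
    then show ?thesis using cnt_Suc[OF st True e(1)] e by blast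
  qed
qed

lemma live_Move:
  assumes "live ((Move a i b # r, 0), 1, D, put b h S)"
    and "clr b h S" "first a A S" "a \<noteq> b" "b \<noteq> PG" "a \<noteq> PG" "1 \<le> h"
  shows "\<exists>v h'. cnt K i A v \<and> (nxt K ^^ v) h h' \<and> clr b h' S \<and> 1 \<le> h' \<and> live ((r, 0), 1, D, put b h' S)"
proof -
  let ?M = "Move a i b # r" let ?S = "put b h S"
  obtain p' s x q' where st: "stops_at (?M, 0) D ?S 1 p' s x q'"
    and l: "live (q', if x then 1 else Suc p', D, ?S(p' := s))"
    by (rule live_walk[OF assms(1)]) (auto simp: no_odo_def)
  note 1 = stops_atD[OF st]
  have x: "a \<in> ?S p'" "PG \<notin> ?S p'" using 1(3,4,5) by (auto simp: skips_def split: if_splits)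
  have y: "a \<notin> ?S u \<and> PG \<notin> ?S u" if "1 \<le> u" "u < p'" for u
    using 1(2)[OF that] by (auto simp: skips_def split: if_splits)
  have "first a A ?S" using assms by simp
  then have p': "p' = A" using first_unique 1(1) x(1) y by blast
  have "clr PG A S" unfolding clr_def
  proof (intro allI impI)
    fix u assume "1 \<le> u \<and> u \<le> A"
    then show "PG \<notin> S u" using x(2) y[of u] unfolding p' by (cases "u = A") auto
  qed
  moreover have "live ((?M, 1), 1, D, put PG A ?S)"
    using 1(5) l x p' by (auto simp: put_def[of PG] split: if_splits)
  ultimately show ?thesis using live_lives lives_Move_loop assms 1(1) p' by blast
qed

lemma live_Odo:
  assumes "live (init, 1, D, S)"
  shows "\<exists>c. carry_at K D c \<and> clr PX c S \<and> live ((body, 0), 1, carry K D c, put PX c S)"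
proof -
  \<comment> \<open>The counter in the midst of a carry that has passed all cells below
    \<open>p\<close>; setting the digit at \<open>p\<close> completes it to
    \<open>carry\<close>.\<close>
  define E where "E p u = (if 1 \<le> u \<and> u < p \<and> K u = Hdr then False else D u)" for p u
  have *: "\<exists>c. carry_at K D c \<and> clr PX c S \<and> live ((body, 0), 1, carry K D c, put PX c S)"
    if "lives n (init, p, E p, S)" "1 \<le> p" "n > 0 \<or> p \<noteq> 1"
      "\<And>u. 1 \<le> u \<Longrightarrow> u < p \<Longrightarrow> K u \<noteq> Wall \<and> (K u = Hdr \<longrightarrow> D u) \<and> PX \<notin> S u" for n p
    using that
  proof (induction n arbitrary: p)
    case 0
    then show ?case by (auto simp: lives_def)
  next
    case (Suc n)
    have Ep: "E p p = D p" by (simp add: E_def)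
    obtain d s h q' where *: "K p \<noteq> Wall" "act full init (K p) (D p) (S p) = Some (d, s, h, q')"
      "lives n (q', if h then 1 else Suc p, (E p)(p := d), S(p := s))"
      using lives_step[OF Suc.prems(1)] Suc.prems(3) unfolding Ep by auto
    have X: "PX \<notin> S p" using *(2) by (auto simp: init_def split: if_splits)
    show ?case
    proof (cases "K p = Hdr \<and> \<not> D p")
      case True
      have "(E p)(p := True) = carry K D p" by (auto simp: E_def carry_def fun_eq_iff)
      then have "live ((body, 0), 1, carry K D p, put PX p S)"
        using * True X lives_live[of n] by (auto simp: init_def put_def)
      moreover have "carry_at K D p" using True Suc.prems by (auto simp: carry_at_def)
      moreover have "clr PX p S" using X Suc.prems(4) unfolding clr_def by (metis order_le_less)
      ultimately show ?thesis by blast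
    next
      case False
      have "(E p)(p := d) = E (Suc p)" "s = S p" "q' = init" "\<not> h"
        using *(2) False X Suc.prems(2)
        by (auto simp: init_def E_def fun_eq_iff less_Suc_eq split: if_splits)
      then have "lives n (init, Suc p, E (Suc p), S)" using *(3) by auto
      moreover have "K u \<noteq> Wall \<and> (K u = Hdr \<longrightarrow> D u) \<and> PX \<notin> S u" if "1 \<le> u" "u < Suc p" for u
        using Suc.prems(4)[of u] that *(1) False X by (cases "u = p") auto
      ultimately show ?thesis using Suc.IH[of "Suc p"] Suc.prems(2) by auto
    qed
  qed
  obtain n where "n > 0" "lives n (init, 1, D, S)" using live_lives[OF assms] by blast
  moreover have "E 1 = D" by (auto simp: E_def fun_eq_iff)
  ultimately show ?thesis using *[of n 1] by auto
qed

lemma live_succ_check: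
  assumes "live ((succ_check @ r, 0), 1, D, S)" "first PX c S"
  shows "succ_ok K c" "live ((r, 0), 1, D, S)"
proof -
  have 0: "live ((Place PQ # Move PX 1 PQ # TestSucc # Clear PQ # r, 0), 1, D, S)"
    using assms(1) by (simp add: succ_check_def)
  note 1 = live_Place[OF 0]
  obtain v Q where 2: "cnt K 1 c v" "(nxt K ^^ v) 1 Q" "clr PQ Q S" "1 \<le> Q"
    "live ((TestSucc # Clear PQ # r, 0), 1, D, put PQ Q S)"
    using live_Move[OF 1(2,1) assms(2)] by auto
  have f: "first PX c (put PQ Q S)" "first PQ Q (put PQ Q S)"
    using assms(2) 2 by (simp_all add: first_put_same)
  note 3 = live_TestSucc[OF 2(5) f]
  show "succ_ok K c" using 2 3(1) by (auto simp: succ_ok_def)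
  show "live ((r, 0), 1, D, S)" by (rule live_Clear[OF 3(2) 2(3,4)])
qed

lemma live_eqn_check:
  assumes "live ((eqn_check (b, z, i, j, k) @ r, 0), 1, D, S)" "first PX c S"
  shows "eqn_ok K c (b, z, i, j, k)" "live ((r, 0), 1, D, S)"
proof -
  let ?r = "[Place PP, Move PX j PP, Place PQ, Move PP i PQ, Place PR, Move PX k PR, TestEq PQ PR,
    Clear PP, Clear PQ, Clear PR] @ r"
  have "live ((Cond b z 10 # ?r, 0), 1, D, S)" using assms(1) by simp
  from live_Cond[OF this assms(2)] obtain u where u: "stop K z c u"
    "live ((if (K u \<noteq> One z) = b then ?r else drop 10 ?r, 0), 1, D, S)" by blast
  have "eqn_ok K c (b, z, i, j, k) \<and> live ((r, 0), 1, D, S)"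
  proof (cases "(K u \<noteq> One z) = b")
    case False
    then have "live ((r, 0), 1, D, S)" using u(2) by simp
    then show ?thesis using u(1) False by auto
  next
    case True
    let ?r3 = "Clear PP # Clear PQ # Clear PR # r" let ?r2 = "Place PR # Move PX k PR # TestEq PQ PR # ?r3"
    let ?r1 = "Place PQ # Move PP i PQ # ?r2"
    from True have 0: "live ((Place PP # Move PX j PP # ?r1, 0), 1, D, S)" using u(2) by simp
    note 1 = live_Place[OF 0]
    obtain a A where 2: "cnt K j c a" "(nxt K ^^ a) 1 A" "clr PP A S" "1 \<le> A"
      "live ((?r1, 0), 1, D, put PP A S)"
      using live_Move[OF 1(2,1) assms(2)] by auto
    let ?S1 = "put PP A S"
    note 3 = live_Place[OF 2(5)]
    have fP: "first PP A ?S1" by (rule first_put_same[OF 2(3,4)])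
    obtain v Q where 4: "cnt K i A v" "(nxt K ^^ v) 1 Q" "clr PQ Q ?S1" "1 \<le> Q"
      "live ((?r2, 0), 1, D, put PQ Q ?S1)"
      using live_Move[OF 3(2,1) fP] by auto
    let ?S2 = "put PQ Q ?S1"
    note 5 = live_Place[OF 4(5)]
    have fX: "first PX c ?S2" using assms(2) by simp
    obtain v' Q' where 6: "cnt K k c v'" "(nxt K ^^ v') 1 Q'" "clr PR Q' ?S2" "1 \<le> Q'"
      "live ((TestEq PQ PR # ?r3, 0), 1, D, put PR Q' ?S2)"
      using live_Move[OF 5(2,1) fX] by auto
    have "first PQ Q (put PR Q' ?S2)" "first PR Q' (put PR Q' ?S2)"
      using first_put_same[OF 4(3,4)] first_put_same[OF 6(3,4)] by simp_all
    note 7 = live_TestEq[OF 6(5) this]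
    have "live ((?r3, 0), 1, D, put PP A (put PQ Q (put PR Q' S)))"
      using 7(2) by (simp only: put_commute[of PR Q' PQ] put_commute[of PR Q' PP] put_commute[of PQ Q PP])
    then have "live ((Clear PQ # Clear PR # r, 0), 1, D, put PQ Q (put PR Q' S))"
      by (rule live_Clear) (use 2 in auto)
    then have "live ((Clear PR # r, 0), 1, D, put PR Q' S)"
      by (rule live_Clear) (use 4 in auto)
    then have "live ((r, 0), 1, D, S)"
      by (rule live_Clear) (use 6 in auto)
    moreover have "eqn_ok K c (b, z, i, j, k)" using u(1) 2(1,2) 4(1,2) 6(1,2) 7(1) unfolding eqn_ok.simps by blast
    ultimately show ?thesis by blast
  qed
  then show "eqn_ok K c (b, z, i, j, k)" "live ((r, 0), 1, D, S)" by blast+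
qed

lemma live_eqn_checks:
  assumes "live ((concat (map eqn_check es) @ r, 0), 1, D, S)" "first PX c S"
  shows "(\<forall>e\<in>set es. eqn_ok K c e) \<and> live ((r, 0), 1, D, S)"
  using assms(1)
proof (induction es)
  case (Cons e es)
  obtain b z i j k where e: "e = (b, z, i, j, k)" by (cases e)
  have "live ((eqn_check (b, z, i, j, k) @ concat (map eqn_check es) @ r, 0), 1, D, S)"
    using Cons.prems by (simp only: e list.map concat.simps append_assoc)
  from live_eqn_check[OF this assms(2)] show ?case using Cons.IH e by simp
qed simp

text \<open>Each check clears exactly what it has placed, so the marks after the round are the same
  \<open>S\<close>, stray ones included. Only the digits change from round to round.\<close>

theorem live_round:
  assumes "live (init, 1, D, S)"
  shows "\<exists>c. carry_at K D c \<and> succ_ok K c \<and> (\<forall>e\<in>set Es. eqn_ok K c e) \<and>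
    live (init, 1, carry K D c, S)"
proof -
  obtain c where c: "carry_at K D c" "clr PX c S" "live ((body, 0), 1, carry K D c, put PX c S)"
    using live_Odo[OF assms] by blast
  let ?D = "carry K D c" let ?S = "put PX c S"
  have c1: "1 \<le> c" using c(1) by (simp add: carry_at_def)
  have f: "first PX c ?S" by (rule first_put_same[OF c(2) c1])
  have "live ((succ_check @ concat (map eqn_check Es) @ [Clear PX], 0), 1, ?D, ?S)"
    using c(3) by (simp only: body_def)
  note 1 = live_succ_check[OF this f]
  note 2 = live_eqn_checks[OF 1(2) f]
  have "live (([Clear PX], 0), 1, ?D, ?S)" using 2 by simp
  from live_Clear[OF this c(2) c1] have 3: "live (([], 0), 1, ?D, S)" .
  have "mid (([], 0), 1, ?D, S) (init, 1, ?D, S)"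
    using midI[of 1 "([], 0)" ?D S "?D 1" "S 1" True init] K1 by (simp add: init_def)
  from live_mid[OF 3 this] show ?thesis using c(1) 1(1) 2 by blast
qed

end

section \<open>Infinitely many rounds yield a solution\<close>

lemma nxt_det: "nxt K h a \<Longrightarrow> nxt K h b \<Longrightarrow> a = b"
  unfolding nxt_def by (metis linorder_neqE_nat)

lemma stop_det: "stop K i g a \<Longrightarrow> stop K i g b \<Longrightarrow> a = b"
  unfolding stop_def by (metis linorder_neqE_nat)

lemma relpowp_nxt_det: "(nxt K ^^ n) h a \<Longrightarrow> (nxt K ^^ n) h b \<Longrightarrow> a = b"
proof (induction n arbitrary: a b)
  case (Suc n)
  then show ?case by (metis nxt_det relpowp_Suc_E)
qed simp

lemma cnt_det: "cnt K i g v \<Longrightarrow> cnt K i g v' \<Longrightarrow> v = v'"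
proof (induction arbitrary: v' rule: cnt.induct)
  case (cnt_0 g u)
  from cnt_0(3,1,2) show ?case by cases (auto dest: stop_det)
next
  case (cnt_Suc g u v)
  from cnt_Suc(5) show ?case
  proof cases
    case (cnt_0 u')
    then show ?thesis using cnt_Suc stop_det by metis
  next
    case (cnt_Suc u' w)
    then have "u' = u" using \<open>stop K i g u\<close> stop_det by metis
    then show ?thesis using \<open>v' = Suc w\<close> \<open>cnt K i u' w\<close> \<open>\<And>v'. cnt K i u v' \<Longrightarrow> v = v'\<close> by simp
  qed
qed

lemma cnt_zero_iff: "cnt K i g v \<Longrightarrow> stop K i g u \<Longrightarrow> v = 0 \<longleftrightarrow> K u \<noteq> One i"
  by (erule cnt.cases) (auto dest: stop_det)

text \<open>The header \<open>h'\<close> ends every search, so no search leaves the block, and each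
  hit shortens the distance to \<open>h'\<close>.\<close>

lemma cnt_exists:
  assumes "nxt K h h'" "h \<le> g" "g < h'"
  shows "\<exists>v. cnt K i g v"
  using assms(2,3)
proof (induction "h' - g" arbitrary: g rule: less_induct)
  case less
  let ?P = "\<lambda>u. g < u \<and> reach i (K u)"
  have P: "?P h'" using assms(1) less.prems by (auto simp: nxt_def)
  define u where "u = (LEAST u. ?P u)"
  have u: "?P u" unfolding u_def by (rule LeastI[of ?P, OF P])
  have le: "u \<le> h'" unfolding u_def by (rule Least_le[of ?P, OF P])
  have "\<not> ?P v" if "v < u" for v using that unfolding u_def by (rule not_less_Least)
  then have st: "stop K i g u"
    using u le less.prems assms(1) by (auto simp: stop_def nxt_def)
  show ?case
  proof (cases "K u = One i")
    case True
    then have "u < h'" using le assms(1) by (cases "u = h'") (auto simp: nxt_def)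
    then have "h' - u < h' - g" using u less.prems by (intro diff_less_mono2) auto
    then obtain v where "cnt K i u v" using less.hyps[of u] u less.prems(1) \<open>u < h'\<close> by auto
    then show ?thesis using cnt_Suc[OF st True] by blast
  qed (use cnt_0[OF st] in blast)
qed

lemma carry_facts:
  assumes "carry_at K D c" "1 \<le> h" "K h = Hdr"
  shows "c < h \<Longrightarrow> carry K D c h = D h"
    and "c = h \<Longrightarrow> \<not> D h \<and> carry K D c h"
    and "c > h \<Longrightarrow> D h \<and> \<not> carry K D c h"
  using assms by (auto simp: carry_at_def carry_def)

text \<open>A stop at \<open>h\<close> needs digit 0 there and leaves 1, a carry beyond
  \<open>h\<close> needs 1 and leaves 0, and shorter carries do not touch it. So the two events
  alternate: between two stops at \<open>h\<close> there is a longer carry, and between two longer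
  carries a stop at \<open>h\<close>. The initial digits are arbitrary.\<close>

lemma odometer_reaches:
  fixes Ds :: "nat \<Rightarrow> nat \<Rightarrow> bool" and cs :: "nat \<Rightarrow> nat"
  assumes c: "\<And>r. carry_at K (Ds r) (cs r)" and D: "\<And>r. Ds (Suc r) = carry K (Ds r) (cs r)"
    and h: "1 \<le> h" "K h = Hdr" and inf: "\<And>N. \<exists>r\<ge>N. cs r \<ge> h"
  shows "\<exists>r\<ge>N. cs r > h" "\<exists>r. cs r = h"
proof -
  note F = carry_facts[OF c h, folded D]
  show gt: "\<exists>r\<ge>N. cs r > h" for N
  proof (rule ccontr)
    assume "\<not> (\<exists>r\<ge>N. cs r > h)"
    then have le: "\<And>r. r \<ge> N \<Longrightarrow> cs r \<le> h" by (meson not_le)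
    obtain r1 where r1: "r1 \<ge> N" "cs r1 \<ge> h" using inf by blast
    then have "cs r1 = h" using le by (simp add: le_antisym)
    have "Ds (Suc r1 + d) h" for d
    proof (induction d)
      case 0
      show ?case using F(2)[OF \<open>cs r1 = h\<close>] by simp
    next
      case (Suc d)
      have "cs (Suc r1 + d) \<noteq> h" using F(2)[of "Suc r1 + d"] Suc by blast
      then have "cs (Suc r1 + d) < h" using le[of "Suc r1 + d"] r1(1) by simp
      then show ?case using F(1)[of "Suc r1 + d"] Suc by simp
    qed
    then have "Ds r h" if "r \<ge> Suc r1" for r using that by (metis le_add_diff_inverse)
    moreover obtain r2 where r2: "r2 \<ge> Suc r1" "cs r2 \<ge> h" using inf by blast
    moreover have "cs r2 = h" using r2 le[of r2] r1(1) by simp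
    ultimately show False using F(2)[of r2] by blast
  qed
  show "\<exists>r. cs r = h"
  proof (rule ccontr)
    assume ne: "\<not> (\<exists>r. cs r = h)"
    obtain r1 where r1: "cs r1 > h" using gt by blast
    have "\<not> Ds (Suc r1 + d) h" for d
    proof (induction d)
      case 0
      show ?case using F(3)[OF r1] by simp
    next
      case (Suc d)
      have "\<not> cs (Suc r1 + d) > h" using F(3)[of "Suc r1 + d"] Suc by blast
      then have "cs (Suc r1 + d) < h" using ne by (meson linorder_neqE_nat)
      then show ?case using F(1)[of "Suc r1 + d"] Suc by simp
    qed
    then have "\<not> Ds r h" if "r \<ge> Suc r1" for r using that by (metis le_add_diff_inverse)
    moreover obtain r2 where "r2 \<ge> Suc r1" "cs r2 > h" using gt by blast
    ultimately show False using F(3)[of r2] by blast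
  qed
qed

context machine
begin

lemma live_rounds:
  assumes "live (init, 1, D, S)"
  shows "\<exists>Ds cs. \<forall>r. carry_at K (Ds r) (cs r) \<and> Ds (Suc r) = carry K (Ds r) (cs r) \<and>
    succ_ok K (cs r) \<and> (\<forall>e\<in>set Es. eqn_ok K (cs r) e)"
proof -
  let ?ok = "\<lambda>D c. carry_at K D c \<and> succ_ok K c \<and> (\<forall>e\<in>set Es. eqn_ok K c e) \<and>
    live (init, 1, carry K D c, S)"
  define g where "g D = (SOME c. ?ok D c)" for D
  have g: "?ok D (g D)" if "live (init, 1, D, S)" for D
    unfolding g_def by (rule someI_ex) (rule live_round[OF that])
  define Ds where "Ds r = ((\<lambda>D. carry K D (g D)) ^^ r) D" for r
  have "live (init, 1, Ds r, S)" for r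
  proof (induction r)
    case 0
    show ?case using assms by (simp add: Ds_def)
  next
    case (Suc r)
    then show ?case using g[of "Ds r"] by (simp add: Ds_def)
  qed
  then have ok: "?ok (Ds r) (g (Ds r))" for r by (rule g)
  show ?thesis
    by (rule exI[of _ Ds], rule exI[of _ "\<lambda>r. g (Ds r)"]) (use ok in \<open>auto simp: Ds_def\<close>)
qed

theorem live_solution:
  assumes "live (init, 1, D, S)" "cnt K 0 1 w"
  shows "solvable (set Es) w"
proof -
  obtain Ds cs where R: "\<forall>r. carry_at K (Ds r) (cs r) \<and> Ds (Suc r) = carry K (Ds r) (cs r) \<and>
    succ_ok K (cs r) \<and> (\<forall>e\<in>set Es. eqn_ok K (cs r) e)"
    using live_rounds[OF assms(1)] by (elim exE) (rule that)
  then have c: "\<And>r. carry_at K (Ds r) (cs r)" and D: "\<And>r. Ds (Suc r) = carry K (Ds r) (cs r)"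
    and sok: "\<And>r. succ_ok K (cs r)" and eok: "\<And>r e. e \<in> set Es \<Longrightarrow> eqn_ok K (cs r) e"
    by simp_all
  have ex: "\<exists>h. (nxt K ^^ n) 1 h \<and> 1 \<le> h \<and> K h = Hdr \<and> (\<forall>N. \<exists>r\<ge>N. cs r \<ge> h)" for n
  proof (induction n)
    case 0
    have "cs r \<ge> 1" for r using c[of r] by (simp add: carry_at_def)
    then show ?case using K1 by (intro exI[of _ 1]) auto
  next
    case (Suc n)
    then obtain h where h: "(nxt K ^^ n) 1 h" "1 \<le> h" "K h = Hdr" "\<And>N. \<exists>r\<ge>N. cs r \<ge> h" by blast
    note gt = odometer_reaches(1)[of K Ds cs, OF c D h(2-4)]
    let ?P = "\<lambda>u. h < u \<and> K u = Hdr"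
    define h' where "h' = (LEAST u. ?P u)"
    have P: "?P (cs r)" if "cs r > h" for r using that c[of r] by (simp add: carry_at_def)
    then have le: "h' \<le> cs r" if "cs r > h" for r
      using that unfolding h'_def by (intro Least_le[of ?P]) auto
    \<comment> \<open>A stop beyond \<open>h\<close> shows that a next header exists and that no
      wall precedes it. All such stops are at \<open>h'\<close> or later, and they recur, so the
      induction can go on from \<open>h'\<close>.\<close>
    obtain r where r: "cs r > h" using gt by blast
    have h': "?P h'" unfolding h'_def by (rule LeastI[of ?P, OF P[OF r]])
    have "\<not> ?P v" if "v < h'" for v using that unfolding h'_def by (rule not_less_Least)
    then have "nxt K h h'"
      using h' c[of r] h(2) le[OF r] by (auto simp: nxt_def carry_at_def)
    then have "(nxt K ^^ Suc n) 1 h'" using h(1) by auto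
    moreover have "\<exists>r\<ge>N. cs r \<ge> h'" for N using gt[of N] le by blast
    ultimately show ?case using h' by (intro exI[of _ h']) auto
  qed
  define hp where "hp n = (SOME h. (nxt K ^^ n) 1 h \<and> 1 \<le> h \<and> K h = Hdr \<and> (\<forall>N. \<exists>r\<ge>N. cs r \<ge> h))" for n
  have hp: "(nxt K ^^ n) 1 (hp n)" "1 \<le> hp n" "K (hp n) = Hdr" "\<And>N. \<exists>r\<ge>N. cs r \<ge> hp n" for n
    using someI_ex[OF ex[of n]] unfolding hp_def by blast+
  have eq_hp: "h = hp n" if "(nxt K ^^ n) 1 h" for h n by (rule relpowp_nxt_det[OF that hp(1)])
  have nx: "nxt K (hp n) (hp (Suc n))" for n
  proof -
    obtain h where "(nxt K ^^ n) 1 h" "nxt K h (hp (Suc n))" using hp(1)[of "Suc n"] by auto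
    then show ?thesis using eq_hp by metis
  qed
  \<comment> \<open>The machine compares positions only; monotonicity turns their equality into
    equality of numbers.\<close>
  have "strict_mono hp" by (rule strict_mono_Suc_iff[THEN iffD2]) (use nx in \<open>auto simp: nxt_def\<close>)
  then have inj: "hp a = hp b \<Longrightarrow> a = b" for a b by (metis strict_mono_eq)
  define f where "f i n = (THE v. cnt K i (hp n) v)" for i n
  have cf: "cnt K i (hp n) (f i n)" for i n
  proof -
    have "hp n < hp (Suc n)" using nx by (auto simp: nxt_def)
    then obtain v where "cnt K i (hp n) v" using cnt_exists[OF nx order_refl] by blast
    then show ?thesis unfolding f_def using cnt_det by (metis theI)
  qed
  have f_eq: "f i n = v" if "cnt K i (hp n) v" for i n v by (rule cnt_det[OF cf that])
  have at: "\<exists>r. cs r = hp n" for n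
    by (rule odometer_reaches(2)[of K Ds cs, OF c D hp(2-4)])
  have "hp 0 = 1" using hp(1)[of 0] by simp
  then have "f 0 0 = w" using f_eq assms(2) by simp
  moreover have "f 1 n = Suc n" for n
  proof -
    obtain r where "cs r = hp n" using at by blast
    then obtain v Q where vQ: "cnt K 1 (hp n) v" "(nxt K ^^ v) 1 Q" "nxt K (hp n) Q"
      using sok[of r] unfolding succ_ok_def by auto
    have "hp v = hp (Suc n)" using eq_hp[OF vQ(2)] nxt_det[OF vQ(3) nx] by simp
    then show ?thesis using f_eq[OF vQ(1)] inj by simp
  qed
  moreover have "f i (f j n) = f k n" if e: "(b, z, i, j, k) \<in> set Es" "(f z n = 0) = b" for b z i j k n
  proof -
    obtain r where "cs r = hp n" using at by blast
    then have "eqn_ok K (hp n) (b, z, i, j, k)" using eok[OF e(1), of r] by simp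
    then obtain u where u: "stop K z (hp n) u" and ok: "(K u \<noteq> One z) = b \<Longrightarrow>
       \<exists>a A v Q v'. cnt K j (hp n) a \<and> (nxt K ^^ a) 1 A \<and> cnt K i A v \<and> (nxt K ^^ v) 1 Q \<and>
        cnt K k (hp n) v' \<and> (nxt K ^^ v') 1 Q"
      unfolding eqn_ok.simps by blast
    have "(K u \<noteq> One z) = b" using cnt_zero_iff[OF cf u] e(2) by simp
    then obtain a A v Q v' where *: "cnt K j (hp n) a" "(nxt K ^^ a) 1 A" "cnt K i A v"
      "(nxt K ^^ v) 1 Q" "cnt K k (hp n) v'" "(nxt K ^^ v') 1 Q" using ok by blast
    have "hp v = hp v'" using eq_hp[OF *(4)] eq_hp[OF *(6)] by simp
    then have "v = v'" by (rule inj)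
    then show ?thesis
      using f_eq[OF *(1)] f_eq[OF *(5)] f_eq[of i a v] *(3) eq_hp[OF *(2)] by simp
  qed
  then have "holds f (set Es)" unfolding holds_def by blast
  ultimately show ?thesis unfolding solvable_def by (intro exI[of _ f]) auto
qed

end

section \<open>A solution yields recurrence\<close>

locale machine_tape = machine +
  assumes no_wall: "u \<ge> 1 \<Longrightarrow> K u \<noteq> Wall"
begin

lemma walk:
  assumes "p \<le> p'" "\<And>u. p \<le> u \<Longrightarrow> u < p' \<Longrightarrow> skips q D S u"
  shows "mid\<^sup>*\<^sup>* (q, p, D, S) (q, p', D, S)"
  using assms
proof (induction p' rule: dec_induct)
  case (step n)
  have "skips q D S n" using step by simp
  then have "mid (q, n, D, S) (q, Suc n, D, S)"
    using midI[of n q D S "D n" "S n" False q] by (simp add: skips_def)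
  moreover have "mid\<^sup>*\<^sup>* (q, p, D, S) (q, n, D, S)" using step by simp
  ultimately show ?case by (rule rtranclp.rtrancl_into_rtrancl[rotated])
qed simp

lemma walk_act:
  assumes "p \<le> p'" "\<And>u. p \<le> u \<Longrightarrow> u < p' \<Longrightarrow> skips q D S u" "1 \<le> p'"
    and "act full q (K p') (D p') (S p') = Some (D p', s, h, q')"
    and "c = (q', if h then 1 else Suc p', D, S(p' := s))"
  shows "mid\<^sup>*\<^sup>* (q, p, D, S) c"
proof -
  have "mid (q, p', D, S) c"
    using midI[of p' q D S, OF no_wall[OF assms(3)] assms(4)] assms(5) by simp
  with walk[OF assms(1,2)] show ?thesis by (rule rtranclp.rtrancl_into_rtrancl)
qed

lemma run_Place: "a \<notin> S 1 \<Longrightarrow> mid\<^sup>*\<^sup>* ((Place a # r, 0), 1, D, S) ((r, 0), 1, D, put a 1 S)"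
  by (rule walk_act[of 1 1]) (auto simp: put_def)

lemma run_Clear:
  assumes "clr a h S" "1 \<le> h"
  shows "mid\<^sup>*\<^sup>* ((Clear a # r, 0), 1, D, put a h S) ((r, 0), 1, D, S)"
proof (rule walk_act[OF assms(2)])
  have "a \<notin> S h" using assms by (auto simp: clr_def)
  show "((r, 0), 1, D, S) = ((r, 0), if True then 1 else Suc h, D, (put a h S)(h := put a h S h - {a}))"
    unfolding put_remove[of a S h, OF \<open>a \<notin> S h\<close>] by simp
qed (use assms no_wall in \<open>auto simp: skips_def clr_def\<close>)

lemma run_TestEq:
  assumes "first a p S" "first b p S"
  shows "mid\<^sup>*\<^sup>* ((TestEq a b # r, 0), 1, D, S) ((r, 0), 1, D, S)"
  by (rule walk_act[of 1 p _ _ _ "S p" True]) (use assms no_wall in \<open>auto simp: skips_def first_def\<close>)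

lemma run_Cond:
  assumes "first PX A S" "stop K c A u"
  shows "mid\<^sup>*\<^sup>* ((Cond b c n # r, 0), 1, D, S) ((if (K u \<noteq> One c) = b then r else drop n r, 0), 1, D, S)"
proof -
  have "mid\<^sup>*\<^sup>* ((Cond b c n # r, 0), 1, D, S) ((Cond b c n # r, 1), Suc A, D, S)"
    by (rule walk_act[of 1 A _ _ _ "S A" False]) (use assms no_wall in \<open>auto simp: skips_def first_def\<close>)
  also have "mid\<^sup>*\<^sup>* \<dots> ((if (K u \<noteq> One c) = b then r else drop n r, 0), 1, D, S)"
    by (rule walk_act[of "Suc A" u _ _ _ "S u" True]) (use assms no_wall in \<open>auto simp: skips_def stop_def\<close>)
  finally show ?thesis .
qed

lemma run_TestSucc:
  assumes "first PX A S" "first PQ Q S" "nxt K A Q"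
  shows "mid\<^sup>*\<^sup>* ((TestSucc # r, 0), 1, D, S) ((r, 0), 1, D, S)"
proof -
  have "mid\<^sup>*\<^sup>* ((TestSucc # r, 0), 1, D, S) ((TestSucc # r, 1), Suc A, D, S)"
    by (rule walk_act[of 1 A _ _ _ "S A" False])
      (use assms no_wall in \<open>auto simp: skips_def first_def nxt_def\<close>)
  also have "mid\<^sup>*\<^sup>* \<dots> ((r, 0), 1, D, S)"
    by (rule walk_act[of "Suc A" Q _ _ _ "S Q" True])
      (use assms no_wall in \<open>auto simp: skips_def first_def nxt_def\<close>)
  finally show ?thesis .
qed

definition none :: "ptr \<Rightarrow> (nat \<Rightarrow> ptr set) \<Rightarrow> bool" where
  "none a S \<longleftrightarrow> (\<forall>u. a \<notin> S u)"

lemma none_put [simp]: "b \<noteq> a \<Longrightarrow> none b (put a p S) \<longleftrightarrow> none b S"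
  by (simp add: none_def)

lemma none_clr: "none a S \<Longrightarrow> clr a p S"
  by (simp add: none_def clr_def)

lemma run_Move_loop:
  assumes "cnt K i g v" "(nxt K ^^ v) h h'" "none PG S" "none b S" "b \<noteq> PG" "1 \<le> g" "1 \<le> h"
  shows "mid\<^sup>*\<^sup>* ((Move a i b # r, 1), 1, D, put PG g (put b h S)) ((r, 0), 1, D, put b h' S)"
  using assms
proof (induction arbitrary: h rule: cnt.induct)
  case (cnt_0 g u)
  let ?M = "Move a i b # r"
  have "mid\<^sup>*\<^sup>* ((?M, 1), 1, D, put PG g (put b h S)) ((?M, 2), Suc g, D, put b h S)"
    by (rule walk_act[of 1 g _ _ _ "put b h S g" False])
      (use cnt_0.hyps cnt_0.prems(2-6) no_wall in \<open>auto simp: skips_def none_def put_def fun_eq_iff\<close>)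
  also have "mid\<^sup>*\<^sup>* \<dots> ((r, 0), 1, D, put b h S)"
    by (rule walk_act[of "Suc g" u _ _ _ "put b h S u" True])
      (use cnt_0.hyps cnt_0.prems(2-6) no_wall in \<open>auto simp: skips_def none_def stop_def\<close>)
  finally show ?case using cnt_0 by simp
next
  case (cnt_Suc g u v)
  let ?M = "Move a i b # r"
  obtain h1 where h1: "nxt K h h1" "(nxt K ^^ v) h1 h'" using cnt_Suc.prems(1) by (meson relpowp_Suc_D2)
  have s1: "mid\<^sup>*\<^sup>* ((?M, 1), 1, D, put PG g (put b h S)) ((?M, 2), Suc g, D, put b h S)"
    by (rule walk_act[of 1 g _ _ _ "put b h S g" False])
      (use cnt_Suc.hyps(1,2) cnt_Suc.prems(2-6) no_wall in \<open>auto simp: skips_def none_def put_def fun_eq_iff\<close>)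
  have s2: "mid\<^sup>*\<^sup>* \<dots> ((?M, 3), 1, D, put PG u (put b h S))"
    by (rule walk_act[of "Suc g" u _ _ _ "insert PG (put b h S u)" True])
      (use cnt_Suc.hyps(1,2) cnt_Suc.prems(2-6) no_wall in \<open>auto simp: skips_def none_def stop_def put_def[of PG]\<close>)
  have s3: "mid\<^sup>*\<^sup>* \<dots> ((?M, 4), Suc h, D, put PG u S)"
    by (rule walk_act[of 1 h _ _ _ "put PG u S h" False])
      (use cnt_Suc.hyps(1,2) cnt_Suc.prems(2-6) no_wall in \<open>auto simp: skips_def none_def put_def fun_eq_iff\<close>)
  have s4: "mid\<^sup>*\<^sup>* \<dots> ((?M, 1), 1, D, put PG u (put b h1 S))"
    unfolding put_commute[of PG u b]
    by (rule walk_act[of "Suc h" h1 _ _ _ "insert b (put PG u S h1)" True])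
      (use cnt_Suc.hyps(1,2) cnt_Suc.prems(2-6) h1(1) no_wall in \<open>auto simp: skips_def none_def nxt_def put_def[of b]\<close>)
  have s5: "mid\<^sup>*\<^sup>* \<dots> ((r, 0), 1, D, put b h' S)"
    using cnt_Suc.IH[OF h1(2)] cnt_Suc.prems cnt_Suc.hyps h1 by (auto simp: stop_def nxt_def)
  show ?case
      by (rule rtranclp_trans[OF s1 rtranclp_trans[OF s2 rtranclp_trans[OF s3 rtranclp_trans[OF s4 s5]]]])
qed

lemma run_Move:
  assumes "cnt K i A v" "(nxt K ^^ v) h h'" "none PG S" "none b S" "a \<noteq> b" "b \<noteq> PG" "a \<noteq> PG"
    "first a A S" "1 \<le> h"
  shows "mid\<^sup>*\<^sup>* ((Move a i b # r, 0), 1, D, put b h S) ((r, 0), 1, D, put b h' S)"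
proof -
  have A: "1 \<le> A" using assms(8) by (simp add: first_def)
  have "mid\<^sup>*\<^sup>* ((Move a i b # r, 0), 1, D, put b h S) ((Move a i b # r, 1), 1, D, put PG A (put b h S))"
    by (rule walk_act[of 1 A _ _ _ "insert PG (put b h S A)" True])
      (use assms no_wall in \<open>auto simp: skips_def none_def first_def put_def[of PG]\<close>)
  also have "mid\<^sup>*\<^sup>* \<dots> ((r, 0), 1, D, put b h' S)"
    by (rule run_Move_loop) (use assms A in auto)
  finally show ?thesis .
qed

lemma run_Odo:
  assumes "carry_at K D c" "none PX S"
  shows "mid\<^sup>*\<^sup>* (init, 1, D, S) ((body, 0), 1, carry K D c, put PX c S)"
proof -
  define E where "E p u = (if 1 \<le> u \<and> u < p \<and> K u = Hdr then False else D u)" for p u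
  have c: "1 \<le> c" using assms(1) by (simp add: carry_at_def)
  then have "mid\<^sup>*\<^sup>* (init, 1, D, S) (init, c, E c, S)"
    using assms(1)
  proof -
    have "p \<le> c \<Longrightarrow> mid\<^sup>*\<^sup>* (init, 1, D, S) (init, p, E p, S)" if "1 \<le> p" for p
      using that
    proof (induction p rule: dec_induct)
      case base
      have "E 1 = D" by (auto simp: E_def fun_eq_iff)
      then show ?case by simp
    next
      case (step n)
      have "act full init (K n) (E n n) (S n) = Some (if K n = Hdr then False else E n n, S n, False, init)"
        using step assms by (auto simp: E_def init_def none_def carry_at_def)
      from midI[of n init "E n" S, OF no_wall[OF step(1)] this]
      have "mid (init, n, E n, S) (init, Suc n, (E n)(n := (if K n = Hdr then False else E n n)), S)" by simp
      moreover have "(E n)(n := (if K n = Hdr then False else E n n)) = E (Suc n)"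
        using step(1) by (auto simp: E_def fun_eq_iff less_Suc_eq)
      ultimately have "mid (init, n, E n, S) (init, Suc n, E (Suc n), S)" by simp
      moreover have "mid\<^sup>*\<^sup>* (init, 1, D, S) (init, n, E n, S)" using step by simp
      ultimately show ?case by (rule rtranclp.rtrancl_into_rtrancl[rotated])
    qed
    then show ?thesis using c by blast
  qed
  moreover have "act full init (K c) (E c c) (S c) = Some (True, insert PX (S c), True, (body, 0))"
    using assms by (auto simp: E_def init_def none_def carry_at_def)
  then have "mid (init, c, E c, S) ((body, 0), 1, (E c)(c := True), put PX c S)"
    using midI[OF no_wall[OF c], of init "E c" S] by (simp add: put_def)
  moreover have "(E c)(c := True) = carry K D c" by (auto simp: E_def carry_def fun_eq_iff)
  ultimately show ?thesis by simp
qed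

lemma run_succ_check:
  assumes "succ_ok K c" "first PX c S" "none PQ S" "none PG S"
  shows "mid\<^sup>*\<^sup>* ((succ_check @ r, 0), 1, D, S) ((r, 0), 1, D, S)"
proof -
  obtain v Q where Q: "cnt K 1 c v" "(nxt K ^^ v) 1 Q" "nxt K c Q" using assms(1) by (auto simp: succ_ok_def)
  have Q1: "1 \<le> Q" using Q(3) by (simp add: nxt_def)
  have s1: "mid\<^sup>*\<^sup>* ((succ_check @ r, 0), 1, D, S) ((Move PX 1 PQ # TestSucc # Clear PQ # r, 0), 1, D, put PQ 1 S)"
    unfolding succ_check_def append.simps by (rule run_Place) (use assms in \<open>auto simp: none_def\<close>)
  have s2: "mid\<^sup>*\<^sup>* \<dots> ((TestSucc # Clear PQ # r, 0), 1, D, put PQ Q S)"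
    by (rule run_Move[OF Q(1,2)]) (use assms in auto)
  have s3: "mid\<^sup>*\<^sup>* \<dots> ((Clear PQ # r, 0), 1, D, put PQ Q S)"
    by (rule run_TestSucc[OF _ _ Q(3)]) (use assms Q1 none_clr in \<open>auto intro!: first_put_same\<close>)
  have s4: "mid\<^sup>*\<^sup>* \<dots> ((r, 0), 1, D, S)"
    by (rule run_Clear) (use assms Q1 none_clr in auto)
  show ?thesis
      by (rule rtranclp_trans[OF s1 rtranclp_trans[OF s2 rtranclp_trans[OF s3 s4]]])
qed

lemma relpowp_nxt_ge: "(nxt K ^^ n) a b \<Longrightarrow> a \<le> b"
proof (induction n arbitrary: b)
  case (Suc n)
  then obtain b' where "(nxt K ^^ n) a b'" "nxt K b' b" by auto
  moreover from this(2) have "b' < b" by (simp add: nxt_def)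
  ultimately show ?case using Suc.IH[of b'] by simp
qed simp

lemma run_eqn_check:
  assumes "eqn_ok K c (b, z, i, j, k)" "first PX c S" "none PP S" "none PQ S" "none PR S" "none PG S"
  shows "mid\<^sup>*\<^sup>* ((eqn_check (b, z, i, j, k) @ r, 0), 1, D, S) ((r, 0), 1, D, S)"
proof -
  let ?r = "[Place PP, Move PX j PP, Place PQ, Move PP i PQ, Place PR, Move PX k PR, TestEq PQ PR,
    Clear PP, Clear PQ, Clear PR] @ r"
  obtain u where u: "stop K z c u" "(K u \<noteq> One z) = b \<longrightarrow>
     (\<exists>a A v Q v'. cnt K j c a \<and> (nxt K ^^ a) 1 A \<and> cnt K i A v \<and> (nxt K ^^ v) 1 Q \<and>
        cnt K k c v' \<and> (nxt K ^^ v') 1 Q)"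
    using assms(1) unfolding eqn_ok.simps by blast
  have 0: "mid\<^sup>*\<^sup>* ((eqn_check (b, z, i, j, k) @ r, 0), 1, D, S)
    ((if (K u \<noteq> One z) = b then ?r else drop 10 ?r, 0), 1, D, S)"
    using run_Cond[OF assms(2) u(1), of b 10 ?r D] by simp
  show ?thesis
  proof (cases "(K u \<noteq> One z) = b")
    case False
    then show ?thesis using 0 by simp
  next
    case True
    then obtain a A v Q v' where *: "cnt K j c a" "(nxt K ^^ a) 1 A" "cnt K i A v" "(nxt K ^^ v) 1 Q"
      "cnt K k c v'" "(nxt K ^^ v') 1 Q" using u(2) by blast
    have ge: "1 \<le> A" "1 \<le> Q" using relpowp_nxt_ge *(2,4) by blast+
    let ?S1 = "put PP A S" let ?S2 = "put PQ Q ?S1" let ?S3 = "put PR Q ?S2"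
    have s1: "mid\<^sup>*\<^sup>* ((eqn_check (b, z, i, j, k) @ r, 0), 1, D, S) ((?r, 0), 1, D, S)" using 0 True by simp
    have s2: "mid\<^sup>*\<^sup>* \<dots> ((Move PX j PP # drop 2 ?r, 0), 1, D, put PP 1 S)"
      using run_Place[of PP S "Move PX j PP # drop 2 ?r" D] assms by (simp add: none_def)
    have s3: "mid\<^sup>*\<^sup>* \<dots> ((drop 2 ?r, 0), 1, D, ?S1)"
      by (rule run_Move[OF *(1,2)]) (use assms in auto)
    have s4: "mid\<^sup>*\<^sup>* \<dots> ((Move PP i PQ # drop 4 ?r, 0), 1, D, put PQ 1 ?S1)"
      using run_Place[of PQ ?S1 "Move PP i PQ # drop 4 ?r" D] assms by (simp add: none_def)
    have s5: "mid\<^sup>*\<^sup>* \<dots> ((drop 4 ?r, 0), 1, D, ?S2)"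
      by (rule run_Move[OF *(3,4)]) (use assms ge none_clr in \<open>auto intro!: first_put_same\<close>)
    have s6: "mid\<^sup>*\<^sup>* \<dots> ((Move PX k PR # drop 6 ?r, 0), 1, D, put PR 1 ?S2)"
      using run_Place[of PR ?S2 "Move PX k PR # drop 6 ?r" D] assms by (simp add: none_def)
    have s7: "mid\<^sup>*\<^sup>* \<dots> ((drop 6 ?r, 0), 1, D, ?S3)"
      by (rule run_Move[OF *(5,6)]) (use assms in auto)
    have s8: "mid\<^sup>*\<^sup>* \<dots> ((drop 7 ?r, 0), 1, D, ?S3)"
    proof -
      have "first PQ Q ?S2" "first PR Q ?S3" by (rule first_put_same; use assms ge none_clr in auto)+
      then show ?thesis using run_TestEq[of PQ Q ?S3 PR "drop 7 ?r" D] by simp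
    qed
    have s9: "mid\<^sup>*\<^sup>* \<dots> ((drop 8 ?r, 0), 1, D, put PQ Q (put PR Q S))"
    proof -
      have eq: "?S3 = put PP A (put PQ Q (put PR Q S))"
        by (simp only: put_commute[of PR Q PQ] put_commute[of PR Q PP] put_commute[of PQ Q PP])
      show ?thesis unfolding eq using run_Clear[of PP A "put PQ Q (put PR Q S)" "drop 8 ?r" D] assms ge none_clr
        by simp
    qed
    have s10: "mid\<^sup>*\<^sup>* \<dots> ((drop 9 ?r, 0), 1, D, put PR Q S)"
      using run_Clear[of PQ Q "put PR Q S" "drop 9 ?r" D] assms ge none_clr by simp
    have s11: "mid\<^sup>*\<^sup>* \<dots> ((r, 0), 1, D, S)"
      using run_Clear[of PR Q S r D] assms ge none_clr by simp
    show ?thesis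
      by (rule rtranclp_trans[OF s1 rtranclp_trans[OF s2 rtranclp_trans[OF s3 rtranclp_trans[OF s4 rtranclp_trans[OF s5 rtranclp_trans[OF s6 rtranclp_trans[OF s7 rtranclp_trans[OF s8 rtranclp_trans[OF s9 rtranclp_trans[OF s10 s11]]]]]]]]]])
  qed
qed

lemma run_eqn_checks:
  assumes "\<forall>e\<in>set es. eqn_ok K c e" "first PX c S" "none PP S" "none PQ S" "none PR S" "none PG S"
  shows "mid\<^sup>*\<^sup>* ((concat (map eqn_check es) @ r, 0), 1, D, S) ((r, 0), 1, D, S)"
  using assms(1)
proof (induction es)
  case (Cons e es)
  obtain b z i j k where e: "e = (b, z, i, j, k)" by (cases e)
  have "mid\<^sup>*\<^sup>* ((eqn_check (b, z, i, j, k) @ concat (map eqn_check es) @ r, 0), 1, D, S)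
    ((concat (map eqn_check es) @ r, 0), 1, D, S)"
    by (rule run_eqn_check) (use Cons.prems assms e in auto)
  also have "mid\<^sup>*\<^sup>* \<dots> ((r, 0), 1, D, S)" using Cons by simp
  finally show ?case by (simp only: e list.map concat.simps append_assoc)
qed simp

abbreviation unmarked :: "nat \<Rightarrow> ptr set" where "unmarked \<equiv> \<lambda>_. {}"

lemma run_round:
  assumes "carry_at K D c" "succ_ok K c" "\<forall>e\<in>set Es. eqn_ok K c e"
  shows "mid\<^sup>+\<^sup>+ (init, 1, D, unmarked) (init, 1, carry K D c, unmarked)"
proof -
  let ?D = "carry K D c" let ?S = "put PX c unmarked"
  have c: "1 \<le> c" using assms(1) by (simp add: carry_at_def)
  have n: "none a unmarked" for a by (simp add: none_def)
  have f: "first PX c ?S" by (rule first_put_same[OF none_clr[OF n] c])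
  have s1: "mid\<^sup>*\<^sup>* (init, 1, D, unmarked) ((body, 0), 1, ?D, ?S)" by (rule run_Odo[OF assms(1) n])
  have s2: "mid\<^sup>*\<^sup>* \<dots> ((concat (map eqn_check Es) @ [Clear PX], 0), 1, ?D, ?S)"
    unfolding body_def by (rule run_succ_check[OF assms(2) f]) (simp_all add: n)
  have s3: "mid\<^sup>*\<^sup>* \<dots> (([Clear PX], 0), 1, ?D, ?S)"
    by (rule run_eqn_checks[OF assms(3) f]) (simp_all add: n)
  have s4: "mid\<^sup>*\<^sup>* \<dots> (([], 0), 1, ?D, unmarked)"
    by (rule run_Clear[OF none_clr[OF n] c])
  have "mid\<^sup>*\<^sup>* (init, 1, D, unmarked) (([], 0), 1, ?D, unmarked)"
      by (rule rtranclp_trans[OF s1 rtranclp_trans[OF s2 rtranclp_trans[OF s3 s4]]])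
  moreover have "mid (([], 0), 1, ?D, unmarked) (init, 1, ?D, unmarked)"
    using midI[of 1 "([], 0)" ?D unmarked "?D 1" "{}" True init] K1 by (simp add: init_def fun_upd_idem)
  ultimately show ?thesis by (rule rtranclp_into_tranclp1)
qed

text \<open>Counting from zero takes 2^n rounds until digit \<open>n\<close> alone is set, and each
  round takes at least one step; \<open>j > n\<close> is a weak form of this. The induction needs
  increments with an arbitrary carry up to \<open>c\<close>, because the second half of an increment
  at \<open>n + 1\<close> is an increment at \<open>n\<close> that carries.\<close>

lemma recurrence:
  assumes hp0: "hp 0 = 1" and nx: "\<And>n. nxt K (hp n) (hp (Suc n))"
    and sok: "\<And>n. succ_ok K (hp n)" and eok: "\<And>n e. e \<in> set Es \<Longrightarrow> eqn_ok K (hp n) e"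
  shows "\<exists>j>n. (mid ^^ j) (init, 1, \<lambda>_. False, unmarked) (init, 1, \<lambda>u. u = hp n, unmarked)"
proof -
  have mono: "strict_mono hp" by (rule strict_mono_Suc_iff[THEN iffD2]) (use nx in \<open>auto simp: nxt_def\<close>)
  have less: "hp a < hp b \<longleftrightarrow> a < b" for a b by (rule strict_mono_less[OF mono])
  have inj: "hp a = hp b \<longleftrightarrow> a = b" for a b by (rule strict_mono_eq[OF mono])
  have ge1: "1 \<le> hp n" for n using hp0 less[of 0 n] by (cases "n = 0") auto
  have K: "K (hp n) = Hdr" for n using K1 hp0 nx by (cases n) (auto simp: nxt_def)
  have between: "\<exists>n. hp n \<le> u \<and> u < hp (Suc n)" if "1 \<le> u" "u < hp N" for u N
    using that(2)
  proof (induction N)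
    case 0
    then show ?case using that(1) hp0 by simp
  next
    case (Suc N)
    then show ?case by (cases "u < hp N") (auto simp: not_less)
  qed
  have headers: "\<exists>m<c. u = hp m" if u: "K u = Hdr" "1 \<le> u" "u < hp c" for u c
  proof -
    obtain m where m: "hp m \<le> u" "u < hp (Suc m)" using between[OF u(2,3)] by blast
    have "u = hp m" using nx[of m] m u(1) unfolding nxt_def by (metis order_le_less)
    then show ?thesis using u(3) less by blast
  qed
  \<comment> \<open>If digit \<open>n\<close> is 0, two increments starting at block \<open>n\<close> make one starting at block \<open>n + 1\<close>.\<close>
  define inc where "inc n D D' \<longleftrightarrow> (\<exists>c\<ge>n. \<not> D (hp c) \<and> (\<forall>m. n \<le> m \<and> m < c \<longrightarrow> D (hp m)) \<and>
    D' = (\<lambda>u. if u = hp c then True else if \<exists>m. n \<le> m \<and> m < c \<and> u = hp m then False else D u))"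
    for n D D'
  have *: "\<exists>j>n. (mid ^^ j) (init, 1, D, unmarked) (init, 1, D', unmarked)"
    if "\<And>m. m < n \<Longrightarrow> \<not> D (hp m)" "inc n D D'" for n D D'
    using that
  proof (induction n arbitrary: D D')
    case 0
    then obtain c where c: "\<not> D (hp c)" "\<And>m. m < c \<Longrightarrow> D (hp m)"
      "D' = (\<lambda>u. if u = hp c then True else if \<exists>m. m < c \<and> u = hp m then False else D u)"
      unfolding inc_def by auto
    have "carry_at K D (hp c)"
      unfolding carry_at_def using c K ge1 no_wall headers by blast
    moreover have "carry K D (hp c) u = D' u" for u
    proof -
      have "(1 \<le> u \<and> u < hp c \<and> K u = Hdr) \<longleftrightarrow> (\<exists>m. m < c \<and> u = hp m)"
        using headers ge1 K less by blast
      then show ?thesis unfolding carry_def c(3) by simp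
    qed
    then have "carry K D (hp c) = D'" ..
    ultimately have "mid\<^sup>+\<^sup>+ (init, 1, D, unmarked) (init, 1, D', unmarked)"
      using run_round[OF _ sok] eok by metis
    then show ?case unfolding tranclp_power by blast
  next
    case (Suc n)
    obtain c where c: "c \<ge> Suc n" "\<not> D (hp c)" "\<And>m. Suc n \<le> m \<Longrightarrow> m < c \<Longrightarrow> D (hp m)"
      "D' = (\<lambda>u. if u = hp c then True else if \<exists>m. Suc n \<le> m \<and> m < c \<and> u = hp m then False else D u)"
      using Suc.prems(2) unfolding inc_def by auto
    define D1 where "D1 u \<longleftrightarrow> u = hp n \<or> D u" for u
    have D1: "inc n D D1"
      unfolding inc_def using Suc.prems(1)[of n] by (intro exI[of _ n]) (auto simp: fun_eq_iff D1_def)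
    have D2: "inc n D1 D'"
      unfolding inc_def
    proof (intro exI[of _ c] conjI allI impI)
      show "D' = (\<lambda>u. if u = hp c then True else if \<exists>m. n \<le> m \<and> m < c \<and> u = hp m then False else D1 u)"
      proof
        fix u
        show "D' u = (if u = hp c then True else if \<exists>m. n \<le> m \<and> m < c \<and> u = hp m then False else D1 u)"
        proof (cases "u = hp n")
          case True
          then show ?thesis using c(1,4) Suc.prems(1)[of n] inj by (auto simp: D1_def)
        next
          case False
          then have "(\<exists>m. n \<le> m \<and> m < c \<and> u = hp m) \<longleftrightarrow> (\<exists>m. Suc n \<le> m \<and> m < c \<and> u = hp m)"
            by (metis Suc_leD Suc_leI le_neq_implies_less)
          then show ?thesis unfolding c(4) D1_def using False by (simp only: simp_thms)
        qed
      qed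
    next
      fix m assume "n \<le> m \<and> m < c"
      then show "D1 (hp m)" using c(3)[of m] by (cases "m = n") (auto simp: D1_def)
    qed (use c(1,2) inj in \<open>auto simp: D1_def\<close>)
    obtain j1 where j1: "j1 > n" "(mid ^^ j1) (init, 1, D, unmarked) (init, 1, D1, unmarked)"
      using Suc.IH[OF _ D1] Suc.prems(1) by auto
    have nD1: "\<not> D1 (hp m)" if "m < n" for m using that Suc.prems(1)[of m] inj by (simp add: D1_def)
    obtain j2 where j2: "j2 > n" "(mid ^^ j2) (init, 1, D1, unmarked) (init, 1, D', unmarked)"
      using Suc.IH[OF nD1 D2] by blast
    have "(mid ^^ (j1 + j2)) (init, 1, D, unmarked) (init, 1, D', unmarked)"
      unfolding relpowp_add using j1(2) j2(2) by blast
    then show ?case using j1(1) j2(1) by (intro exI[of _ "j1 + j2"]) auto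
  qed
  show ?thesis
    by (rule *) (auto simp: inc_def intro!: exI[of _ n])
qed

text \<open>Only functions with index below \<open>r\<close> are written on the tape;
  \<open>below r\<close> says that the equations mention no others, and \<open>1 < r\<close> that
  the successor is among them.\<close>

theorem solution_recurrence:
  assumes hp0: "hp 0 = 1" and nx: "\<And>n. nxt K (hp n) (hp (Suc n))"
    and c: "\<And>i n. i < r \<Longrightarrow> cnt K i (hp n) (f i n)" and f: "f 1 = Suc" "holds f (set Es)"
    and r: "1 < r" "below r (set Es)"
  shows "\<exists>j>n. (mid ^^ j) (init, 1, \<lambda>_. False, unmarked) (init, 1, \<lambda>u. u = hp n, unmarked)"
proof (rule recurrence[OF hp0 nx])
  have pow: "(nxt K ^^ n) 1 (hp n)" for n
    by (induction n) (use hp0 nx in auto)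
  fix n
  show "succ_ok K (hp n)"
    unfolding succ_ok_def using c[OF r(1), of n] pow[of "Suc n"] nx f(1) by metis
  fix e assume e: "e \<in> set Es"
  obtain b z i j k where ee: "e = (b, z, i, j, k)" by (cases e)
  have lt: "z < r" "i < r" "j < r" "k < r" using r(2) e ee unfolding below_def by fastforce+
  obtain u where u: "stop K z (hp n) u" using c[OF lt(1), of n] by (auto elim: cnt.cases)
  have "\<exists>a A v Q v'. cnt K j (hp n) a \<and> (nxt K ^^ a) 1 A \<and> cnt K i A v \<and> (nxt K ^^ v) 1 Q \<and>
        cnt K k (hp n) v' \<and> (nxt K ^^ v') 1 Q" if "(K u \<noteq> One z) = b"
  proof -
    have "(f z n = 0) = b" using cnt_zero_iff[OF c[OF lt(1)] u] that by simp
    then have "f i (f j n) = f k n" using holdsD[OF f(2)] e ee by blast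
    then show ?thesis using c[OF lt(3), of n] c[OF lt(2), of "f j n"] c[OF lt(4), of n] pow by metis
  qed
  then show "eqn_ok K (hp n) e" unfolding ee eqn_ok.simps using u by blast
qed

end

subsection \<open>The tape of a solution\<close>

definition block :: "(nat \<Rightarrow> nat \<Rightarrow> nat) \<Rightarrow> nat \<Rightarrow> nat \<Rightarrow> kd list" where
  "block f r n = Hdr # concat (map (\<lambda>i. replicate (f i n) (One i)) [0..<r])"

fun block_start :: "(nat \<Rightarrow> nat \<Rightarrow> nat) \<Rightarrow> nat \<Rightarrow> nat \<Rightarrow> nat" where
  "block_start f r 0 = 1"
| "block_start f r (Suc n) = block_start f r n + length (block f r n)"

definition tape :: "(nat \<Rightarrow> nat \<Rightarrow> nat) \<Rightarrow> nat \<Rightarrow> nat \<Rightarrow> kd" where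
  "tape f r u = (if u = 0 then Wall else
     (let n = LEAST n. u < block_start f r (Suc n) in block f r n ! (u - block_start f r n)))"

lemma block_start_mono: "m \<le> n \<Longrightarrow> block_start f r m \<le> block_start f r n"
  by (rule lift_Suc_mono_le[of "block_start f r"]) auto

lemma tape_block:
  assumes "t < length (block f r n)"
  shows "tape f r (block_start f r n + t) = block f r n ! t"
proof -
  let ?b = "block_start f r"
  have "(LEAST m. ?b n + t < ?b (Suc m)) = n"
  proof (rule Least_equality)
    show "?b n + t < ?b (Suc n)" using assms by simp
    fix m assume m: "?b n + t < ?b (Suc m)"
    show "n \<le> m"
    proof (rule ccontr)
      assume "\<not> n \<le> m"
      then have "?b (Suc m) \<le> ?b n" by (intro block_start_mono) simp
      then show False using m by simp
    qed
  qed
  moreover have "?b n \<noteq> 0" using block_start_mono[of 0 n f r] by simp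
  ultimately show ?thesis by (simp add: tape_def Let_def)
qed

lemma tape_cases:
  assumes "1 \<le> u"
  obtains n t where "t < length (block f r n)" "u = block_start f r n + t"
proof -
  let ?b = "block_start f r"
  have "n < ?b (Suc n)" for n
  proof (induction n)
    case (Suc n)
    then show ?case by (simp add: block_def)
  qed simp
  then have ex: "\<exists>n. u < ?b (Suc n)" by blast
  define n where "n = (LEAST n. u < ?b (Suc n))"
  have n: "u < ?b (Suc n)" unfolding n_def by (rule LeastI_ex[OF ex])
  have "?b n \<le> u"
  proof (cases n)
    case (Suc m)
    then have "\<not> u < ?b (Suc m)" using not_less_Least[of m "\<lambda>n. u < ?b (Suc n)"] n_def by simp
    then show ?thesis using Suc by simp
  qed (use assms in simp)
  then show ?thesis using that[of "u - ?b n" n] n by simp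
qed

lemma block_nth: "0 < t \<Longrightarrow> t < length (block f r n) \<Longrightarrow> \<exists>i. block f r n ! t = One i"
proof -
  assume "0 < t" "t < length (block f r n)"
  then have "block f r n ! t \<in> set (concat (map (\<lambda>i. replicate (f i n) (One i)) [0..<r]))"
    by (cases t) (auto simp: block_def simp del: set_concat)
  then show ?thesis by auto
qed

lemma tape_0: "tape f r 0 = Wall"
  by (simp add: tape_def)

lemma tape_start: "tape f r (block_start f r n) = Hdr"
  using tape_block[of 0 f r n] by (simp add: block_def)

lemma tape_1: "tape f r 1 = Hdr"
  using tape_start[of f r 0] by simp

lemma tape_not_Wall: "1 \<le> u \<Longrightarrow> tape f r u \<noteq> Wall"
proof -
  assume "1 \<le> u"
  then obtain n t where t: "t < length (block f r n)" "u = block_start f r n + t" by (rule tape_cases)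
  show ?thesis
  proof (cases "t = 0")
    case True
    then show ?thesis using tape_start t(2) by simp
  next
    case False
    then show ?thesis using block_nth[OF _ t(1)] tape_block[OF t(1)] t(2) by auto
  qed
qed

lemma nxt_tape: "nxt (tape f r) (block_start f r n) (block_start f r (Suc n))"
  unfolding nxt_def
proof (intro conjI allI impI)
  show "tape f r (block_start f r (Suc n)) = Hdr" by (rule tape_start)
  fix u assume u: "block_start f r n < u \<and> u < block_start f r (Suc n)"
  define t where "t = u - block_start f r n"
  have t: "0 < t" "t < length (block f r n)" "u = block_start f r n + t" using u by (auto simp: t_def)
  then obtain i where "tape f r u = One i" using block_nth[OF t(1,2)] tape_block[OF t(2)] by auto
  then show "tape f r u \<noteq> Wall" "tape f r u \<noteq> Hdr" by simp_all
qed (simp add: block_def)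

text \<open>The offset \<open>a\<close> covers letters of smaller index, which only the first search
  meets. After a hit the search starts inside the run of \<open>One i\<close>, hence offset 0 in the
  induction step.\<close>

lemma cnt_run:
  assumes "\<And>t. t < a \<Longrightarrow> \<exists>j<i. K (Suc g + t) = One j" "\<And>t. t < v \<Longrightarrow> K (Suc g + a + t) = One i"
    and "reach i (K (Suc g + a + v))" "K (Suc g + a + v) \<noteq> One i"
  shows "cnt K i g v"
  using assms
proof (induction v arbitrary: g a)
  case 0
  have "stop K i g (Suc g + a)" unfolding stop_def
  proof (intro conjI allI impI)
    fix v assume "g < v \<and> v < Suc g + a"
    then have "v = Suc g + (v - Suc g)" "v - Suc g < a" by auto
    then obtain j where "j < i" "K v = One j" using 0(1) by metis
    then show "K v \<noteq> Wall" "\<not> reach i (K v)" by auto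
  qed (use 0 in auto)
  then show ?case using cnt_0 0 by (metis add_0_right)
next
  case (Suc v)
  let ?u = "Suc g + a"
  have u: "K ?u = One i" using Suc.prems(2)[of 0] by simp
  have "stop K i g ?u" unfolding stop_def
  proof (intro conjI allI impI)
    fix v assume "g < v \<and> v < ?u"
    then have "v = Suc g + (v - Suc g)" "v - Suc g < a" by auto
    then obtain j where "j < i" "K v = One j" using Suc.prems(1) by metis
    then show "K v \<noteq> Wall" "\<not> reach i (K v)" by auto
  qed (use u in auto)
  moreover have "cnt K i ?u v"
  proof (rule Suc.IH[of 0])
    fix t assume "t < v"
    then show "K (Suc ?u + 0 + t) = One i" using Suc.prems(2)[of "Suc t"] by simp
  qed (use Suc.prems(3,4) in auto)
  ultimately show ?case using cnt_Suc u by blast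
qed

lemma cnt_tape:
  assumes "i < r"
  shows "cnt (tape f r) i (block_start f r n) (f i n)"
proof -
  let ?R = "\<lambda>i. replicate (f i n) (One i)" let ?b = "block_start f r n"
  define xs where "xs = concat (map ?R [0..<i])"
  define ys where "ys = concat (map ?R [Suc i..<r])"
  have "[0..<r] = [0..<i] @ i # [Suc i..<r]"
    using assms upt_add_eq_append[of 0 i "r - i"] upt_conv_Cons[of i r] by simp
  then have bl: "block f r n = Hdr # xs @ ?R i @ ys" by (simp add: block_def xs_def ys_def)
  have tb: "tape f r (Suc ?b + t) = (xs @ ?R i @ ys) ! t" if "t < length (xs @ ?R i @ ys)" for t
    using tape_block[of "Suc t" f r n] that by (simp add: bl)
  show ?thesis
  proof (rule cnt_run[of "length xs"])
    fix t assume t: "t < length xs"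
    then have "tape f r (Suc ?b + t) = xs ! t" using tb[of t] by (simp add: nth_append)
    moreover have "xs ! t \<in> set xs" using t by simp
    ultimately show "\<exists>j<i. tape f r (Suc ?b + t) = One j" by (auto simp: xs_def)
  next
    fix t assume "t < f i n"
    then show "tape f r (Suc ?b + length xs + t) = One i" using tb[of "length xs + t"]
      by (simp add: nth_append add.assoc)
  next
    let ?v = "Suc ?b + length xs + f i n"
    have "tape f r ?v = Hdr \<or> (\<exists>j>i. tape f r ?v = One j)"
    proof (cases ys)
      case Nil
      then have "?v = block_start f r (Suc n)" by (simp add: bl)
      then show ?thesis using tape_start by metis
    next
      case (Cons y ys')
      then have "tape f r ?v = y" using tb[of "length xs + f i n"] by (simp add: nth_append add.assoc)
      moreover have "y \<in> set ys" using Cons by simp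
      ultimately show ?thesis by (auto simp: ys_def)
    qed
    then show "reach i (tape f r ?v)" "tape f r ?v \<noteq> One i" by auto
  qed
qed

section \<open>Cellular automata of radius one\<close>

definition ca :: "(nat \<Rightarrow> nat \<Rightarrow> nat \<Rightarrow> nat) \<Rightarrow> (int \<Rightarrow> nat) \<Rightarrow> int \<Rightarrow> nat" where
  "ca R x = (\<lambda>i. R (x (i - 1)) (x i) (x (i + 1)))"

lemma ca_apply: "ca R x i = R (x (i - 1)) (x i) (x (i + 1))"
  by (simp add: ca_def)

lemma open_cylinder1: "open {x :: int \<Rightarrow> nat. x i = a}"
proof -
  have "open ((\<lambda>x :: int \<Rightarrow> nat. x i) -` {a})"
    by (rule open_vimage) (auto intro: continuous_on_product_coordinates open_discrete)
  then show ?thesis by (simp add: vimage_def)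
qed

lemma continuous_on_ca: "continuous_on S (ca R)"
proof (rule continuous_on_coordinatewise_then_product)
  fix i
  have "continuous_on UNIV (\<lambda>x. ca R x i)"
  proof (rule continuous_on_open_vimage[OF open_UNIV, THEN iffD2], intro allI impI)
    fix B :: "nat set"
    have "(\<lambda>x. ca R x i) -` B \<inter> UNIV =
      (\<Union>(a, b, c)\<in>{(a, b, c). R a b c \<in> B}. {x. x (i - 1) = a} \<inter> {x. x i = b} \<inter> {x. x (i + 1) = c})"
      by (auto simp: ca_def)
    moreover have "open \<dots>" by (auto intro!: open_UN open_Int open_cylinder1)
    ultimately show "open ((\<lambda>x. ca R x i) -` B \<inter> UNIV)" by simp
  qed
  then show "continuous_on S (\<lambda>x. ca R x i)" by (rule continuous_on_subset) simp
qed

lemma ca_full_shift: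
  assumes "\<And>a b c. a < k \<Longrightarrow> b < k \<Longrightarrow> c < k \<Longrightarrow> R a b c < k" "x \<in> full_shift k"
  shows "ca R x \<in> full_shift k"
  using assms by (simp add: ca_def full_shift_def)

lemma cellular_automaton_ca:
  assumes "\<And>a b c. a < k \<Longrightarrow> b < k \<Longrightarrow> c < k \<Longrightarrow> R a b c < k"
  shows "cellular_automaton k (ca R)"
  unfolding cellular_automaton_def
proof (intro conjI ballI)
  show "ca R ` full_shift k \<subseteq> full_shift k" using ca_full_shift[of k R, OF assms] by blast
  show "continuous_on (full_shift k) (ca R)" by (rule continuous_on_ca)
  fix x show "ca R (shift_map x) = shift_map (ca R x)"
    by (simp add: ca_def shift_map_def fun_eq_iff algebra_simps)
qed

text \<open>Finite windows give a neighbourhood basis: a basic open set of the product restricts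
  only finitely many coordinates, and single values are open in the discrete alphabet.\<close>

lemma closure_cylinders:
  fixes x :: "int \<Rightarrow> nat"
  shows "x \<in> closure A \<longleftrightarrow> (\<forall>m::nat. \<exists>y\<in>A. \<forall>i. \<bar>i\<bar> \<le> int m \<longrightarrow> y i = x i)"
proof
  assume x: "x \<in> closure A"
  show "\<forall>m::nat. \<exists>y\<in>A. \<forall>i. \<bar>i\<bar> \<le> int m \<longrightarrow> y i = x i"
  proof
    fix m :: nat
    let ?T = "\<Inter>i\<in>{- int m..int m}. {y. y i = x i}"
    have "open ?T" by (intro open_INT ballI open_cylinder1) simp
    moreover have "x \<in> ?T" by simp
    ultimately have "A \<inter> ?T \<noteq> {}" using x by (meson IntI closure_iff_nhds_not_empty empty_iff subset_refl)
    then obtain y where "y \<in> A" "y \<in> ?T" by blast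
    have "y i = x i" if "\<bar>i\<bar> \<le> int m" for i
    proof -
      have "i \<in> {- int m..int m}" using that by auto
      then show ?thesis using \<open>y \<in> ?T\<close> by blast
    qed
    then show "\<exists>y\<in>A. \<forall>i. \<bar>i\<bar> \<le> int m \<longrightarrow> y i = x i" using \<open>y \<in> A\<close> by blast
  qed
next
  assume c: "\<forall>m::nat. \<exists>y\<in>A. \<forall>i. \<bar>i\<bar> \<le> int m \<longrightarrow> y i = x i"
  show "x \<in> closure A"
    unfolding closure_iff_nhds_not_empty
  proof (intro allI impI)
    fix S U assume U: "U \<subseteq> S" "open U" "x \<in> U"
    obtain X where X: "x \<in> Pi\<^sub>E UNIV X" "finite {i. X i \<noteq> (UNIV :: nat set)}" "Pi\<^sub>E UNIV X \<subseteq> U"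
      using product_topology_open_contains_basis[of "\<lambda>_. euclidean" UNIV U x] U(2,3)
      by (auto simp: open_fun_def)
    obtain m where m: "\<And>i. X i \<noteq> UNIV \<Longrightarrow> \<bar>i\<bar> \<le> int m"
    proof -
      have "finite ((\<lambda>i. nat \<bar>i\<bar>) ` {i. X i \<noteq> UNIV})" using X(2) by simp
      then obtain m where "\<forall>n\<in>(\<lambda>i. nat \<bar>i\<bar>) ` {i. X i \<noteq> UNIV}. n \<le> m"
        using finite_nat_set_iff_bounded_le by blast
      then show ?thesis using that[of m] by force
    qed
    obtain y where y: "y \<in> A" "\<And>i. \<bar>i\<bar> \<le> int m \<Longrightarrow> y i = x i" using c by blast
    have "y i \<in> X i" for i using y(2)[of i] m[of i] X(1) by (cases "X i = UNIV") (auto simp: PiE_def Pi_def)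
    then have "y \<in> U" using X(3) by (auto simp: PiE_def Pi_def extensional_def)
    then show "A \<inter> S \<noteq> {}" using y(1) U(1) by blast
  qed
qed

text \<open>One bound \<open>m\<close> serves for window and time, as both conditions get weaker
  when \<open>m\<close> shrinks. A single function of return times is then enough to witness
  recurrence.\<close>

lemma nonwandering_iff:
  "x \<in> nonwandering f X \<longleftrightarrow> x \<in> X \<and> (\<forall>m. \<exists>j\<ge>m. \<forall>i. \<bar>i\<bar> \<le> int m \<longrightarrow> (f ^^ j) x i = x i)"
proof -
  have "(\<forall>n. x \<in> closure {(f ^^ j) x | j. j \<ge> n}) \<longleftrightarrow>
    (\<forall>n m. \<exists>j\<ge>n. \<forall>i. \<bar>i\<bar> \<le> int m \<longrightarrow> (f ^^ j) x i = x i)"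
    unfolding closure_cylinders by blast
  also have "\<dots> \<longleftrightarrow> (\<forall>m. \<exists>j\<ge>m. \<forall>i. \<bar>i\<bar> \<le> int m \<longrightarrow> (f ^^ j) x i = x i)"
  proof (intro iffI allI)
    fix n m assume a: "\<forall>m. \<exists>j\<ge>m. \<forall>i. \<bar>i\<bar> \<le> int m \<longrightarrow> (f ^^ j) x i = x i"
    then obtain j where "j \<ge> max n m" "\<forall>i. \<bar>i\<bar> \<le> int (max n m) \<longrightarrow> (f ^^ j) x i = x i" by blast
    then show "\<exists>j\<ge>n. \<forall>i. \<bar>i\<bar> \<le> int m \<longrightarrow> (f ^^ j) x i = x i" by (intro exI[of _ j]) auto
  qed blast
  finally show ?thesis unfolding nonwandering_def by blast
qed

section \<open>The upper bound: recurrence in a cellular automaton is a Sigma-1-1 condition\<close>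

lemma orec_finite_rule:
  fixes R :: "nat \<Rightarrow> nat \<Rightarrow> nat \<Rightarrow> nat"
  assumes "orec A" "orec B" "orec D"
  shows "orec (\<lambda>C xs. if A C xs < k \<and> B C xs < k \<and> D C xs < k
    then R (A C xs) (B C xs) (D C xs) else 0)"
proof -
  define G where "G n = (if pfst n < k \<and> pfst (psnd n) < k \<and> psnd (psnd n) < k
    then R (pfst n) (pfst (psnd n)) (psnd (psnd n)) else 0)" for n
  let ?F = "(\<lambda>(a, b, c). prod_encode (a, prod_encode (b, c))) ` ({..<k} \<times> {..<k} \<times> {..<k})"
  have "finite ?F" by simp
  then obtain N where N: "\<forall>n\<in>?F. n < N" using finite_nat_set_iff_bounded by blast
  have "G n = 0" if "n \<ge> N" for n
  proof -
    have "n \<notin> ?F" using N that by (meson not_less)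
    moreover have "n \<in> ?F" if "pfst n < k" "pfst (psnd n) < k" "psnd (psnd n) < k"
      using that by (intro image_eqI[of _ _ "(pfst n, pfst (psnd n), psnd (psnd n))"]) auto
    ultimately show ?thesis by (auto simp: G_def)
  qed
  from orec_finite_table[of "\<lambda>C xs. prod_encode (A C xs, prod_encode (B C xs, D C xs))" N G, OF _ this]
  have "orec (\<lambda>C xs. G (prod_encode (A C xs, prod_encode (B C xs, D C xs))))"
    using assms by (simp add: orec_prod_encode)
  then show ?thesis unfolding G_def pfst_prod_encode psnd_prod_encode .
qed

lemma word_code_inj:
  "\<forall>a\<in>set u. a < k \<Longrightarrow> \<forall>a\<in>set v. a < k \<Longrightarrow> word_code k u = word_code k v \<Longrightarrow> u = v"
proof (induction u arbitrary: v)
  case Nil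
  then show ?case by (cases v) auto
next
  case (Cons a u)
  then obtain b v' where v: "v = b # v'" by (cases v) auto
  have eq: "a + k * word_code k u = b + k * word_code k v'" using Cons.prems(3) v by simp
  have ab: "a < k" "b < k" using Cons.prems v by auto
  have "a = (a + k * word_code k u) mod k" using ab by simp
  also have "\<dots> = b" unfolding eq using ab by simp
  finally have "a = b" .
  moreover from this have "word_code k u = word_code k v'" using eq ab by simp
  ultimately show ?case using Cons.IH[of v'] Cons.prems(1,2) v by simp
qed

text \<open>Invariance along diagonals lets a pair of naturals address the integer
  \<open>p - q\<close>. The neighbours of a cell are then \<open>(p, Suc q)\<close> and
  \<open>(Suc p, q)\<close>, without case distinctions on signs.\<close>

lemma diagonal_invariant:
  assumes "\<And>p q. F (Suc p) (Suc q) = F p q"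
  shows "F p q = F (nat (int p - int q)) (nat (int q - int p))"
proof (induction q arbitrary: p)
  case (Suc q)
  show ?case
  proof (cases p)
    case (Suc p')
    then show ?thesis using assms Suc.IH[of p'] by simp
  qed (simp add: nat_add_distrib)
qed simp

theorem Sigma11_language_ca:
  assumes k: "0 < k" and R: "\<And>a b c. a < k \<Longrightarrow> b < k \<Longrightarrow> c < k \<Longrightarrow> R a b c < k"
  shows "Sigma11 (language k (nonwandering (ca R) (full_shift k)))"
proof -
  \<comment> \<open>The function guessed codes a space-time diagram (tag 0, where cell \<open>p - q\<close> at time \<open>t\<close> has the
    address \<open>(t, p, q)\<close>), return times (tag 1), and the codes of the suffixes of the word (tag 2).\<close>
  define t where "t m = pfst m" for m
  define p where "p m = pfst (psnd m)" for m
  define q where "q m = pfst (psnd (psnd m))" for m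
  define a where "a m = pfst (psnd (psnd (psnd m)))" for m
  define b where "b m = pfst (psnd (psnd (psnd (psnd m))))" for m
  define c where "c m = pfst (psnd (psnd (psnd (psnd (psnd m)))))" for m
  define d where "d m = psnd (psnd (psnd (psnd (psnd (psnd m)))))" for m
  note defs = t_def p_def q_def a_def b_def c_def d_def
  define Y where "Y t p q = prod_encode (0, prod_encode (t, prod_encode (p, q)))" for t p q
  define T where "T m = prod_encode (1, m)" for m :: nat
  define V where "V j = prod_encode (2, j)" for j :: nat
  \<comment> \<open>The rule is unconstrained outside the alphabet; cutting it off there makes it a
    finite table and hence recursive.\<close>
  define R' where "R' a b c = (if a < k \<and> b < k \<and> c < k then R a b c else 0)" for a b c
  define Q where "Q C xs \<longleftrightarrow> (let m = arg xs 0; w = arg xs 1 in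
    (prod_encode (Y (t m) (p m) (q m), a m) \<in> C \<longrightarrow> a m < k) \<and>
    (prod_encode (Y (t m) (p m) (q m), a m) \<in> C \<longrightarrow>
      prod_encode (Y (t m) (Suc (p m)) (Suc (q m)), a m) \<in> C) \<and>
    (prod_encode (Y (t m) (p m) (Suc (q m)), a m) \<in> C \<and> prod_encode (Y (t m) (p m) (q m), b m) \<in> C \<and>
      prod_encode (Y (t m) (Suc (p m)) (q m), c m) \<in> C \<longrightarrow>
      prod_encode (Y (Suc (t m)) (p m) (q m), R' (a m) (b m) (c m)) \<in> C) \<and>
    (prod_encode (T (t m), d m) \<in> C \<longrightarrow> t m \<le> d m) \<and>
    (prod_encode (T (t m), d m) \<in> C \<and> p m \<le> t m \<and> q m \<le> t m \<and>
      prod_encode (Y 0 (p m) (q m), a m) \<in> C \<longrightarrow> prod_encode (Y (d m) (p m) (q m), a m) \<in> C) \<and>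
    prod_encode (V 0, w) \<in> C \<and>
    (prod_encode (V (t m), a m) \<in> C \<and> prod_encode (V (Suc (t m)), b m) \<in> C \<and>
      prod_encode (Y 0 (t m) 0, c m) \<in> C \<longrightarrow> a m = 0 \<or> a m = Suc (c m) + k * b m))" for C xs
  have "orecP Q"
    unfolding Q_def[abs_def] Let_def Y_def T_def V_def R'_def defs
    by (intro orec_intros orec_finite_rule)
  then show ?thesis
  proof (rule Sigma11I)
    fix w
    let ?N = "nonwandering (ca R) (full_shift k)"
    show "w \<in> language k ?N \<longleftrightarrow> (\<exists>g. \<forall>m. Q (graph g) [m, w])"
    proof
      assume "w \<in> language k ?N"
      then obtain y n where y: "y \<in> ?N" and w: "w = word_code k (map (\<lambda>i. y (int i)) [0..<n])"
        unfolding language_def by blast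
      let ?y = "\<lambda>t. (ca R ^^ t) y" let ?w = "map (\<lambda>i. y (int i)) [0..<n]"
      have fs: "?y t \<in> full_shift k" for t
        by (induction t) (use y in \<open>auto simp: nonwandering_iff intro: ca_full_shift[of k R, OF R]\<close>)
      then have lt: "?y t i < k" for t i by (simp add: full_shift_def)
      have "\<forall>m. \<exists>j\<ge>m. \<forall>i. \<bar>i\<bar> \<le> int m \<longrightarrow> ?y j i = y i" using y by (simp add: nonwandering_iff)
      then obtain \<tau> where \<tau>: "\<And>m. \<tau> m \<ge> m" "\<And>m i. \<bar>i\<bar> \<le> int m \<Longrightarrow> ?y (\<tau> m) i = y i" by metis
      \<comment> \<open>Beyond the end of the word the suffix is empty and has code 0, the first
        alternative in the condition on tag 2.\<close>
      define W where "W j = word_code k (drop j ?w)" for j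
      have W: "W j = 0 \<or> W j = Suc (y (int j)) + k * W (Suc j)" for j
      proof (cases "j < n")
        case True
        then have "drop j ?w = y (int j) # drop (Suc j) ?w" by (simp add: Cons_nth_drop_Suc[symmetric])
        then show ?thesis by (simp add: W_def)
      qed (simp add: W_def)
      define g where "g x = (if pfst x = 0 then ?y (pfst (psnd x)) (int (pfst (psnd (psnd x))) - int (psnd (psnd (psnd x))))
        else if pfst x = 1 then \<tau> (psnd x) else W (psnd x))" for x
      have gY: "g (Y t p q) = ?y t (int p - int q)" and gT: "g (T m) = \<tau> m" and gV: "g (V m) = W m" for t p q m
        by (simp_all add: g_def Y_def T_def V_def)
      have "Q (graph g) [m, w]" for m
        unfolding Q_def Let_def prod_encode_in_graph gY gT gV arg_simps One_nat_def
      proof (intro conjI impI; (elim conjE)?)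
        assume "a m = ?y (t m) (int (p m) - int (Suc (q m)))" "b m = ?y (t m) (int (p m) - int (q m))"
          "c m = ?y (t m) (int (Suc (p m)) - int (q m))"
        then show "R' (a m) (b m) (c m) = ?y (Suc (t m)) (int (p m) - int (q m))"
          using lt by (simp add: R'_def ca_apply algebra_simps)
      next
        assume "d m = \<tau> (t m)" "p m \<le> t m" "q m \<le> t m" "a m = ?y 0 (int (p m) - int (q m))"
        then show "a m = ?y (d m) (int (p m) - int (q m))" using \<tau>(2) by simp
      next
        show "w = W 0" by (simp add: W_def w)
      next
        assume "a m = W (t m)" "b m = W (Suc (t m))" "c m = ?y 0 (int (t m) - int 0)"
        then show "a m = 0 \<or> a m = Suc (c m) + k * b m" using W[of "t m"] by simp
      qed (use lt \<tau>(1) in auto)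
      then show "\<exists>g. \<forall>m. Q (graph g) [m, w]" by blast
    next
      assume "\<exists>g. \<forall>m. Q (graph g) [m, w]"
      then obtain g where g: "\<And>m. Q (graph g) [m, w]" by blast
      have Qc: "(t m = t' \<and> p m = p' \<and> q m = q' \<and> a m = a' \<and> b m = b' \<and> c m = c' \<and> d m = d')"
        if "m = prod_encode (t', prod_encode (p', prod_encode (q', prod_encode (a', prod_encode (b', prod_encode (c', d'))))))"
        for m t' p' q' a' b' c' d'
        using that by (simp add: defs)
      have Qg: "(a' = g (Y t' p' q') \<longrightarrow> a' < k) \<and>
        (a' = g (Y t' p' q') \<longrightarrow> a' = g (Y t' (Suc p') (Suc q'))) \<and>
        (a' = g (Y t' p' (Suc q')) \<and> b' = g (Y t' p' q') \<and> c' = g (Y t' (Suc p') q') \<longrightarrow>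
          R' a' b' c' = g (Y (Suc t') p' q')) \<and>
        (d' = g (T t') \<longrightarrow> t' \<le> d') \<and>
        (d' = g (T t') \<and> p' \<le> t' \<and> q' \<le> t' \<and> a' = g (Y 0 p' q') \<longrightarrow> a' = g (Y d' p' q')) \<and>
        w = g (V 0) \<and>
        (a' = g (V t') \<and> b' = g (V (Suc t')) \<and> c' = g (Y 0 t' 0) \<longrightarrow> a' = 0 \<or> a' = Suc c' + k * b')"
        for t' p' q' a' b' c' d'
      proof -
        define m where "m = prod_encode (t', prod_encode (p', prod_encode (q', prod_encode (a', prod_encode (b', prod_encode (c', d'))))))"
        have m: "t m = t'" "p m = p'" "q m = q'" "a m = a'" "b m = b'" "c m = c'" "d m = d'"
          using Qc[OF m_def] by auto
        show ?thesis using g[of m] unfolding Q_def Let_def prod_encode_in_graph arg_simps One_nat_def m .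
      qed
      define y where "y i = g (Y 0 (nat i) (nat (- i)))" for i
      have lt: "g (Y t p q) < k" for t p q using Qg[of "g (Y t p q)" t p q] by blast
      have diag: "g (Y t (Suc p) (Suc q)) = g (Y t p q)" for t p q using Qg[of "g (Y t p q)" t p q] by simp
      have gY: "g (Y t p q) = (ca R ^^ t) y (int p - int q)" for t p q
      proof (induction t arbitrary: p q)
        case 0
        show ?case using diagonal_invariant[of "\<lambda>p q. g (Y 0 p q)" p q, OF diag]
          by (simp add: y_def)
      next
        case (Suc t)
        have "g (Y (Suc t) p q) = R' (g (Y t p (Suc q))) (g (Y t p q)) (g (Y t (Suc p) q))"
          using Qg[of "g (Y t p (Suc q))" t p q "g (Y t p q)" "g (Y t (Suc p) q)"] by simp
        also have "\<dots> = R (g (Y t p (Suc q))) (g (Y t p q)) (g (Y t (Suc p) q))"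
          using lt by (simp add: R'_def)
        also have "\<dots> = ca R ((ca R ^^ t) y) (int p - int q)"
        proof -
          have "int p - int (Suc q) = int p - int q - 1" "int (Suc p) - int q = int p - int q + 1" by simp_all
          then show ?thesis unfolding Suc.IH ca_apply by (simp only:)
        qed
        finally show ?case by simp
      qed
      have yfs: "y \<in> full_shift k" using lt by (simp add: full_shift_def y_def)
      have "\<exists>j\<ge>m. \<forall>i. \<bar>i\<bar> \<le> int m \<longrightarrow> (ca R ^^ j) y i = y i" for m
      proof (intro exI[of _ "g (T m)"] conjI allI impI)
        show "m \<le> g (T m)" using Qg[of 0 m 0 0 0 0 "g (T m)"] by simp
        fix i assume i: "\<bar>i\<bar> \<le> int m"
        have e: "int (nat i) - int (nat (- i)) = i" by (cases "0 \<le> i") auto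
        have gi: "g (Y t (nat i) (nat (- i))) = (ca R ^^ t) y i" for t
          using gY[of t "nat i" "nat (- i)"] unfolding e .
        have "nat i \<le> m" "nat (- i) \<le> m" using i by auto
        then have "g (Y 0 (nat i) (nat (- i))) = g (Y (g (T m)) (nat i) (nat (- i)))"
          using Qg[of "g (Y 0 (nat i) (nat (- i)))" m "nat i" "nat (- i)" 0 0 "g (T m)"] by blast
        then show "(ca R ^^ g (T m)) y i = y i" unfolding gi by simp
      qed
      then have yN: "y \<in> ?N" using yfs by (simp add: nonwandering_iff)
      have V: "g (V j) = 0 \<or> g (V j) = Suc (y (int j)) + k * g (V (Suc j))" for j
        using Qg[of "g (V j)" j 0 0 "g (V (Suc j))" "g (Y 0 j 0)" 0] gY[of 0 j 0] by simp
      have "\<exists>n. g (V j) = word_code k (map (\<lambda>i. y (int i)) [j..<n])" for j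
      \<comment> \<open>The length of the word is not guessed. A nonzero code exceeds that of the
        next suffix because \<open>k\<close> is positive, so the codes descend to 0, and this
        determines an end \<open>n\<close>.\<close>
      proof (induction "g (V j)" arbitrary: j rule: less_induct)
        case less
        show ?case
        proof (cases "g (V j) = 0")
          case True
          then show ?thesis by (intro exI[of _ j]) simp
        next
          case False
          then have v: "g (V j) = Suc (y (int j)) + k * g (V (Suc j))" using V[of j] by simp
          have "g (V (Suc j)) \<le> k * g (V (Suc j))" using k by simp
          then have "g (V (Suc j)) < g (V j)" using v by linarith
          then obtain n where n: "g (V (Suc j)) = word_code k (map (\<lambda>i. y (int i)) [Suc j..<n])"
            using less by blast
          show ?thesis
          proof (cases "j < n")
            case True
            then have "[j..<n] = j # [Suc j..<n]" by (rule upt_conv_Cons)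
            then show ?thesis using v n by (intro exI[of _ n]) simp
          next
            case False
            then show ?thesis using v n by (intro exI[of _ "Suc j"]) simp
          qed
        qed
      qed
      then obtain n where "g (V 0) = word_code k (map (\<lambda>i. y (int i)) [0..<n])" by blast
      moreover have "w = g (V 0)" using Qg by blast
      ultimately show "w \<in> language k ?N" unfolding language_def using yN by blast
    qed
  qed
qed

section \<open>The machine as a cellular automaton\<close>

datatype head = Run lbl | Home lbl

text \<open>A cell without head records on which side of it the head is: \<open>Lt\<close> left, \<open>Rt\<close> right.
  A head moves right only onto an \<open>Lt\<close> cell and left only onto an \<open>Rt\<close> cell, and is blocked otherwise.
  So every head owns an interval of cells that no other head can enter.\<close>
datatype status = Lt | Rt | Hd head

type_synonym cell = "kd \<times> bool \<times> ptr set \<times> status"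

text \<open>A head cannot jump to cell 1, so \<open>Home\<close> carries the next label left to the
  wall, bounces there and resumes to the right of it. The boolean before the new head tells whether
  the move goes right.\<close>

fun trans :: "operation list \<Rightarrow> head \<Rightarrow> kd \<Rightarrow> bool \<Rightarrow> ptr set \<Rightarrow> (bool \<times> ptr set \<times> bool \<times> head) option" where
  "trans full (Run q) k d S = (if k = Wall then None else
     case act full q k d S of None \<Rightarrow> None
     | Some (d', s, h, q') \<Rightarrow> Some (d', s, \<not> h, if h then Home q' else Run q'))"
| "trans full (Home q) k d S = Some (d, S, k = Wall, if k = Wall then Run q else Home q)"

definition stat :: "cell \<Rightarrow> status" where "stat c = snd (snd (snd c))"

lemma stat_simp [simp]: "stat (k, d, S, s) = s"
  by (simp add: stat_def)

fun leaves :: "operation list \<Rightarrow> bool \<Rightarrow> cell \<Rightarrow> head option" where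
  "leaves full rt (k, d, S, Hd s) = (case trans full s k d S of None \<Rightarrow> None
     | Some (d', S', rt', s') \<Rightarrow> if rt' = rt then Some s' else None)"
| "leaves full rt (k, d, S, Lt) = None"
| "leaves full rt (k, d, S, Rt) = None"

fun cell_rule :: "operation list \<Rightarrow> cell \<Rightarrow> cell \<Rightarrow> cell \<Rightarrow> cell" where
  "cell_rule full l (k, d, S, Hd s) r = (case trans full s k d S of None \<Rightarrow> (k, d, S, Hd s)
     | Some (d', S', rt, s') \<Rightarrow>
         if rt then (if stat r = Lt then (k, d', S', Rt) else (k, d, S, Hd s))
         else (if stat l = Rt then (k, d', S', Lt) else (k, d, S, Hd s)))"
| "cell_rule full l (k, d, S, Lt) r =
     (k, d, S, case leaves full True l of None \<Rightarrow> Lt | Some s \<Rightarrow> Hd s)"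
| "cell_rule full l (k, d, S, Rt) r =
     (k, d, S, case leaves full False r of None \<Rightarrow> Rt | Some s \<Rightarrow> Hd s)"

definition glob :: "operation list \<Rightarrow> (int \<Rightarrow> cell) \<Rightarrow> int \<Rightarrow> cell" where
  "glob full x = (\<lambda>i. cell_rule full (x (i - 1)) (x i) (x (i + 1)))"

type_synonym hconfig = "head \<times> nat \<times> (nat \<Rightarrow> bool) \<times> (nat \<Rightarrow> ptr set)"

section \<open>A head confined to the interval of cells that it owns\<close>

locale walled = machine +
  assumes K0: "K 0 = Wall"
begin

text \<open>\<open>I\<close> stands for the cells that the head can enter. A move to the right out
  of \<open>I\<close> is refused, and the configuration is then fixed forever.\<close>

definition hstep :: "nat set \<Rightarrow> hconfig \<Rightarrow> hconfig" where
  "hstep I c = (case c of (s, p, D, S) \<Rightarrow>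
     (case trans full s (K p) (D p) (S p) of None \<Rightarrow> c
      | Some (d, S', rt, s') \<Rightarrow>
         if rt then (if Suc p \<in> I then (s', Suc p, D(p := d), S(p := S')) else c)
         else (s', p - 1, D(p := d), S(p := S'))))"

definition cell_of :: "hconfig \<Rightarrow> nat \<Rightarrow> cell" where
  "cell_of c i = (case c of (s, p, D, S) \<Rightarrow>
     (K i, D i, S i, if i < p then Rt else if i = p then Hd s else Lt))"

definition sim :: "nat set \<Rightarrow> (int \<Rightarrow> cell) \<Rightarrow> hconfig \<Rightarrow> bool" where
  "sim I x c \<longleftrightarrow> fst (snd c) \<in> I \<and> (\<forall>i\<in>I. x (int i) = cell_of c i) \<and>
     (\<forall>i. i \<in> I \<and> Suc i \<notin> I \<longrightarrow> stat (x (int (Suc i))) \<noteq> Lt)"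

lemma trans_0: "trans full s (K 0) d S = Some (d', S', rt, s') \<Longrightarrow> rt"
  using K0 by (cases s) auto

text \<open>In \<open>I\<close> the cells left of the head are \<open>Rt\<close> and those right of
  it \<open>Lt\<close>. An \<open>Rt\<close> cell admits heads only from the right and an
  \<open>Lt\<close> cell only from the left, so no other head ever enters \<open>I\<close>. The
  tracked head never leaves the wall at 0 to the left, and the first cell beyond \<open>I\<close>,
  not being \<open>Lt\<close>, blocks it on the right.\<close>

lemma sim_step:
  assumes I: "\<And>i j. j \<in> I \<Longrightarrow> i \<le> j \<Longrightarrow> i \<in> I" and "sim I x c"
  shows "sim I (glob full x) (hstep I c)"
proof -
  obtain s p D S where c: "c = (s, p, D, S)" by (cases c)
  have p: "p \<in> I" and x: "\<And>i. i \<in> I \<Longrightarrow> x (int i) = cell_of c i"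
    and bd: "\<And>i. i \<in> I \<Longrightarrow> Suc i \<notin> I \<Longrightarrow> stat (x (int (Suc i))) \<noteq> Lt"
    using assms(2) by (auto simp: sim_def c)
  let ?c = "hstep I c"
  have p': "fst (snd ?c) \<in> I"
    using p I[OF p, of "p - 1"] by (auto simp: hstep_def c split: option.splits prod.splits)
  have xp: "x (int p) = (K p, D p, S p, Hd s)" using x[OF p] by (simp add: cell_of_def c)
  have lv: "leaves full rt (x (int i)) = None" if "i \<in> I" "i \<noteq> p" for i rt
    using x[OF that(1)] that(2) by (auto simp: cell_of_def c)
  have lp: "leaves full rt (x (int p)) = (case trans full s (K p) (D p) (S p) of None \<Rightarrow> None
     | Some (d', S', rt', s') \<Rightarrow> if rt' = rt then Some s' else None)" for rt
    by (simp add: xp)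
  have r: "stat (x (int p + 1)) = Lt \<longleftrightarrow> Suc p \<in> I"
    using x[of "Suc p"] bd[OF p] by (auto simp: cell_of_def c add.commute)
  have l: "stat (x (int p - 1)) = Rt" if "0 < p"
  proof -
    have "int p - 1 = int (p - 1)" using that by simp
    moreover have "stat (x (int (p - 1))) = Rt"
      using x[of "p - 1"] I[OF p, of "p - 1"] that by (simp add: cell_of_def c)
    ultimately show ?thesis by (simp only:)
  qed
  consider (stay) "?c = c" "leaves full False (x (int p)) = None"
      "leaves full True (x (int p)) = None \<or> Suc p \<notin> I" "glob full x (int p) = x (int p)"
    | (right) s' d S' where "?c = (s', Suc p, D(p := d), S(p := S'))" "leaves full True (x (int p)) = Some s'"
      "leaves full False (x (int p)) = None" "glob full x (int p) = (K p, d, S', Rt)"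
    | (left) s' d S' where "?c = (s', p - 1, D(p := d), S(p := S'))" "0 < p"
      "leaves full True (x (int p)) = None"
      "leaves full False (x (int p)) = Some s'" "glob full x (int p) = (K p, d, S', Lt)"
  proof (cases "trans full s (K p) (D p) (S p)")
    case None
    then show ?thesis by (intro stay) (simp_all add: lp hstep_def c glob_def xp)
  next
    case (Some a)
    obtain d S' rt s' where a: "a = (d, S', rt, s')" by (cases a)
    note tr = Some[unfolded a]
    show ?thesis
    proof (cases rt)
      case True
      show ?thesis
      proof (cases "Suc p \<in> I")
        case False
        then show ?thesis using True tr r by (intro stay) (simp_all add: lp hstep_def c glob_def xp)
      next
        case sp: True
        show ?thesis
          by (rule right[of s' d S']) (use True sp tr r in \<open>simp_all add: lp hstep_def c glob_def xp\<close>)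
      qed
    next
      case False
      then have p0: "0 < p" using trans_0 tr by (cases "p = 0") auto
      show ?thesis
        by (rule left[of s' d S']) (use False p0 tr l in \<open>simp_all add: lp hstep_def c glob_def xp\<close>)
    qed
  qed
  note cases = this
  have lo: "glob full x (int i) = (K i, D i, S i,
      if Suc i = p then (case leaves full False (x (int p)) of None \<Rightarrow> Rt | Some s \<Rightarrow> Hd s) else Rt)"
    if "i < p" for i
  proof -
    have i: "i \<in> I" "Suc i \<in> I" using I[OF p] that by auto
    have "x (int i) = (K i, D i, S i, Rt)" using x[OF i(1)] that by (simp add: cell_of_def c)
    then have "glob full x (int i) = (K i, D i, S i,
        case leaves full False (x (int (Suc i))) of None \<Rightarrow> Rt | Some s \<Rightarrow> Hd s)"
      by (simp add: glob_def add.commute)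
    then show ?thesis using lv[OF i(2)] by (cases "Suc i = p") auto
  qed
  have hi: "glob full x (int i) = (K i, D i, S i,
      if i = Suc p then (case leaves full True (x (int p)) of None \<Rightarrow> Lt | Some s \<Rightarrow> Hd s) else Lt)"
    if "p < i" "i \<in> I" for i
  proof -
    have i: "i - 1 \<in> I" using I[OF that(2)] by simp
    have i1: "int i - 1 = int (i - 1)" using that by simp
    have "x (int i) = (K i, D i, S i, Lt)" using x[OF that(2)] that by (simp add: cell_of_def c)
    then have g: "glob full x (int i) = (K i, D i, S i,
        case leaves full True (x (int (i - 1))) of None \<Rightarrow> Lt | Some s \<Rightarrow> Hd s)"
      by (simp only: glob_def i1 cell_rule.simps)
    show ?thesis
    proof (cases "i = Suc p")
      case False
      then have "i - 1 \<noteq> p" using that by auto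
      then show ?thesis using g lv[OF i] False by simp
    qed (use g in simp)
  qed
  have step: "glob full x (int i) = cell_of ?c i" if i: "i \<in> I" for i
  proof -
    consider "i < p" | "i = p" | "p < i" by linarith
    then show ?thesis
    proof cases
      case 1
      show ?thesis unfolding lo[OF 1] by (rule cases) (use 1 in \<open>auto simp: cell_of_def c\<close>)
    next
      case 2
      show ?thesis unfolding 2 by (rule cases) (auto simp: cell_of_def c xp)
    next
      case 3
      show ?thesis unfolding hi[OF 3 i] by (rule cases) (use 3 i in \<open>auto simp: cell_of_def c\<close>)
    qed
  qed
  have "stat (glob full x (int (Suc i))) \<noteq> Lt" if i: "i \<in> I" "Suc i \<notin> I" for i
  proof -
    \<comment> \<open>A cell turns into \<open>Lt\<close> only when its head moves left onto an
      \<open>Rt\<close> cell. The last cell of \<open>I\<close> is at or right of the head, so it is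
      not \<open>Rt\<close>.\<close>
    have "p \<le> i" using I[OF p, of "Suc i"] i(2) by (meson not_less_eq_eq)
    then have "stat (x (int i)) \<noteq> Rt" using x[OF i(1)] by (auto simp: cell_of_def c)
    then show ?thesis using bd[OF i]
      by (cases "(full, x (int i), x (int (Suc i)), x (int (Suc i) + 1))" rule: cell_rule.cases)
        (auto simp: glob_def split: option.splits)
  qed
  then show ?thesis using p' step by (auto simp: sim_def)
qed

lemma sim_steps:
  assumes "\<And>i j. j \<in> I \<Longrightarrow> i \<le> j \<Longrightarrow> i \<in> I" "sim I x c"
  shows "sim I ((glob full ^^ t) x) ((hstep I ^^ t) c)"
  by (induction t) (use assms sim_step[OF assms(1)] in auto)

text \<open>While the head walks home, the idealised machine already waits at cell 1. The absence of
  walls up to the head guarantees that the walk ends at cell 0 and not at some other wall.\<close>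

definition tracks :: "config \<Rightarrow> hconfig \<Rightarrow> nat \<Rightarrow> bool" where
  "tracks m c n \<longleftrightarrow> (\<exists>q p D S. (mid ^^ n) m (q, p, D, S) \<and>
     (c = (Run q, p, D, S) \<and> 1 \<le> p \<and> (\<forall>u. 1 \<le> u \<and> u < p \<longrightarrow> K u \<noteq> Wall) \<or>
      p = 1 \<and> (\<exists>p'. c = (Home q, p', D, S) \<and> (\<forall>u. 1 \<le> u \<and> u \<le> p' \<longrightarrow> K u \<noteq> Wall))))"

lemma tracks_RunI:
  "(mid ^^ n) m (q, p, D, S) \<Longrightarrow> 1 \<le> p \<Longrightarrow> \<forall>u. 1 \<le> u \<and> u < p \<longrightarrow> K u \<noteq> Wall \<Longrightarrow>
    tracks m (Run q, p, D, S) n"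
  unfolding tracks_def by blast

lemma tracks_HomeI:
  "(mid ^^ n) m (q, 1, D, S) \<Longrightarrow> \<forall>u. 1 \<le> u \<and> u \<le> p \<longrightarrow> K u \<noteq> Wall \<Longrightarrow>
    tracks m (Home q, p, D, S) n"
  unfolding tracks_def by blast

lemma tracks_Run:
  assumes "tracks m (Run q, p, D, S) n" "hstep I (Run q, p, D, S) \<noteq> (Run q, p, D, S)"
  shows "tracks m (hstep I (Run q, p, D, S)) (Suc n)"
proof -
  have m: "(mid ^^ n) m (q, p, D, S)" and p: "1 \<le> p" "\<And>u. 1 \<le> u \<Longrightarrow> u < p \<Longrightarrow> K u \<noteq> Wall"
    using assms(1) by (auto simp: tracks_def)
  obtain d s h q' where a: "K p \<noteq> Wall" "act full q (K p) (D p) (S p) = Some (d, s, h, q')"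
    using assms(2) by (auto simp: hstep_def split: option.splits if_splits)
  have m': "(mid ^^ Suc n) m (q', if h then 1 else Suc p, D(p := d), S(p := s))"
    using relpowp_Suc_I[of n mid, OF m midI[of p q D S, OF a]] .
  show ?thesis
  proof (cases h)
    case True
    then have c: "hstep I (Run q, p, D, S) = (Home q', p - 1, D(p := d), S(p := s))"
      using a by (simp add: hstep_def)
    have "\<forall>u. 1 \<le> u \<and> u \<le> p - 1 \<longrightarrow> K u \<noteq> Wall" using p(2) by auto
    then show ?thesis unfolding c using m' True by (intro tracks_HomeI) simp_all
  next
    case False
    then have c: "hstep I (Run q, p, D, S) = (Run q', Suc p, D(p := d), S(p := s))"
      using a assms(2) by (auto simp: hstep_def split: if_splits)
    have "\<forall>u. 1 \<le> u \<and> u < Suc p \<longrightarrow> K u \<noteq> Wall" using p(2) a(1) by (auto simp: less_Suc_eq)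
    then show ?thesis unfolding c using m' False by (intro tracks_RunI) simp_all
  qed
qed

lemma tracks_Home:
  assumes "tracks m (Home q, p, D, S) n" "hstep I (Home q, p, D, S) \<noteq> (Home q, p, D, S)"
  shows "tracks m (hstep I (Home q, p, D, S)) n"
proof -
  have m: "(mid ^^ n) m (q, 1, D, S)" and p: "\<And>u. 1 \<le> u \<Longrightarrow> u \<le> p \<Longrightarrow> K u \<noteq> Wall"
    using assms(1) by (auto simp: tracks_def)
  show ?thesis
  proof (cases "p = 0")
    case True
    then have "hstep I (Home q, p, D, S) = (Run q, 1, D, S)"
      using assms(2) K0 by (auto simp: hstep_def split: if_splits)
    then show ?thesis using m by (simp add: tracks_RunI)
  next
    case False
    then have "hstep I (Home q, p, D, S) = (Home q, p - 1, D, S)" using p[of p] by (simp add: hstep_def)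
    moreover have "\<forall>u. 1 \<le> u \<and> u \<le> p - 1 \<longrightarrow> K u \<noteq> Wall" using p by auto
    ultimately show ?thesis using tracks_HomeI[OF m] by simp
  qed
qed

text \<open>A step of a \<open>Home\<close> head is not a step of \<open>mid\<close>, so elapsed
  time alone gives no \<open>mid\<close> steps. But a visit of the initial state is followed by a
  \<open>Run\<close> step, which is one unless the head is blocked, and \<open>nf\<close> excludes
  blocked configurations.\<close>

lemma recurrent_live:
  assumes nf: "\<And>t. hstep I ((hstep I ^^ t) c) \<noteq> (hstep I ^^ t) c" and c: "c = (Run init, 1, D, S)"
    and vis: "\<And>t. \<exists>t'\<ge>t. \<exists>D' S'. (hstep I ^^ t') c = (Run init, 1, D', S')"
  shows "live (init, 1, D, S)"
proof -
  let ?m = "(init, 1, D, S)" let ?c = "\<lambda>t. (hstep I ^^ t) c"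
  have step: "\<exists>n'\<ge>n. tracks ?m (?c (Suc t)) n'" if "tracks ?m (?c t) n" for t n
  proof -
    obtain s p D S where ct: "?c t = (s, p, D, S)" by (cases "?c t")
    show ?thesis
    proof (cases s)
      case (Run q)
      then have "tracks ?m (?c (Suc t)) (Suc n)" using tracks_Run[of ?m q p D S n I] that nf[of t] ct by simp
      then show ?thesis by (intro exI[of _ "Suc n"]) simp
    next
      case (Home q)
      then have "tracks ?m (?c (Suc t)) n" using tracks_Home[of ?m q p D S n I] that nf[of t] ct by simp
      then show ?thesis by blast
    qed
  qed
  have steps: "\<exists>n'\<ge>n. tracks ?m (?c (t + k)) n'" if "tracks ?m (?c t) n" for t n k
  proof (induction k)
    case 0
    show ?case using that by auto
  next
    case (Suc k)
    then obtain n1 where n1: "n1 \<ge> n" "tracks ?m (?c (t + k)) n1" by blast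
    obtain n2 where n2: "n2 \<ge> n1" "tracks ?m (?c (Suc (t + k))) n2" using step[OF n1(2)] by blast
    show ?case using n1(1) n2 by (intro exI[of _ n2]) simp
  qed
  have "\<exists>n\<ge>N. \<exists>t D' S'. tracks ?m (?c t) n \<and> ?c t = (Run init, 1, D', S')" for N
  proof (induction N)
    case 0
    have "?c 0 = (Run init, 1, D, S)" using c by simp
    moreover have "tracks ?m (Run init, 1, D, S) 0" by (rule tracks_RunI) auto
    ultimately show ?case by (metis zero_le)
  next
    case (Suc N)
    then obtain n t D' S' where n: "n \<ge> N" "tracks ?m (?c t) n" "?c t = (Run init, 1, D', S')" by blast
    have 1: "tracks ?m (?c (Suc t)) (Suc n)"
      using tracks_Run[of ?m init 1 D' S' n I] n(2,3) nf[of t] by simp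
    obtain t' D2 S2 where t': "t' \<ge> Suc t" "?c t' = (Run init, 1, D2, S2)" using vis by blast
    obtain n' where n': "n' \<ge> Suc n" "tracks ?m (?c t') n'"
      using steps[OF 1, of "t' - Suc t"] t'(1) by auto
    have "n' \<ge> Suc N" using n'(1) n(1) by simp
    then show ?case using t'(2) n'(2) by blast
  qed
  moreover have "(mid ^^ n) ?m (init, 1, D', S')" if "tracks ?m (Run init, 1, D', S') n" for n D' S'
    using that by (auto simp: tracks_def)
  ultimately have "\<exists>n\<ge>N. \<exists>D' S'. (mid ^^ n) ?m (init, 1, D', S')" for N by metis
  then show ?thesis unfolding live_def by blast
qed

end

locale walled_tape = machine_tape + walled
begin

lemma hstep_Home:
  "(hstep UNIV ^^ Suc p) (Home q, p, D, S) = (Run q, 1, D, S)"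
proof (induction p)
  case 0
  then show ?case using K0 by (simp add: hstep_def)
next
  case (Suc p)
  have "hstep UNIV (Home q, Suc p, D, S) = (Home q, p, D, S)" using no_wall[of "Suc p"] by (simp add: hstep_def)
  then show ?case using Suc by (simp only: funpow_Suc_right comp_apply)
qed

lemma mid_hstep:
  assumes "mid (q, p, D, S) (q', p', D', S')" "1 \<le> p"
  shows "\<exists>a\<ge>1. (hstep UNIV ^^ a) (Run q, p, D, S) = (Run q', p', D', S') \<and> 1 \<le> p'"
proof -
  obtain d s h where a: "K p \<noteq> Wall" "act full q (K p) (D p) (S p) = Some (d, s, h, q')"
    "p' = (if h then 1 else Suc p)" "D' = D(p := d)" "S' = S(p := s)"
    using assms(1) unfolding mid_def by auto
  show ?thesis
  proof (cases h)
    case True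
    have "hstep UNIV (Run q, p, D, S) = (Home q', p - 1, D', S')" using a True by (simp add: hstep_def)
    then have "(hstep UNIV ^^ Suc (Suc (p - 1))) (Run q, p, D, S) = (Run q', p', D', S')"
      using hstep_Home[of "p - 1" q' D' S'] a(3) True
      by (simp only: funpow_Suc_right[of "Suc (p - 1)"] comp_apply if_True)
    then show ?thesis using a(3) True by (intro exI[of _ "Suc (Suc (p - 1))"]) auto
  next
    case False
    then have "hstep UNIV (Run q, p, D, S) = (Run q', p', D', S')" using a by (simp add: hstep_def)
    then show ?thesis using a(3) False by (intro exI[of _ 1]) auto
  qed
qed

lemma mids_hstep:
  assumes "(mid ^^ n) (q, p, D, S) (q', p', D', S')" "1 \<le> p"
  shows "\<exists>a\<ge>n. (hstep UNIV ^^ a) (Run q, p, D, S) = (Run q', p', D', S') \<and> 1 \<le> p'"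
  using assms(1)
proof (induction n arbitrary: q' p' D' S')
  case 0
  then show ?case using assms(2) by (intro exI[of _ 0]) auto
next
  case (Suc n)
  obtain q1 p1 D1 S1 where 1: "(mid ^^ n) (q, p, D, S) (q1, p1, D1, S1)" "mid (q1, p1, D1, S1) (q', p', D', S')"
    using Suc.prems by (auto elim!: relpowp_Suc_E)
  obtain a where a: "a \<ge> n" "(hstep UNIV ^^ a) (Run q, p, D, S) = (Run q1, p1, D1, S1)" "1 \<le> p1"
    using Suc.IH[OF 1(1)] by blast
  obtain b where b: "b \<ge> 1" "(hstep UNIV ^^ b) (Run q1, p1, D1, S1) = (Run q', p', D', S')" "1 \<le> p'"
    using mid_hstep[OF 1(2) a(3)] by blast
  have "(hstep UNIV ^^ (b + a)) (Run q, p, D, S) = (Run q', p', D', S')"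
    using a(2) b(2) by (simp only: funpow_add comp_apply)
  then show ?case using a(1) b(1,3) by (intro exI[of _ "b + a"]) auto
qed

end

section \<open>Finiteness of the alphabet\<close>

definition labels :: "operation list \<Rightarrow> lbl set" where
  "labels full = (\<lambda>(m, ph). (drop m full, ph)) ` ({..length full} \<times> {..4})"

lemma labelsI: "ph \<le> 4 \<Longrightarrow> (drop m full, ph) \<in> labels full"
proof (cases "m \<le> length full")
  case True
  assume "ph \<le> 4"
  then show ?thesis using True unfolding labels_def by (intro image_eqI[of _ _ "(m, ph)"]) auto
next
  case False
  assume "ph \<le> 4"
  then show ?thesis using False unfolding labels_def by (intro image_eqI[of _ _ "(length full, ph)"]) auto
qed

lemma labels_ph: "(l, ph) \<in> labels full \<Longrightarrow> ph' \<le> 4 \<Longrightarrow> (l, ph') \<in> labels full"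
  unfolding labels_def by (auto intro: image_eqI)

lemma labels_rest: "(a # l, ph) \<in> labels full \<Longrightarrow> ph' \<le> 4 \<Longrightarrow> (drop n l, ph') \<in> labels full"
proof -
  assume "(a # l, ph) \<in> labels full" and ph: "ph' \<le> 4"
  then obtain m where "a # l = drop m full" unfolding labels_def by auto
  then have "l = drop (Suc m) full" by (metis drop_Suc list.sel(3) tl_drop)
  then have "drop n l = drop (n + Suc m) full" by simp
  then show ?thesis using labelsI[OF ph] by metis
qed

text \<open>Operations are only dropped from the front, or the whole program is reloaded, so what
  remains to be done is always a suffix of \<open>full\<close>; no new phase exceeds 4.\<close>

lemma act_labels:
  assumes "act full q k d S = Some (d', s, h, q')" "q \<in> labels full"
  shows "q' \<in> labels full"
proof -
  obtain l ph where q: "q = (l, ph)" by (cases q)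
  have full: "(full, 0) \<in> labels full" using labelsI[of 0 0 full] by simp
  show ?thesis
  proof (cases l)
    case Nil
    then show ?thesis using assms(1) full q by simp
  next
    case (Cons a l')
    have old: "(a # l', ph) \<in> labels full" using assms(2) q Cons by simp
    have rest: "(drop n l', 0) \<in> labels full" for n using labels_rest[OF old] by simp
    have rest0: "(l', 0) \<in> labels full" using rest[of 0] by simp
    have same: "(a # l', n) \<in> labels full" if "n \<le> 4" for n using labels_ph[OF old that] .
    show ?thesis
      using assms(1) old same[of 0] same[of 1] same[of 2] same[of 3] same[of 4] unfolding q Cons
      by (cases a) (auto simp: rest rest0 split: if_splits)
  qed
qed

definition heads :: "operation list \<Rightarrow> head set" where
  "heads full = Run ` labels full \<union> Home ` labels full"

definition kinds :: "nat \<Rightarrow> kd set" where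
  "kinds r = {Wall, Hdr} \<union> One ` {..<r}"

definition cells :: "operation list \<Rightarrow> nat \<Rightarrow> cell set" where
  "cells full r = kinds r \<times> UNIV \<times> UNIV \<times> ({Lt, Rt} \<union> Hd ` heads full)"

lemma finite_cells: "finite (cells full r)"
proof -
  have "(UNIV :: ptr set) = {PX, PG, PP, PQ, PR}" using ptr.exhaust by auto
  then have "finite (UNIV :: ptr set)" by (metis finite.emptyI finite.insertI)
  then have "finite (UNIV :: ptr set set)" by (metis Pow_UNIV finite_Pow_iff)
  then show ?thesis by (auto simp: cells_def kinds_def heads_def labels_def intro!: finite_cartesian_product)
qed

lemma trans_heads:
  "trans full s k d S = Some (d', S', rt, s') \<Longrightarrow> s \<in> heads full \<Longrightarrow> s' \<in> heads full"
  by (cases s) (auto simp: heads_def dest: act_labels split: if_splits option.splits)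

lemma leaves_heads: "leaves full rt c = Some s \<Longrightarrow> c \<in> cells full r \<Longrightarrow> s \<in> heads full"
  by (cases "(full, rt, c)" rule: leaves.cases)
    (auto simp: cells_def dest: trans_heads split: option.splits if_splits)

lemma cell_rule_cells:
  assumes "l \<in> cells full r" "c \<in> cells full r" "u \<in> cells full r"
  shows "cell_rule full l c u \<in> cells full r"
  using assms leaves_heads[of full True l _ r] leaves_heads[of full False u _ r]
  by (cases "(full, l, c, u)" rule: cell_rule.cases)
    (auto simp: cells_def dest: trans_heads split: option.splits)

text \<open>The closing \<open>One 1\<close> ends the run of \<open>One 0\<close>; without it the
  unknown cell to the right could prolong the run and change the value of \<open>f 0 0\<close>. On
  the tape of a solution it is the next letter because \<open>f 1 0 = 1\<close>. Digit and marks
  under the head are fixed as well, so that its first step is certain to succeed.\<close>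

definition start_word :: "operation list \<Rightarrow> nat \<Rightarrow> cell list" where
  "start_word full w = [(Wall, False, {}, Rt), (Hdr, False, {}, Hd (Run (full, 0)))] @
     replicate w (One 0, False, {}, Lt) @ [(One 1, False, {}, Lt)]"

lemma start_word_nth:
  "start_word full w ! 0 = (Wall, False, {}, Rt)"
  "start_word full w ! 1 = (Hdr, False, {}, Hd (Run (full, 0)))"
  "t < w \<Longrightarrow> start_word full w ! (t + 2) = (One 0, False, {}, Lt)"
  "start_word full w ! (w + 2) = (One 1, False, {}, Lt)"
  "length (start_word full w) = w + 3"
  by (simp_all add: start_word_def nth_append)

lemma glob_cells: "(\<And>i. x i \<in> cells full r) \<Longrightarrow> (glob full ^^ t) x i \<in> cells full r"
  by (induction t arbitrary: i) (auto simp: glob_def intro: cell_rule_cells)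

lemma recurrent_solvable:
  fixes x :: "int \<Rightarrow> cell"
  assumes "machine.body Es = bdy"
    and x: "\<And>i. i < w + 3 \<Longrightarrow> x (int i) = start_word (Odo # bdy) w ! i"
    and rec: "\<And>t. \<exists>t'\<ge>t. (glob (Odo # bdy) ^^ t') x 1 = x 1"
  shows "solvable (set Es) w"
proof -
  define K where "K i = fst (x (int i))" for i
  define D where "D i = fst (snd (x (int i)))" for i
  define S where "S i = fst (snd (snd (x (int i))))" for i
  have x0: "x 0 = (Wall, False, {}, Rt)" and x1: "x 1 = (Hdr, False, {}, Hd (Run (Odo # bdy, 0)))"
    using x[of 0] x[of 1] start_word_nth(1,2)[of "Odo # bdy" w] by simp_all
  have x2: "K (2 + t) = One 0" if "t < w" for t
    using x[of "t + 2"] start_word_nth(3)[OF that] that by (simp add: K_def add.commute)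
  have x3: "K (2 + w) = One 1"
    using x[of "w + 2"] start_word_nth(4)[of "Odo # bdy" w] by (simp add: K_def add.commute)
  have s2: "stat (x 2) = Lt"
    using x[of 2] start_word_nth(3)[of 0 w "Odo # bdy"] start_word_nth(4)[of "Odo # bdy" w]
    by (cases "w = 0") (auto simp: numeral_2_eq_2)
  interpret walled Es K
    by standard (use x0 x1 in \<open>simp_all add: K_def\<close>)
  have bdy: "body = bdy" by (rule assms(1))
  have xe: "x (int i) = (K i, D i, S i, stat (x (int i)))" for i
    by (simp add: K_def D_def S_def stat_def)
  \<comment> \<open>Right of the head, the interval extends up to the first cell that is not
    \<open>Lt\<close>.\<close>
  define I where "I = {i. \<forall>j. 2 \<le> j \<and> j \<le> i \<longrightarrow> stat (x (int j)) = Lt}"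
  have dc: "i \<in> I" if "j \<in> I" "i \<le> j" for i j using that by (auto simp: I_def)
  have I12: "0 \<in> I" "1 \<in> I" "2 \<in> I" using s2 by (auto simp: I_def)
  let ?c = "(Run init, 1, D, S)"
  have "sim I x ?c"
    unfolding sim_def
  proof (intro conjI ballI allI impI)
    show "fst (snd ?c) \<in> I" using I12 by simp
    fix i assume i: "i \<in> I"
    consider "i = 0" | "i = 1" | "2 \<le> i" by linarith
    then show "x (int i) = cell_of ?c i"
    proof cases
      case 3
      then have "stat (x (int i)) = Lt" using i by (simp add: I_def)
      then show ?thesis using 3 xe[of i] by (simp add: cell_of_def)
    qed (use x0 x1 xe[of 0] xe[of 1] in \<open>simp_all add: cell_of_def init_def bdy\<close>)
  next
    fix i assume i: "i \<in> I \<and> Suc i \<notin> I"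
    then obtain j where j: "2 \<le> j" "j \<le> Suc i" "stat (x (int j)) \<noteq> Lt" by (auto simp: I_def)
    have "j = Suc i"
    proof (rule ccontr)
      assume "j \<noteq> Suc i"
      then show False using j i by (auto simp: I_def)
    qed
    then show "stat (x (int (Suc i))) \<noteq> Lt" using j(3) by simp
  qed
  then have "sim I ((glob full ^^ t) x) ((hstep I ^^ t) ?c)" for t
    by (intro sim_steps) (use dc in auto)
  then have sim: "sim I ((glob (Odo # bdy) ^^ t) x) ((hstep I ^^ t) ?c)" for t
    unfolding bdy .
  have vis: "\<exists>t'\<ge>t. \<exists>D' S'. (hstep I ^^ t') ?c = (Run init, 1, D', S') \<and> \<not> D' 1 \<and> S' 1 = {}" for t
  proof -
    obtain t' where t': "t' \<ge> t" "(glob (Odo # bdy) ^^ t') x 1 = x 1" using rec by blast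
    obtain s p D' S' where c': "(hstep I ^^ t') ?c = (s, p, D', S')" by (cases "(hstep I ^^ t') ?c")
    have "(glob (Odo # bdy) ^^ t') x (int 1) = cell_of (s, p, D', S') 1"
      using sim[of t'] I12(2) unfolding sim_def c' by blast
    then have "cell_of (s, p, D', S') 1 = (Hdr, False, {}, Hd (Run init))"
      using t'(2) x1 by (simp add: init_def bdy)
    then have "p = 1" "s = Run init" "\<not> D' 1" "S' 1 = {}"
      by (auto simp: cell_of_def split: if_splits)
    then show ?thesis using t'(1) c' by blast
  qed
  have "live (init, 1, D, S)"
  proof (rule recurrent_live[of I ?c])
    fix t
    show "hstep I ((hstep I ^^ t) ?c) \<noteq> (hstep I ^^ t) ?c"
    proof
      \<comment> \<open>A blocked head would recur trivially. But it would have to be blocked in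
        cell 1 in the initial state, where digit 0 and the absence of marks let \<open>Odo\<close>
        take a step.\<close>
      assume fixed: "hstep I ((hstep I ^^ t) ?c) = (hstep I ^^ t) ?c"
      have const: "(hstep I ^^ (t + k)) ?c = (hstep I ^^ t) ?c" for k
        by (induction k) (use fixed in auto)
      obtain t' D' S' where t': "t' \<ge> t" "(hstep I ^^ t') ?c = (Run init, 1, D', S')" "\<not> D' 1" "S' 1 = {}"
        using vis by blast
      have "(hstep I ^^ t) ?c = (Run init, 1, D', S')" using const[of "t' - t"] t'(1,2) by simp
      then have "hstep I (Run init, 1, D', S') = (Run init, 1, D', S')" using fixed by simp
      then show False using t'(3,4) K1 by (simp add: hstep_def init_def)
    qed
    show "\<exists>t'\<ge>t. \<exists>D' S'. (hstep I ^^ t') ?c = (Run init, 1, D', S')" using vis[of t] by blast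
  qed simp
  moreover have "cnt K 0 1 w"
    by (rule cnt_run[of 0]) (use x2 x3 in auto)
  ultimately show ?thesis by (rule live_solution)
qed

lemma tape_kinds: "tape f r u \<in> kinds r"
proof (cases "u = 0")
  case True
  then show ?thesis by (simp add: tape_0 kinds_def)
next
  case False
  then have "1 \<le> u" by simp
  then obtain n t where t: "t < length (block f r n)" "u = block_start f r n + t" by (rule tape_cases)
  then have "tape f r u \<in> set (block f r n)" using tape_block[OF t(1)] by simp
  then show ?thesis by (auto simp: block_def kinds_def)
qed

lemma block_start_gt: "n < block_start f r n"
proof (induction n)
  case (Suc n)
  then show ?case by (simp add: block_def)
qed simp

lemma solvable_recurrent:
  assumes sol: "solvable (set Es) w" and "machine.body Es = bdy" and r: "1 < r" "below r (set Es)"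
  shows "\<exists>x. (\<forall>i. x i \<in> cells (Odo # bdy) r) \<and> (\<forall>i<w + 3. x (int i) = start_word (Odo # bdy) w ! i) \<and>
    (\<forall>m. \<exists>t\<ge>m. \<forall>i. \<bar>i\<bar> \<le> int m \<longrightarrow> (glob (Odo # bdy) ^^ t) x i = x i)"
proof -
  obtain f where f: "f 0 0 = w" "f 1 = Suc" "holds f (set Es)" using sol unfolding solvable_def by blast
  let ?K = "tape f r"
  interpret walled_tape Es ?K
    by standard (use tape_1 tape_0 tape_not_Wall in auto)
  have bdy: "body = bdy" by (rule assms(2))
  let ?c = "(Run init, 1, \<lambda>_. False, \<lambda>_. {}) :: hconfig"
  \<comment> \<open>The cells to the left are walls with status \<open>Rt\<close>. They contain no
    head and never change, since the head does not leave cell 0 to the left.\<close>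
  define x where "x i = (if i < 0 then (Wall, False, {}, Rt) else cell_of ?c (nat i))" for i
  have "(Odo # bdy, 0) \<in> labels (Odo # bdy)" using labelsI[of 0 0 "Odo # bdy"] by simp
  then have "x i \<in> cells (Odo # bdy) r" for i
    using tape_kinds[of f r "nat i"]
    by (auto simp: x_def cell_of_def cells_def heads_def init_def bdy kinds_def)
  moreover have "x (int i) = start_word (Odo # bdy) w ! i" if i: "i < w + 3" for i
  proof -
    have "[0..<r] = 0 # 1 # [2..<r]" using r(1) by (simp add: upt_conv_Cons numeral_2_eq_2)
    then have bl: "block f r 0 = Hdr # replicate w (One 0) @ One 1 # concat (map (\<lambda>i. replicate (f i 0) (One i)) [2..<r])"
      using f by (simp add: block_def)
    have xi: "x (int i) = cell_of ?c i" by (simp add: x_def)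
    have tb: "?K (Suc t) = block f r 0 ! t" if "t < length (block f r 0)" for t
      using tape_block[OF that] by simp
    consider "i = 0" | "i = 1" | t where "i = t + 2" "t < w" | "i = w + 2"
    proof -
      have "i = 0 \<or> i = 1 \<or> (\<exists>t. i = t + 2 \<and> t < w) \<or> i = w + 2"
        using i by (cases i; cases "i - 1") auto
      then show thesis using that by blast
    qed
    then show ?thesis
    proof cases
      case 1
      then show ?thesis unfolding xi using start_word_nth(1) tape_0 by (simp add: cell_of_def)
    next
      case 2
      then show ?thesis unfolding xi using start_word_nth(2)[of "Odo # bdy" w] tape_1 by (simp add: cell_of_def init_def bdy)
    next
      case (3 t)
      then have "?K i = One 0" using tb[of "Suc t"] by (simp add: bl nth_append)
      then show ?thesis unfolding xi using 3 start_word_nth(3)[of t w "Odo # bdy"] by (simp add: cell_of_def)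
    next
      case 4
      then have "?K i = One 1" using tb[of "Suc w"] by (simp add: bl nth_append)
      then show ?thesis unfolding xi using 4 start_word_nth(4)[of "Odo # bdy" w] by (simp add: cell_of_def)
    qed
  qed
  moreover have "\<exists>t\<ge>m. \<forall>i. \<bar>i\<bar> \<le> int m \<longrightarrow> (glob (Odo # bdy) ^^ t) x i = x i" for m
  proof -
    have "sim UNIV x ?c" by (auto simp: sim_def x_def)
    then have sim: "sim UNIV ((glob full ^^ t) x) ((hstep UNIV ^^ t) ?c)" for t
      by (intro sim_steps) auto
    have pos: "(glob full ^^ t) x (int i) = cell_of ((hstep UNIV ^^ t) ?c) i" for t i
      using sim[of t] by (simp add: sim_def)
    have neg: "i < 0 \<Longrightarrow> (glob full ^^ t) x i = (Wall, False, {}, Rt)" for t i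
    proof (induction t arbitrary: i)
      case 0
      then show ?case by (simp add: x_def)
    next
      case (Suc t)
      let ?x = "(glob full ^^ t) x"
      have "leaves full False (?x (i + 1)) = None"
      proof (cases "i + 1 < 0")
        case True
        then show ?thesis using Suc.IH[of "i + 1"] by simp
      next
        case False
        then have i: "i + 1 = int 0" using Suc.prems by simp
        obtain s p D S where c': "(hstep UNIV ^^ t) ?c = (s, p, D, S)" by (cases "(hstep UNIV ^^ t) ?c")
        show ?thesis unfolding i pos c'
          by (auto simp: cell_of_def split: option.splits prod.splits dest: trans_0)
      qed
      moreover have "?x i = (Wall, False, {}, Rt)" by (rule Suc.IH[OF Suc.prems])
      ultimately have "glob full ?x i = (Wall, False, {}, Rt)" by (simp add: glob_def)
      then show ?case by simp
    qed
    obtain j where j: "j > m"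
      "(mid ^^ j) (init, 1, \<lambda>_. False, \<lambda>_. {}) (init, 1, \<lambda>u. u = block_start f r m, \<lambda>_. {})"
      using solution_recurrence[of "block_start f r" r f m] nxt_tape[of f r] cnt_tape f r by auto
    obtain a where a: "a \<ge> j" "(hstep UNIV ^^ a) ?c = (Run init, 1, \<lambda>u. u = block_start f r m, \<lambda>_. {})"
      using mids_hstep[OF j(2)] by auto
    have "(glob full ^^ a) x i = x i" if i: "\<bar>i\<bar> \<le> int m" for i
    proof (cases "i < 0")
      case True
      then show ?thesis by (simp add: neg x_def)
    next
      case False
      \<comment> \<open>Only the digit at the start of block \<open>m\<close> differs from the
        initial configuration, and that cell lies outside the window.\<close>
      then have "nat i \<noteq> block_start f r m" using i block_start_gt[of m f r] by simp
      moreover have "(glob full ^^ a) x i = cell_of ((hstep UNIV ^^ a) ?c) (nat i)"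
        using pos[of a "nat i"] False by simp
      ultimately show ?thesis using False unfolding a(2) by (simp add: x_def cell_of_def)
    qed
    then show ?thesis using a(1) j(1) bdy by (intro exI[of _ a]) auto
  qed
  ultimately show ?thesis by blast
qed

section \<open>The reduction and completeness\<close>

lemma below_exists: "finite E \<Longrightarrow> \<exists>r>1. below r E"
proof (induction E rule: finite_induct)
  case empty
  show ?case by (intro exI[of _ 2]) simp
next
  case (insert e E)
  then obtain r where r: "r > 1" "below r E" by blast
  obtain b c i j k where e: "e = (b, c, i, j, k)" by (cases e)
  let ?s = "r + c + i + j + k + 1"
  have "below ?s E" by (rule below_mono[OF r(2)]) simp
  then show ?case using r(1) e by (intro exI[of _ ?s]) auto
qed

theorem automaton_for_system:
  assumes "finite E"
  shows "\<exists>k R u a v. 0 < k \<and> (\<forall>a b c. a < k \<longrightarrow> b < k \<longrightarrow> c < k \<longrightarrow> R a b c < k) \<and>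
    (\<forall>w. solvable E w \<longleftrightarrow>
      word_code k (u @ replicate w a @ v) \<in> language k (nonwandering (ca R) (full_shift k)))"
proof -
  obtain Es where Es: "set Es = E" using finite_list[OF assms] by blast
  obtain r where r: "1 < r" "below r (set Es)" using below_exists[OF assms] Es by blast
  define bdy where "bdy = machine.body Es"
  let ?full = "Odo # bdy"
  let ?A = "cells ?full r"
  define k where "k = card ?A"
  obtain e where e: "bij_betw e ?A {0..<k}" unfolding k_def using ex_bij_betw_finite_nat[OF finite_cells] by blast
  define dec where "dec = inv_into ?A e"
  have dec: "dec n \<in> ?A" "e (dec n) = n" if "n < k" for n
    using that e unfolding dec_def bij_betw_def by (auto intro: inv_into_into f_inv_into_f)
  have dec_e: "dec (e c) = c" if "c \<in> ?A" for c
    using that e unfolding dec_def bij_betw_def by simp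
  have elt: "e c < k" if "c \<in> ?A" for c using that e unfolding bij_betw_def by auto
  have inj: "inj_on e ?A" using e by (simp add: bij_betw_def)
  define R where "R a b c = e (cell_rule ?full (dec a) (dec b) (dec c))" for a b c
  have R: "R a b c < k" if "a < k" "b < k" "c < k" for a b c
    unfolding R_def using elt cell_rule_cells dec(1) that by blast
  have k: "0 < k"
  proof -
    have "(Wall, False, {}, Lt) \<in> ?A" by (simp add: cells_def kinds_def)
    then show ?thesis using elt by fastforce
  qed
  have conj: "(ca R ^^ t) (\<lambda>i. e (x i)) = (\<lambda>i. e ((glob ?full ^^ t) x i))" if x: "\<And>i. x i \<in> ?A" for x t
  proof (induction t)
    case (Suc t)
    have "ca R (\<lambda>i. e ((glob ?full ^^ t) x i)) = (\<lambda>i. e (glob ?full ((glob ?full ^^ t) x) i))"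
      by (rule ext) (simp add: ca_apply R_def dec_e[OF glob_cells[OF x]] glob_def)
    then show ?case using Suc by simp
  qed simp
  have inA: "set (start_word ?full w) \<subseteq> ?A" for w
  proof -
    have "(?full, 0) \<in> labels ?full" using labelsI[of 0 0 ?full] by simp
    then show ?thesis using r(1) by (auto simp: start_word_def cells_def kinds_def heads_def)
  qed
  let ?N = "nonwandering (ca R) (full_shift k)"
  have "solvable E w \<longleftrightarrow> word_code k (map e (start_word ?full w)) \<in> language k ?N" for w
  proof
    assume "solvable E w"
    then obtain x where x: "\<And>i. x i \<in> ?A" "\<And>i. i < w + 3 \<Longrightarrow> x (int i) = start_word ?full w ! i"
      "\<And>m. \<exists>t\<ge>m. \<forall>i. \<bar>i\<bar> \<le> int m \<longrightarrow> (glob ?full ^^ t) x i = x i"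
      using solvable_recurrent[of Es w bdy r] Es r bdy_def by metis
    let ?y = "\<lambda>i. e (x i)"
    have "?y \<in> full_shift k" using elt x(1) by (simp add: full_shift_def)
    moreover have "\<exists>t\<ge>m. \<forall>i. \<bar>i\<bar> \<le> int m \<longrightarrow> (ca R ^^ t) ?y i = ?y i" for m
      using x(3)[of m] unfolding conj[OF x(1)] by metis
    ultimately have "?y \<in> ?N" unfolding nonwandering_iff by blast
    moreover have "map e (start_word ?full w) = map (\<lambda>i. ?y (int i)) [0..<w + 3]"
      by (rule nth_equalityI) (simp_all add: start_word_nth(5) x(2))
    ultimately show "word_code k (map e (start_word ?full w)) \<in> language k ?N"
      unfolding language_def by (intro imageI CollectI exI[of _ ?y] exI[of _ "w + 3"] conjI)
  next
    assume "word_code k (map e (start_word ?full w)) \<in> language k ?N"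
    then obtain y n where y: "y \<in> ?N"
      and wc: "word_code k (map e (start_word ?full w)) = word_code k (map (\<lambda>i. y (int i)) [0..<n])"
      unfolding language_def by blast
    have ylt: "y i < k" for i using y by (simp add: nonwandering_iff full_shift_def)
    have eq: "map e (start_word ?full w) = map (\<lambda>i. y (int i)) [0..<n]"
    proof (rule word_code_inj[OF _ _ wc])
      have "e c < k" if "c \<in> set (start_word ?full w)" for c using that elt inA by blast
      then show "\<forall>a\<in>set (map e (start_word ?full w)). a < k" unfolding set_map by blast
    qed (use ylt in auto)
    then have n: "n = w + 3" by (metis length_map length_upt minus_nat.diff_0 start_word_nth(5))
    define x where "x i = dec (y i)" for i
    have xA: "x i \<in> ?A" for i unfolding x_def by (rule dec(1)[OF ylt])
    have ex: "(\<lambda>i. e (x i)) = y" unfolding x_def using dec(2)[OF ylt] by blast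
    have xs: "x (int i) = start_word ?full w ! i" if i: "i < w + 3" for i
    proof -
      have "y (int i) = map e (start_word ?full w) ! i" unfolding eq using i n by simp
      also have "\<dots> = e (start_word ?full w ! i)" using i start_word_nth(5)[of ?full w] by simp
      finally show ?thesis unfolding x_def
        using dec_e inA i start_word_nth(5)[of ?full w] by (metis nth_mem subsetD)
    qed
    have rec: "\<exists>t'\<ge>t. (glob ?full ^^ t') x 1 = x 1" for t
    proof -
      have "\<forall>m. \<exists>j\<ge>m. \<forall>i. \<bar>i\<bar> \<le> int m \<longrightarrow> (ca R ^^ j) y i = y i"
        using y unfolding nonwandering_iff by (rule conjunct2)
      \<comment> \<open>Only the return of cell 1 is passed on; the maximum with 1 puts that cell
        inside the window.\<close>
      from spec[OF this, of "max t 1"]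
      obtain t' where t': "t' \<ge> max t 1" "\<forall>i. \<bar>i\<bar> \<le> int (max t 1) \<longrightarrow> (ca R ^^ t') y i = y i" by blast
      have "(ca R ^^ t') y 1 = e ((glob ?full ^^ t') x 1)"
        using conj[of x t', OF xA] unfolding ex by (rule fun_cong)
      moreover have "(ca R ^^ t') y 1 = e (x 1)"
        using spec[OF t'(2), of 1] fun_cong[OF ex, of 1] by simp
      ultimately have "e ((glob ?full ^^ t') x 1) = e (x 1)" by (simp only:)
      then have "(glob ?full ^^ t') x 1 = x 1"
        by (rule inj_onD[OF inj _ glob_cells[of x ?full r t' 1, OF xA] xA])
      then show ?thesis using t'(1) by auto
    qed
    show "solvable E w" unfolding Es[symmetric]
      by (rule recurrent_solvable[OF bdy_def[symmetric] xs rec])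
  qed
  \<comment> \<open>Alphabet, prefix and suffix depend on \<open>E\<close> alone, so the word is a
    computable function of \<open>w\<close>.\<close>
  moreover have "map e (start_word ?full w) = map e (take 2 (start_word ?full 0)) @
      replicate w (e (One 0, False, {}, Lt)) @ [e (One 1, False, {}, Lt)]" for w
    by (simp add: start_word_def)
  ultimately have "solvable E w \<longleftrightarrow> word_code k (map e (take 2 (start_word ?full 0)) @
      replicate w (e (One 0, False, {}, Lt)) @ [e (One 1, False, {}, Lt)]) \<in> language k ?N" for w
    by (simp only:)
  then show ?thesis
    by - (rule exI[of _ k], rule exI[of _ R], rule exI[of _ "map e (take 2 (start_word ?full 0))"],
      rule exI[of _ "e (One 0, False, {}, Lt)"], rule exI[of _ "[e (One 1, False, {}, Lt)]"],
      intro conjI allI impI k R)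
qed

lemma orec_word_code: "orec (\<lambda>C xs. word_code k (u @ replicate (arg xs 0) a @ v))"
proof (induction u)
  case Nil
  have "word_code k (replicate n a @ v) = ((\<lambda>x. Suc a + k * x) ^^ n) (word_code k v)" for n
    by (induction n) auto
  moreover have "orec (\<lambda>C xs. ((\<lambda>x. Suc a + k * x) ^^ arg xs 0) (word_code k v))"
    by (rule orec_funpow) (intro orec_intros)+
  ultimately show ?case by simp
next
  case (Cons b u)
  have "orec (\<lambda>C xs. Suc b + k * word_code k (u @ replicate (arg xs 0) a @ v))"
    by (intro orec_add orec_mult orec_const Cons)
  then show ?case by simp
qed

lemma complete_language_exists:
  "\<exists>k f. 0 < k \<and> cellular_automaton k f \<and> Sigma11_complete (language k (nonwandering f (full_shift k)))"
proof -
  obtain E where E: "finite E" "\<And>w. w \<in> universal \<longleftrightarrow> solvable E w" using universal_solvable by blast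
  obtain k R u a v where k: "0 < k" and R: "\<forall>a b c. a < k \<longrightarrow> b < k \<longrightarrow> c < k \<longrightarrow> R a b c < k"
    and red: "\<And>w. solvable E w \<longleftrightarrow>
      word_code k (u @ replicate w a @ v) \<in> language k (nonwandering (ca R) (full_shift k))"
    using automaton_for_system[OF E(1)] by blast
  let ?L = "language k (nonwandering (ca R) (full_shift k))"
  have "many_one_reducible universal ?L"
    by (rule many_one_reducibleI[OF orec_word_code[of k u a v]]) (simp_all add: E(2) red)
  then have "\<And>Q. Sigma11 Q \<Longrightarrow> many_one_reducible Q ?L"
    using many_one_reducible_trans reducible_universal by blast
  moreover have "Sigma11 ?L" using Sigma11_language_ca[OF k] R by blast
  moreover have "cellular_automaton k (ca R)" using cellular_automaton_ca R by blast
  ultimately show ?thesis using k unfolding Sigma11_complete_def by blast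
qed

theorem theorem3:
  shows "(\<forall>P. Sigma11 P \<longrightarrow>
            (\<exists>k f. 0 < k \<and> cellular_automaton k f \<and>
               many_one_reducible P (language k (nonwandering f (full_shift k)))))
       \<and> (\<exists>k f. 0 < k \<and> cellular_automaton k f \<and>
               Sigma11_complete (language k (nonwandering f (full_shift k))))"
  \<comment> \<open>One automaton, that of the universal system, serves every
    \<open>P\<close>.\<close>
  using complete_language_exists unfolding Sigma11_complete_def by blast

end
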